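(* Let $g\ge0$, $n\ge1$ with $2-2g-n<0$ and $(g,n)\ne(0,3)$. If the cluster algebra $\mathcal{A}(\Sigma_{g,n})$ is not finitely generated, then $\mathcal{A}(\Sigma_{g,n})\neq\mathcal{U}(\Sigma_{g,n})$. In particular, for every $n\ge1$, $\mathcal{A}(\Sigma_{1,n})\ne\mathcal{U}(\Sigma_{1,n})$.
   Context: $\Sigma_{g,n}=\overline\Sigma_g\setminus V$ with $V$ a set of $n$ punctures in a closed oriented genus-$g$ surface. Fix an ideal triangulation $T$ (maximal collection of distinct pairwise non-crossing isotopy classes of simple, non-contractible arcs between punctures not bounding an unpunctured monogon) without self-folded triangles, with edges $e_1,\dots,e_m$, $m=6g-6+3n$, and exchange matrix $B=\sum_\Delta B^\Delta$ over triangles, $b^\Delta_{ij}=1$ (resp. $-1$) if $e_j$ follows $e_i$ clockwise (resp. counterclockwise) in $\Delta$, $0$ otherwise. In $\mathcal F=\mathbb Q(x_1,\dots,x_m)$, seeds $(\mathbf y,C)$ mutate by $y_ky_k'=\prod_{c_{jk}>0}y_j^{c_{jk}}+\prod_{c_{jk}<0}y_j^{-c_{jk}}$ and $c'_{ij}=-c_{ij}$ if $k\in\{i,j\}$, else $c'_{ij}=c_{ij}+\frac12(|c_{ik}|c_{kj}+c_{ik}|c_{kj}|)$. The cluster algebra $\mathcal A(\Sigma_{g,n})$ is the subring of $\mathcal F$ generated by all cluster variables of seeds mutation-equivalent to $((x_1,\dots,x_m),B)$. The upper cluster algebra is $\mathcal U(\Sigma_{g,n})=\bigcap_{(\mathbf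 y,C)}\mathbb Z[y_1^{\pm1},\dots,y_m^{\pm1}]\subset\mathcal F$, the intersection over all seeds $(\mathbf y,C)$ mutation-equivalent to the initial one. (Coefficients are $\mathbb Z$.) *)

theory Defs
  imports Complex_Main "HOL-Library.Poly_Mapping" "HOL-Computational_Algebra.Fraction_Field"
begin

section \<open>The ambient field Q(x_0,...,x_{m-1})\<close>

text \<open>Multivariate polynomials over Q in variables indexed by nat (monomials are
finitely supported exponent vectors), and their fraction field.\<close>

type_synonym mpoly_rat = "(nat \<Rightarrow>\<^sub>0 nat) \<Rightarrow>\<^sub>0 rat"
type_synonym ratfun = "mpoly_rat fract"

definition var :: "nat \<Rightarrow> ratfun" where
  "var i = Fract (Poly_Mapping.single (Poly_Mapping.single i 1) 1) 1"

section \<open>Combinatorial ideal triangulations of punctured surfaces\<close>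

text \<open>A triangulation with F triangles and m edges (arcs) is given by a labelling
  lab t s (t < F, s < 3) of the sides of the triangles by edge labels < m.
  Side s of triangle t runs counterclockwise from corner s to corner (s+1) mod 3.
  Two sides with the same label are glued (orientation reversingly), so that the
  result is an oriented closed surface; vertices (punctures) are the classes of
  corners under the induced identification.\<close>

definition sides :: "nat \<Rightarrow> (nat \<times> nat) set" where
  "sides F = {(t, s). t < F \<and> s < 3}"

definition corner_rel :: "nat \<Rightarrow> (nat \<Rightarrow> nat \<Rightarrow> nat) \<Rightarrow> ((nat \<times> nat) \<times> (nat \<times> nat)) set" where
  "corner_rel F lab = {((t, s), (t', (s' + 1) mod 3)) | t s t' s'.
      (t, s) \<in> sides F \<and> (t', s') \<in> sides F \<and> (t, s) \<noteq> (t', s') \<and> lab t s = lab t' s'}"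

definition num_vertices :: "nat \<Rightarrow> (nat \<Rightarrow> nat \<Rightarrow> nat) \<Rightarrow> nat" where
  "num_vertices F lab = card (sides F // ((corner_rel F lab \<union> (corner_rel F lab)\<inverse>)\<^sup>*))"

definition tri_adj :: "nat \<Rightarrow> (nat \<Rightarrow> nat \<Rightarrow> nat) \<Rightarrow> (nat \<times> nat) set" where
  "tri_adj F lab = {(t, t'). t < F \<and> t' < F \<and> (\<exists>s s'. s < 3 \<and> s' < 3 \<and> lab t s = lab t' s')}"

text \<open>An ideal triangulation without self-folded triangles of the connected closed
  oriented genus-g surface with n punctures.\<close>

definition is_triangulation ::
  "nat \<Rightarrow> nat \<Rightarrow> nat \<Rightarrow> nat \<Rightarrow> (nat \<Rightarrow> nat \<Rightarrow> nat) \<Rightarrow> bool" where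
  "is_triangulation g n F m lab \<longleftrightarrow>
     (\<forall>t s. t < F \<and> s < 3 \<longrightarrow> lab t s < m) \<and>
     (\<forall>e < m. card {(t, s). t < F \<and> s < 3 \<and> lab t s = e} = 2) \<and>
     (\<forall>t < F. lab t 0 \<noteq> lab t 1 \<and> lab t 1 \<noteq> lab t 2 \<and> lab t 0 \<noteq> lab t 2) \<and>
     (\<forall>t < F. \<forall>t' < F. (t, t') \<in> (tri_adj F lab)\<^sup>*) \<and>
     num_vertices F lab = n \<and>
     int n - int m + int F = 2 - 2 * int g"

text \<open>Exchange matrix B = sum over triangles of B^Delta; b_ij^Delta = 1 if e_j follows
  e_i clockwise in Delta (i.e. e_i = side s+1, e_j = side s), -1 if counterclockwise.\<close>

definition exch_matrix :: "nat \<Rightarrow> (nat \<Rightarrow> nat \<Rightarrow> nat) \<Rightarrow> nat \<Rightarrow> nat \<Rightarrow> int" where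
  "exch_matrix F lab i j =
     (\<Sum>t<F. \<Sum>s<3.
        (if lab t ((s + 1) mod 3) = i \<and> lab t s = j then 1 else 0)
      - (if lab t s = i \<and> lab t ((s + 1) mod 3) = j then 1 else 0))"

section \<open>Seeds, mutation, cluster algebra, upper cluster algebra\<close>

type_synonym seed = "(nat \<Rightarrow> ratfun) \<times> (nat \<Rightarrow> nat \<Rightarrow> int)"

definition mutate :: "nat \<Rightarrow> nat \<Rightarrow> seed \<Rightarrow> seed" where
  "mutate m k S = (let y = fst S; C = snd S in
     ((\<lambda>i. if i = k then
            ((\<Prod>j\<in>{j. j < m \<and> C j k > 0}. y j ^ nat (C j k))
             + (\<Prod>j\<in>{j. j < m \<and> C j k < 0}. y j ^ nat (- C j k))) / y k
          else y i),
      (\<lambda>i j. if k = i \<or> k = j then - C i j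
             else C i j + (\<bar>C i k\<bar> * C k j + C i k * \<bar>C k j\<bar>) div 2)))"

inductive_set seeds :: "nat \<Rightarrow> (nat \<Rightarrow> nat \<Rightarrow> int) \<Rightarrow> seed set"
  for m :: nat and B :: "nat \<Rightarrow> nat \<Rightarrow> int" where
  init: "(var, B) \<in> seeds m B"
| mut: "S \<in> seeds m B \<Longrightarrow> k < m \<Longrightarrow> mutate m k S \<in> seeds m B"

text \<open>Subring (with Z-coefficients) generated by a set.\<close>

inductive_set subring_gen :: "ratfun set \<Rightarrow> ratfun set" for X :: "ratfun set" where
  gen: "x \<in> X \<Longrightarrow> x \<in> subring_gen X"
| one: "1 \<in> subring_gen X"
| neg: "x \<in> subring_gen X \<Longrightarrow> - x \<in> subring_gen X"
| add: "x \<in> subring_gen X \<Longrightarrow> y \<in> subring_gen X \<Longrightarrow> x + y \<in> subring_gen X"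
| mult: "x \<in> subring_gen X \<Longrightarrow> y \<in> subring_gen X \<Longrightarrow> x * y \<in> subring_gen X"

definition cluster_algebra :: "nat \<Rightarrow> (nat \<Rightarrow> nat \<Rightarrow> int) \<Rightarrow> ratfun set" where
  "cluster_algebra m B = subring_gen {fst S i | S i. S \<in> seeds m B \<and> i < m}"

text \<open>Laurent polynomial ring Z[y_0^{+-1},...,y_{m-1}^{+-1}] inside the field.\<close>

definition laurent_ring :: "nat \<Rightarrow> (nat \<Rightarrow> ratfun) \<Rightarrow> ratfun set" where
  "laurent_ring m y = subring_gen ({y i | i. i < m} \<union> {inverse (y i) | i. i < m})"

definition upper_cluster_algebra :: "nat \<Rightarrow> (nat \<Rightarrow> nat \<Rightarrow> int) \<Rightarrow> ratfun set" where
  "upper_cluster_algebra m B = (\<Inter>S\<in>seeds m B. laurent_ring m (fst S))"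

definition finitely_generated_ring :: "ratfun set \<Rightarrow> bool" where
  "finitely_generated_ring R \<longleftrightarrow> (\<exists>X. finite X \<and> X \<subseteq> R \<and> subring_gen X = R)"

end

theory Submission
  imports Defs "HOL-Library.Product_Plus" "HOL-Library.Z2"
    "HOL-Computational_Algebra.Formal_Laurent_Series" "HOL-Combinatorics.Transposition"
begin

text \<open>Lambda lengths of arcs are realised as determinants of vectors that are moved by the holonomy
  group \<open>G\<close> of a decorated hyperbolic structure with entries in the ambient field. Let the skein
  ring be generated by the traces of \<open>G\<close> and by the determinants of \<open>A x\<close> and \<open>y\<close>, where
  \<open>A \<in> G\<close> and \<open>x\<close>, \<open>y\<close> are puncture vectors with either tag. It contains all cluster variables. The
  vectors of any ideal triangulation span a \<open>G\<close>-invariant lattice over its Laurent ring, so the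
  skein ring lies in the upper cluster algebra. It is finitely generated by the Cayley--Hamilton
  identity; hence \<open>A = U\<close> would force the cluster algebra to be finitely generated.

  In positive genus, the skein ring is evaluated in characteristic two at a degenerate structure
  with a nontrivial diagonal holonomy on the closed surface and all horocycle lengths zero. Up to a
  scaling parameter that tends to zero, notched arcs vanish and plain arcs are small, so the
  cluster algebra reduces to the field with two elements, whereas some trace does not.\<close>

section \<open>Two-by-two matrices\<close>

text \<open>Mutation leads to self-folded triangles, but tagged triangulations are never formed: a
  seed is described by an ordinary triangulation, possibly with self-folded triangles, whose lambda
  lengths are monomials with exponents \<open>EE\<close> in the variables. A variable on a radius is
  mutated after the tags at the enclosed puncture have been exchanged. The gluing sign puts
  \<open>- 1\<close> into the holonomy group. In characteristic two it disappears, so that integer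
  periods alone define a diagonal holonomy; moreover the contributions to each horocycle length then
  cancel in pairs. The eigenvalue of the holonomy must survive when the scaling parameter tends to
  zero, hence two nested variables of Laurent series. All arcs of the triangulation used for the
  evaluation need a nonzero period, since an arc of period zero gets lambda length zero, which
  cannot be inverted. Arcs on which every cocycle vanishes are therefore flipped away beforehand.
  The evaluation is a relation between two fields and not a map, because it makes sense on one
  Laurent ring only.\<close>

datatype 'a mat2 = Mat2 'a 'a 'a 'a

instantiation mat2 :: (comm_ring_1) ring_1
begin

definition "0 = Mat2 0 0 0 0"
definition "1 = Mat2 1 0 0 1"
fun plus_mat2 where
  "Mat2 a b c d + Mat2 a' b' c' d' = Mat2 (a + a') (b + b') (c + c') (d + d')"
fun uminus_mat2 where "- Mat2 a b c d = Mat2 (- a) (- b) (- c) (- d)"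
definition "A - B = A + - (B :: 'a mat2)"
fun times_mat2 where
  "Mat2 a b c d * Mat2 a' b' c' d' =
     Mat2 (a * a' + b * c') (a * b' + b * d') (c * a' + d * c') (c * b' + d * d')"

instance
proof
  fix A B C :: "'a mat2"
  show "A + B + C = A + (B + C)" "A + B = B + A" "A * B * C = A * (B * C)"
    "(A + B) * C = A * C + B * C" "A * (B + C) = A * B + A * C"
    by (cases A; cases B; cases C; simp add: algebra_simps)+
  show "0 + A = A" "- A + A = 0" "1 * A = A" "A * 1 = A" "A - B = A + - B"
    by (cases A; simp add: zero_mat2_def one_mat2_def minus_mat2_def)+
  show "(0 :: 'a mat2) \<noteq> 1"
    by (simp add: zero_mat2_def one_mat2_def)
qed

end

fun tr :: "'a::comm_ring_1 mat2 \<Rightarrow> 'a" where "tr (Mat2 a b c d) = a + d"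
fun det2 :: "'a::comm_ring_1 mat2 \<Rightarrow> 'a" where "det2 (Mat2 a b c d) = a * d - b * c"
fun adj :: "'a::comm_ring_1 mat2 \<Rightarrow> 'a mat2" where "adj (Mat2 a b c d) = Mat2 d (- b) (- c) a"
fun smat :: "'a::comm_ring_1 \<Rightarrow> 'a mat2 \<Rightarrow> 'a mat2" where
  "smat k (Mat2 a b c d) = Mat2 (k * a) (k * b) (k * c) (k * d)"
fun mv :: "'a::comm_ring_1 mat2 \<Rightarrow> 'a \<times> 'a \<Rightarrow> 'a \<times> 'a" where
  "mv (Mat2 a b c d) (x, y) = (a * x + b * y, c * x + d * y)"
fun dt :: "'a::comm_ring_1 \<times> 'a \<Rightarrow> 'a \<times> 'a \<Rightarrow> 'a" where
  "dt (a, b) (c, d) = a * d - b * c"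
fun sv :: "'a::comm_ring_1 \<Rightarrow> 'a \<times> 'a \<Rightarrow> 'a \<times> 'a" where
  "sv k (x, y) = (k * x, k * y)"

lemma mv_mult: "mv (A * B) v = mv A (mv B v)"
  by (cases A; cases B; cases v) (simp add: algebra_simps)

lemma mv_one [simp]: "mv 1 v = v"
  by (cases v) (simp add: one_mat2_def)

lemma mv_uminus: "mv (- A) v = - mv A v"
  by (cases A; cases v) simp

lemma mv_minus [simp]: "mv A (- v) = - mv A v"
  by (cases A; cases v) simp

lemma mv_sv: "mv A (sv k v) = sv k (mv A v)"
  by (cases A; cases v) (simp add: algebra_simps)

lemma sv_sv: "sv k (sv l v) = sv (k * l) v"
  by (cases v) (simp add: algebra_simps)

lemma sv_one [simp]: "sv 1 v = v"
  by (cases v) simp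

lemma dt_minus_left [simp]: "dt (- v) w = - dt v w"
  by (cases v; cases w) simp

lemma dt_minus_right [simp]: "dt v (- w) = - dt v w"
  by (cases v; cases w) simp

lemma dt_sv_left: "dt (sv k v) w = k * dt v w"
  by (cases v; cases w) (simp add: algebra_simps)

lemma dt_sv_right: "dt v (sv k w) = k * dt v w"
  by (cases v; cases w) (simp add: algebra_simps)

lemma dt_swap: "dt v w = - dt w v"
  by (cases v; cases w) (simp add: algebra_simps)

lemma dt_self [simp]: "dt v v = 0"
  by (cases v) (simp add: algebra_simps)

lemma dt_mv: "dt (mv A v) (mv A w) = det2 A * dt v w"
  by (cases A; cases v; cases w) (simp add: algebra_simps)

lemma dt_adj: "dt (mv A v) w = dt v (mv (adj A) w)"
  by (cases A; cases v; cases w) (simp add: algebra_simps)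

lemma det2_mult: "det2 (A * B) = det2 A * det2 B"
  by (cases A; cases B) (simp add: algebra_simps)

lemma det2_one [simp]: "det2 1 = 1"
  by (simp add: one_mat2_def)

lemma det2_uminus [simp]: "det2 (- A) = det2 A"
  by (cases A) simp

lemma det2_adj [simp]: "det2 (adj A) = det2 A"
  by (cases A) (simp add: algebra_simps)

lemma adj_right: "det2 A = 1 \<Longrightarrow> A * adj A = 1"
  by (cases A) (simp add: one_mat2_def algebra_simps)

lemma adj_left: "det2 A = 1 \<Longrightarrow> adj A * A = 1"
  by (cases A) (simp add: one_mat2_def algebra_simps)

lemma adj_mult: "adj (A * B) = adj B * adj A"
  by (cases A; cases B) (simp add: algebra_simps)

lemma adj_adj [simp]: "adj (adj A) = A"
  by (cases A) simp

lemma adj_uminus: "adj (- A) = - adj A"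
  by (cases A) simp

lemma adj_one [simp]: "adj 1 = 1"
  by (simp add: one_mat2_def)

lemma mv_adj_left [simp]: "det2 A = 1 \<Longrightarrow> mv (adj A) (mv A v) = v"
  by (metis adj_left mv_mult mv_one)

lemma mv_adj_right [simp]: "det2 A = 1 \<Longrightarrow> mv A (mv (adj A) v) = v"
  by (metis adj_right mv_mult mv_one)

lemma tr_dt: "tr A * dt v w = dt (mv A v) w + dt v (mv A w)"
  by (cases A; cases v; cases w) (simp add: algebra_simps)

text \<open>Three vectors of the plane are dependent; pairing their dependence with \<open>x\<close>
  gives this Pluecker relation. It yields the Ptolemy relation of a flip and the expansions of
  vectors in a frame.\<close>

lemma dt_plucker: "dt x a * dt b c + dt x b * dt c a + dt x c * dt a b = 0"
  by (cases x; cases a; cases b; cases c) (simp add: algebra_simps)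

lemma ex_mat2_frame:
  fixes p q p' q' :: "'a::field \<times> 'a"
  assumes "dt p q = dt p' q'" "dt p q \<noteq> 0"
  shows "\<exists>A. det2 A = 1 \<and> mv A p' = p \<and> mv A q' = q"
proof -
  obtain a b c d a' b' c' d' where e: "p = (a, b)" "q = (c, d)" "p' = (a', b')" "q' = (c', d')"
    by (metis surj_pair)
  define D where "D = a * d - b * c"
  have D: "D \<noteq> 0" "a' * d' - b' * c' = D"
    using assms e by (auto simp: D_def)
  \<comment> \<open>The matrix with columns \<open>p\<close>, \<open>q\<close> times the inverse of
    the matrix with columns \<open>p'\<close>, \<open>q'\<close>; both have determinant
    \<open>D\<close>.\<close>
  define A where "A = Mat2 ((a * d' - c * b') / D) ((c * a' - a * c') / D)
      ((b * d' - d * b') / D) ((d * a' - b * c') / D)"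
  have "(a * d' - c * b') * (d * a' - b * c') - (c * a' - a * c') * (b * d' - d * b')
      = (a * d - b * c) * (a' * d' - b' * c')"
    by (simp add: algebra_simps)
  also have "\<dots> = D * D" using D D_def by simp
  finally have "det2 A = 1"
    using D by (simp add: A_def diff_divide_distrib [symmetric])
  moreover have "mv A p' = p"
  proof -
    have "(a * d' - c * b') * a' + (c * a' - a * c') * b' = a * (a' * d' - b' * c')"
      "(b * d' - d * b') * a' + (d * a' - b * c') * b' = b * (a' * d' - b' * c')"
      by (simp_all add: algebra_simps)
    then show ?thesis
      using D by (simp add: A_def e add_divide_distrib [symmetric])
  qed
  moreover have "mv A q' = q"
  proof -
    have "(a * d' - c * b') * c' + (c * a' - a * c') * d' = c * (a' * d' - b' * c')"
      "(b * d' - d * b') * c' + (d * a' - b * c') * d' = d * (a' * d' - b' * c')"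
      by (simp_all add: algebra_simps)
    then show ?thesis
      using D by (simp add: A_def e add_divide_distrib [symmetric])
  qed
  ultimately show ?thesis by blast
qed

lemma dt_eq_imp_eq:
  fixes x y p q :: "'a::field \<times> 'a"
  assumes "dt p q \<noteq> 0" "dt x p = dt y p" "dt x q = dt y q"
  shows "x = y"
proof -
  obtain a b c d x1 x2 y1 y2 where e: "p = (a, b)" "q = (c, d)" "x = (x1, x2)" "y = (y1, y2)"
    by (metis surj_pair)
  have h: "(x1 - y1) * b = (x2 - y2) * a" "(x1 - y1) * d = (x2 - y2) * c" "a * d - b * c \<noteq> 0"
    using assms by (auto simp: e algebra_simps)
  have "(x1 - y1) * (a * d - b * c) = a * ((x1 - y1) * d) - c * ((x1 - y1) * b)"
    by (simp add: algebra_simps)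
  also have "\<dots> = 0" unfolding h(1,2) by (simp add: algebra_simps)
  finally have "x1 = y1" using h(3) by simp
  moreover have "(x2 - y2) * (a * d - b * c) = d * ((x2 - y2) * a) - b * ((x2 - y2) * c)"
    by (simp add: algebra_simps)
  then have "(x2 - y2) * (a * d - b * c) = 0"
    unfolding h(1,2) [symmetric] by (simp add: algebra_simps)
  then have "x2 = y2" using h(3) by simp
  ultimately show ?thesis by (simp add: e)
qed

section \<open>Finite generation of rings of invariants\<close>

definition is_subring :: "'a::comm_ring_1 set \<Rightarrow> bool" where
  "is_subring C \<longleftrightarrow> 1 \<in> C \<and> (\<forall>x\<in>C. - x \<in> C) \<and> (\<forall>x\<in>C. \<forall>y\<in>C. x + y \<in> C \<and> x * y \<in> C)"

lemma is_subringD: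
  assumes "is_subring C"
  shows "1 \<in> C" "0 \<in> C" "x \<in> C \<Longrightarrow> - x \<in> C" "x \<in> C \<Longrightarrow> y \<in> C \<Longrightarrow> x + y \<in> C"
    "x \<in> C \<Longrightarrow> y \<in> C \<Longrightarrow> x * y \<in> C" "x \<in> C \<Longrightarrow> y \<in> C \<Longrightarrow> x - y \<in> C"
proof -
  show a: "1 \<in> C" "x \<in> C \<Longrightarrow> - x \<in> C" "x \<in> C \<Longrightarrow> y \<in> C \<Longrightarrow> x + y \<in> C"
    "x \<in> C \<Longrightarrow> y \<in> C \<Longrightarrow> x * y \<in> C" for x y
    using assms unfolding is_subring_def by auto
  show "0 \<in> C" using a(1) a(2) a(3) by (metis add.right_inverse)
  show "x \<in> C \<Longrightarrow> y \<in> C \<Longrightarrow> x - y \<in> C" using a(2) [of y] a(3) [of x "- y"] by auto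
qed

lemma is_subring_subring_gen [simp]: "is_subring (subring_gen X)"
  unfolding is_subring_def
  by (auto intro: subring_gen.intros)

lemma subring_gen_least:
  assumes "is_subring C" "X \<subseteq> C"
  shows "subring_gen X \<subseteq> C"
proof
  fix x assume "x \<in> subring_gen X"
  then show "x \<in> C"
    by induction (use assms is_subringD in auto)
qed

lemma subring_gen_mono: "X \<subseteq> subring_gen Y \<Longrightarrow> subring_gen X \<subseteq> subring_gen Y"
  by (rule subring_gen_least) auto

lemma is_subring_prod:
  assumes "is_subring C" "\<And>i. i \<in> I \<Longrightarrow> f i \<in> C"
  shows "prod f I \<in> C"
  using assms(2) by (induction I rule: infinite_finite_induct) (auto intro: is_subringD [OF assms(1)])

lemma is_subring_sum:
  assumes "is_subring C" "\<And>i. i \<in> I \<Longrightarrow> f i \<in> C"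
  shows "sum f I \<in> C"
  using assms(2) by (induction I rule: infinite_finite_induct) (auto intro: is_subringD [OF assms(1)])

lemma is_subring_power:
  assumes "is_subring C" "x \<in> C"
  shows "x ^ n \<in> C"
  by (induction n) (auto intro: is_subringD [OF assms(1)] assms(2))

section \<open>Words in matrices and the modules they span\<close>

inductive_set mat_monoid :: "'a::comm_ring_1 mat2 set \<Rightarrow> 'a mat2 set" for S where
  one: "1 \<in> mat_monoid S"
| mult: "g \<in> S \<Longrightarrow> A \<in> mat_monoid S \<Longrightarrow> g * A \<in> mat_monoid S"

lemma mat_monoid_mult:
  "A \<in> mat_monoid S \<Longrightarrow> B \<in> mat_monoid S \<Longrightarrow> A * B \<in> mat_monoid S"
  by (induction rule: mat_monoid.induct) (auto simp: mult.assoc intro: mat_monoid.intros)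

lemma mat_monoid_gen: "g \<in> S \<Longrightarrow> g \<in> mat_monoid S"
  using mat_monoid.mult [OF _ mat_monoid.one] by simp

lemma mat_monoid_mono: "A \<in> mat_monoid S \<Longrightarrow> S \<subseteq> T \<Longrightarrow> A \<in> mat_monoid T"
  by (induction rule: mat_monoid.induct) (auto intro: mat_monoid.intros)

lemma det2_mat_monoid:
  "A \<in> mat_monoid S \<Longrightarrow> (\<And>g. g \<in> S \<Longrightarrow> det2 g = 1) \<Longrightarrow> det2 A = 1"
  by (induction rule: mat_monoid.induct) (auto simp: det2_mult)

inductive_set mat_span :: "'a::comm_ring_1 set \<Rightarrow> 'a mat2 set \<Rightarrow> 'a mat2 set" for C B where
  zero: "0 \<in> mat_span C B"
| step: "b \<in> B \<Longrightarrow> c \<in> C \<Longrightarrow> A \<in> mat_span C B \<Longrightarrow> smat c b + A \<in> mat_span C B"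

lemma smat_simps:
  "smat c 0 = 0" "smat c (A + B) = smat c A + smat c B" "smat c (smat d A) = smat (c * d) A"
  "smat 1 A = A" "smat (- 1) A = - A" "smat c A * B = smat c (A * B)" "A * smat c B = smat c (A * B)"
  by (cases A; cases B; simp add: zero_mat2_def algebra_simps)+

lemma tr_simps: "tr 0 = 0" "tr (A + B) = tr A + tr B" "tr (smat c A) = c * tr A"
  "tr (- A) = - tr A"
  by (cases A; cases B; simp add: zero_mat2_def algebra_simps)+

lemma dt_mv_simps: "dt (mv 0 v) w = 0" "dt (mv (A + B) v) w = dt (mv A v) w + dt (mv B v) w"
  "dt (mv (smat c A) v) w = c * dt (mv A v) w"
  by (cases A; cases B; cases v; cases w; simp add: zero_mat2_def algebra_simps)+

lemma mat_span_add: "A \<in> mat_span C B \<Longrightarrow> A' \<in> mat_span C B \<Longrightarrow> A + A' \<in> mat_span C B"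
  by (induction rule: mat_span.induct) (auto simp: add.assoc intro: mat_span.intros)

lemma mat_span_smat:
  assumes "is_subring C"
  shows "A \<in> mat_span C B \<Longrightarrow> c \<in> C \<Longrightarrow> smat c A \<in> mat_span C B"
  by (induction rule: mat_span.induct)
    (auto simp: smat_simps intro!: mat_span.intros is_subringD(5) [OF assms])

lemma mat_span_uminus:
  assumes "is_subring C" "A \<in> mat_span C B"
  shows "- A \<in> mat_span C B"
  using mat_span_smat [OF assms(1,2), of "- 1"] is_subringD(1,3) [OF assms(1)]
  by (auto simp: smat_simps)

lemma mat_span_diff:
  assumes "is_subring C" "A \<in> mat_span C B" "A' \<in> mat_span C B"
  shows "A - A' \<in> mat_span C B"
  using mat_span_add [OF assms(2) mat_span_uminus [OF assms(1,3)]] by simp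

lemma mat_span_gen:
  assumes "is_subring C" "b \<in> B"
  shows "b \<in> mat_span C B"
  using mat_span.step [OF assms(2) is_subringD(1) [OF assms(1)] mat_span.zero]
  by (simp add: smat_simps)

lemma mat_span_mult_left:
  assumes C: "is_subring C" and B: "\<And>b. b \<in> B \<Longrightarrow> A * b \<in> mat_span C B'"
    and X: "X \<in> mat_span C B"
  shows "A * X \<in> mat_span C B'"
  using X
  by (induction rule: mat_span.induct)
    (auto simp: distrib_left smat_simps intro!: mat_span.zero mat_span_add mat_span_smat [OF C] B)

lemma mat_span_mult_right:
  assumes C: "is_subring C" and B: "\<And>b. b \<in> B \<Longrightarrow> b * A \<in> mat_span C B'"
    and X: "X \<in> mat_span C B"
  shows "X * A \<in> mat_span C B'"
  using X
  by (induction rule: mat_span.induct)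
    (auto simp: distrib_right smat_simps intro!: mat_span.zero mat_span_add mat_span_smat [OF C] B)

text \<open>Polarised Cayley--Hamilton: apply \<open>mat2_square\<close> to \<open>g + h\<close> and
  remove the squares. A letter moves past another at the price of scalars made of traces.\<close>

lemma mat2_anticommute:
  "g * h = - (h * g) + smat (tr g) h + smat (tr h) g + smat (tr (g * h) - tr g * tr h) 1"
  for g h :: "'a::comm_ring_1 mat2"
  by (cases g; cases h) (simp add: one_mat2_def algebra_simps)

lemma mat2_square: "g * g = smat (tr g) g + - smat (det2 g) 1" for g :: "'a::comm_ring_1 mat2"
  by (cases g) (simp add: one_mat2_def algebra_simps)

text \<open>By the polarised Cayley--Hamilton identity, adjoining a matrix \<open>g\<close> to a matrix ring
  that is spanned by a finite set \<open>B\<close> gives a ring spanned by \<open>B \<union> B g\<close>.\<close>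

lemma finite_mat_span:
  assumes C: "is_subring C" and "finite S"
    and "\<And>g. g \<in> S \<Longrightarrow> det2 g = 1" "\<And>g. g \<in> S \<Longrightarrow> tr g \<in> C"
      "\<And>g h. g \<in> S \<Longrightarrow> h \<in> S \<Longrightarrow> tr (g * h) \<in> C"
  shows "\<exists>B. finite B \<and> B \<subseteq> mat_monoid S \<and> 1 \<in> mat_span C B \<and> S \<subseteq> mat_span C B \<and>
    (\<forall>X\<in>mat_span C B. \<forall>Y\<in>mat_span C B. X * Y \<in> mat_span C B)"
  using assms(2-)
proof (induction S rule: finite_induct)
  case empty
  have "b * c \<in> mat_span C {1}" if "b \<in> mat_span C {1}" "c \<in> mat_span C {1}" for b c
    using that mat_span_mult_right [OF C, of "{1}" c "{1}"] by auto
  then show ?case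
    by (intro exI [of _ "{1}"]) (auto intro: mat_span_gen [OF C] mat_monoid.one)
next
  case (insert g S)
  then obtain B where B: "finite B" "B \<subseteq> mat_monoid S" "1 \<in> mat_span C B" "S \<subseteq> mat_span C B"
    "\<And>X Y. X \<in> mat_span C B \<Longrightarrow> Y \<in> mat_span C B \<Longrightarrow> X * Y \<in> mat_span C B"
    by auto
  define B' where "B' = B \<union> (\<lambda>b. b * g) ` B"
  let ?W = "mat_span C B" and ?W' = "mat_span C B'"
  have tg: "tr g \<in> C" "det2 g = 1" using insert.prems by auto
  have W: "w \<in> ?W'" if "w \<in> ?W" for w
    using mat_span_mult_right [OF C, of B 1 B', OF _ that] mat_span_gen [OF C, of _ B']
    by (auto simp: B'_def)
  have Wg: "w * g \<in> ?W'" if "w \<in> ?W" for w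
    using mat_span_mult_right [OF C, of B g B', OF _ that] mat_span_gen [OF C, of _ B']
    by (auto simp: B'_def)
  have WW': "w * x \<in> ?W'" if "w \<in> ?W" "x \<in> ?W'" for w x
  proof (rule mat_span_mult_left [OF C _ that(2)])
    fix b assume "b \<in> B'"
    then consider "b \<in> B" | b' where "b' \<in> B" "b = b' * g" by (auto simp: B'_def)
    then show "w * b \<in> ?W'"
    proof cases
      case 1
      then show ?thesis using W B(5) [OF that(1)] mat_span_gen [OF C] by blast
    next
      case 2
      then show ?thesis using Wg B(5) [OF that(1)] mat_span_gen [OF C]
        by (metis mult.assoc)
    qed
  qed
  \<comment> \<open>A leading \<open>g\<close> is pushed through the word one letter at a time; each
    resulting term is covered by the induction hypothesis or by the closure of the old span.\<close>
  have gM: "g * A \<in> ?W'" if "A \<in> mat_monoid S" for A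
    using that
  proof (induction rule: mat_monoid.induct)
    case one
    show ?case using Wg [OF B(3)] by simp
  next
    case (mult h A)
    have A: "A \<in> ?W" "h \<in> ?W" "h * A \<in> ?W"
    proof -
      show "h \<in> ?W" using mult B(4) by auto
      show "A \<in> ?W" using mult(2)
        by (induction rule: mat_monoid.induct) (use B in auto)
      with \<open>h \<in> ?W\<close> show "h * A \<in> ?W" using B(5) by auto
    qed
    have "g * (h * A) = (g * h) * A" by (simp add: mult.assoc)
    also have "\<dots> = - (h * (g * A)) + smat (tr g) (h * A) + smat (tr h) (g * A)
        + smat (tr (g * h) - tr g * tr h) A"
      by (subst mat2_anticommute) (simp add: algebra_simps smat_simps)
    finally show ?case
      using insert.prems mult A WW' [OF A(2) mult.IH] W [OF A(1)] W [OF A(3)]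
      by (auto intro!: mat_span_add mat_span_diff [OF C] mat_span_smat [OF C] is_subringD(5,6) [OF C])
  qed
  have gW: "g * w \<in> ?W'" if "w \<in> ?W" for w
    by (rule mat_span_mult_left [OF C _ that]) (use gM B(2) in auto)
  have W'g: "x * g \<in> ?W'" if "x \<in> ?W'" for x
  proof (rule mat_span_mult_right [OF C _ that])
    fix b assume "b \<in> B'"
    then consider "b \<in> B" | b' where "b' \<in> B" "b = b' * g" by (auto simp: B'_def)
    then show "b * g \<in> ?W'"
    proof cases
      case 1
      then show ?thesis using Wg mat_span_gen [OF C] by blast
    next
      case 2
      have "b * g = b' * (g * g)" by (simp add: 2 mult.assoc)
      also have "\<dots> = smat (tr g) (b' * g) + - b'"
        by (subst mat2_square) (simp add: tg distrib_left right_diff_distrib smat_simps)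
      finally show ?thesis
        using 2 tg W [OF mat_span_gen [OF C]] Wg [OF mat_span_gen [OF C]]
        by (auto intro!: mat_span_diff [OF C] mat_span_smat [OF C])
    qed
  qed
  have "X * Y \<in> ?W'" if X: "X \<in> ?W'" and "Y \<in> ?W'" for X Y
  proof (rule mat_span_mult_left [OF C _ \<open>Y \<in> ?W'\<close>])
    have Xb: "X * b \<in> ?W'" if "b \<in> B" for b
    proof (rule mat_span_mult_right [OF C _ X])
      fix x assume "x \<in> B'"
      then consider "x \<in> B" | b' where "b' \<in> B" "x = b' * g" by (auto simp: B'_def)
      then show "x * b \<in> ?W'"
      proof cases
        case 1
        then show ?thesis using W B(5) mat_span_gen [OF C] that by blast
      next
        case 2
        then show ?thesis using WW' gW mat_span_gen [OF C] that by (metis mult.assoc)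
      qed
    qed
    fix b assume "b \<in> B'"
    then show "X * b \<in> ?W'"
      using Xb W'g by (auto simp: B'_def simp flip: mult.assoc)
  qed
  moreover have "B' \<subseteq> mat_monoid (insert g S)"
    using B(2) mat_monoid_mono [of _ S "insert g S"] mat_monoid_mult mat_monoid_gen [of g "insert g S"]
    by (fastforce simp: B'_def)
  moreover have "insert g S \<subseteq> ?W'"
    using W B(4) Wg [OF B(3)] by auto
  ultimately show ?case
    using B(1) W [OF B(3)] by (intro exI [of _ B']) (auto simp: B'_def)
qed

definition inv_gens :: "ratfun mat2 set \<Rightarrow> (ratfun \<times> ratfun) set \<Rightarrow> ratfun set" where
  "inv_gens G E = tr ` G \<union> {dt (mv A a) b | A a b. A \<in> G \<and> a \<in> E \<and> b \<in> E}"

text \<open>Both \<open>tr A\<close> and \<open>dt (mv A a) b\<close> are linear in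
  \<open>A\<close>, and every word is a combination of a finite set \<open>B\<close> with
  coefficients in the ring of traces of one and two letters. So these traces and the values on
  \<open>B\<close> generate.\<close>

lemma finitely_generated_invariants:
  assumes S: "finite S" "\<And>g. g \<in> S \<Longrightarrow> det2 g = 1" and E: "finite E"
  shows "finitely_generated_ring (subring_gen (inv_gens (mat_monoid S) E))"
proof -
  let ?G = "mat_monoid S"
  define X0 where "X0 = tr ` S \<union> (\<lambda>(g, h). tr (g * h)) ` (S \<times> S)"
  define C where "C = subring_gen X0"
  have C: "is_subring C" by (simp add: C_def)
  have "tr g \<in> C" "tr (g * h) \<in> C" if "g \<in> S" "h \<in> S" for g h
    using that by (auto simp: C_def X0_def intro!: subring_gen.gen)
  then obtain B where B: "finite B" "B \<subseteq> ?G" "1 \<in> mat_span C B" "S \<subseteq> mat_span C B"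
    "\<forall>X\<in>mat_span C B. \<forall>Y\<in>mat_span C B. X * Y \<in> mat_span C B"
    using finite_mat_span [OF C S] by blast
  define X where "X = X0 \<union> tr ` B \<union> (\<lambda>(A, a, b). dt (mv A a) b) ` (B \<times> E \<times> E)"
  let ?R = "subring_gen X"
  have CR: "C \<subseteq> ?R"
    unfolding C_def by (rule subring_gen_mono) (auto simp: X_def intro: subring_gen.gen)
  have GB: "A \<in> mat_span C B" if "A \<in> ?G" for A
    using that by induction (use B in auto)
  have t: "tr A \<in> ?R" if "A \<in> mat_span C B" for A
    using that
  proof induction
    case (step b c A)
    have "tr b \<in> ?R" using step by (auto simp: X_def intro!: subring_gen.gen)
    then show ?case using step CR by (auto simp: tr_simps intro!: subring_gen.add subring_gen.mult)
  qed (simp add: tr_simps is_subringD)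
  have d: "dt (mv A a) b \<in> ?R" if "A \<in> mat_span C B" "a \<in> E" "b \<in> E" for A a b
    using that(1)
  proof induction
    case (step B' c A)
    have "dt (mv B' a) b \<in> ?R"
      using step that by (force simp: X_def intro!: subring_gen.gen)
    then show ?case using step CR by (auto simp: dt_mv_simps intro!: subring_gen.add subring_gen.mult)
  qed (simp add: dt_mv_simps is_subringD)
  have 1: "inv_gens ?G E \<subseteq> ?R"
    using t d GB by (auto simp: inv_gens_def)
  have "X \<subseteq> inv_gens ?G E"
  proof -
    have "tr ` S \<subseteq> tr ` ?G" "tr ` B \<subseteq> tr ` ?G"
      using B(2) mat_monoid_gen [of _ S] by auto
    moreover have "(\<lambda>(g, h). tr (g * h)) ` (S \<times> S) \<subseteq> tr ` ?G"
      using mat_monoid_mult [OF mat_monoid_gen mat_monoid_gen, of _ S] by auto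
    moreover have "(\<lambda>(A, a, b). dt (mv A a) b) ` (B \<times> E \<times> E)
        \<subseteq> {dt (mv A a) b | A a b. A \<in> ?G \<and> a \<in> E \<and> b \<in> E}"
    proof (rule image_subsetI)
      fix p assume "p \<in> B \<times> E \<times> E"
      then obtain A a b where "p = (A, a, b)" "A \<in> ?G" "a \<in> E" "b \<in> E" using B(2) by auto
      then show "(case p of (A, a, b) \<Rightarrow> dt (mv A a) b) \<in> {dt (mv A a) b | A a b. A \<in> ?G \<and> a \<in> E \<and> b \<in> E}"
        by (metis (mono_tags, lifting) case_prod_conv mem_Collect_eq)
    qed
    ultimately show ?thesis
      unfolding X_def X0_def inv_gens_def by (simp only: Un_subset_iff le_supI1 le_supI2 simp_thms)
  qed
  then have 2: "X \<subseteq> subring_gen (inv_gens ?G E)"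
    by (auto intro: subring_gen.gen)
  have "finite X"
    using S E B by (auto simp: X_def X0_def)
  moreover have "subring_gen X = subring_gen (inv_gens ?G E)"
    using subring_gen_mono [OF 1] subring_gen_mono [OF 2] by (rule equalityI [rotated])
  ultimately show ?thesis
    unfolding finitely_generated_ring_def using 2 by (intro exI [of _ X] conjI)
qed

section \<open>Flips of glued triangles\<close>

definition nx :: "nat \<Rightarrow> nat" where "nx s = (s + 1) mod 3"

lemma nx_values: "nx 0 = 1" "nx 1 = 2" "nx (Suc 0) = 2" "nx 2 = 0"
  by (simp_all add: nx_def)

lemma nx_simps [simp]:
  assumes "s < 3"
  shows "nx s < 3" "nx s \<noteq> s" "s \<noteq> nx s" "nx (nx s) \<noteq> s" "s \<noteq> nx (nx s)" "nx (nx (nx s)) = s"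
    "nx (nx s) \<noteq> nx s" "nx s \<noteq> nx (nx s)"
proof -
  have "s = 0 \<or> s = 1 \<or> s = 2" using assms by auto
  then show "nx s < 3" "nx s \<noteq> s" "s \<noteq> nx s" "nx (nx s) \<noteq> s" "s \<noteq> nx (nx s)" "nx (nx (nx s)) = s"
    "nx (nx s) \<noteq> nx s" "nx s \<noteq> nx (nx s)"
    by (elim disjE; simp add: nx_values)+
qed

lemma less3_cases: "s < 3 \<Longrightarrow> i < 3 \<Longrightarrow> i = s \<or> i = nx s \<or> i = nx (nx s)" for s i :: nat
proof -
  assume "s < 3" "i < 3"
  then have "(s = 0 \<or> s = 1 \<or> s = 2) \<and> (i = 0 \<or> i = 1 \<or> i = 2)" by auto
  then show ?thesis by (auto simp: nx_values)
qed

lemma lessThan_3: "s < 3 \<Longrightarrow> {..<3} = {s, nx s, nx (nx s)}"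
  using less3_cases [of s] by auto

lemma sum_less3: "s < 3 \<Longrightarrow> (\<Sum>i<3. f i) = f s + (f (nx s) + (f (nx (nx s)) :: 'a::comm_monoid_add))"
  by (simp add: lessThan_3)

definition gl :: "nat \<Rightarrow> (nat \<Rightarrow> nat \<Rightarrow> nat) \<Rightarrow> nat \<Rightarrow> nat \<Rightarrow> nat \<Rightarrow> nat \<Rightarrow> bool" where
  "gl F lab t s t' s' \<longleftrightarrow> t < F \<and> s < 3 \<and> t' < F \<and> s' < 3 \<and> (t, s) \<noteq> (t', s') \<and> lab t s = lab t' s'"

text \<open>Self-folded triangles are allowed here, since flips create them. Connectedness is
  obtained, where it matters, from the paths \<open>gp\<close>.\<close>

definition surf :: "nat \<Rightarrow> nat \<Rightarrow> (nat \<Rightarrow> nat \<Rightarrow> nat) \<Rightarrow> bool" where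
  "surf F m lab \<longleftrightarrow> (\<forall>t<F. \<forall>s<3. lab t s < m) \<and>
     (\<forall>e<m. card {(t, s). t < F \<and> s < 3 \<and> lab t s = e} = 2)"

text \<open>The loop \<open>e\<close> and the radius \<open>j\<close> bound a self-folded triangle.\<close>

definition sf :: "nat \<Rightarrow> (nat \<Rightarrow> nat \<Rightarrow> nat) \<Rightarrow> nat \<Rightarrow> nat \<Rightarrow> bool" where
  "sf F lab e j \<longleftrightarrow> (\<exists>t<F. \<exists>s<3. lab t s = e \<and> lab t (nx s) = j \<and> lab t (nx (nx s)) = j)"

text \<open>The arc \<open>e\<close> has lambda length \<open>\<Prod>j. y j ^ EE F lab e j\<close> in the cluster variables \<open>y\<close>:
  the variable attached to a loop around a puncture is the doubly tagged radius, and the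
  loop is the product of the two radii.\<close>

definition EE :: "nat \<Rightarrow> (nat \<Rightarrow> nat \<Rightarrow> nat) \<Rightarrow> nat \<Rightarrow> nat \<Rightarrow> nat" where
  "EE F lab e j = (if j = e then 1 else 0) + (if sf F lab e j then 1 else 0)"

definition wedge :: "(nat \<Rightarrow> nat) \<Rightarrow> (nat \<Rightarrow> nat) \<Rightarrow> nat \<Rightarrow> nat \<Rightarrow> int" where
  "wedge f g i j = int (f i) * int (g j) - int (g i) * int (f j)"

text \<open>Coefficient matrix of the Weil--Petersson 2-form, the sum of
  \<open>dlog lam (nx s)\<close> wedge \<open>dlog lam s\<close> over all corners, written in the
  logarithms of the cluster variables. Through \<open>EE\<close> it covers self-folded triangles,
  which contribute 0.\<close>

definition cmat :: "nat \<Rightarrow> (nat \<Rightarrow> nat \<Rightarrow> nat) \<Rightarrow> nat \<Rightarrow> nat \<Rightarrow> int" where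
  "cmat F lab i j = (\<Sum>t<F. \<Sum>s<3. wedge (EE F lab (lab t (nx s))) (EE F lab (lab t s)) i j)"

lemma gl_sym: "gl F lab t s t' s' \<Longrightarrow> gl F lab t' s' t s"
  by (auto simp: gl_def)

lemma surf_lab: "surf F m lab \<Longrightarrow> t < F \<Longrightarrow> s < 3 \<Longrightarrow> lab t s < m"
  by (simp add: surf_def)

lemma surf_finite: "finite {(t, s). t < (F::nat) \<and> s < (3::nat) \<and> P t s}"
  by (rule finite_subset [of _ "{..<F} \<times> {..<3}"]) auto

lemma surf_sides:
  assumes "surf F m lab" "e < m"
  obtains t s t' s' where "gl F lab t s t' s'" "lab t s = e" "lab t' s' = e"
    "\<And>x i. x < F \<Longrightarrow> i < 3 \<Longrightarrow> lab x i = e \<Longrightarrow> (x, i) = (t, s) \<or> (x, i) = (t', s')"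
proof -
  have "card {(t, s). t < F \<and> s < 3 \<and> lab t s = e} = 2" using assms by (simp add: surf_def)
  then obtain p q where pq: "{(t, s). t < F \<and> s < 3 \<and> lab t s = e} = {p, q}" "p \<noteq> q"
    by (auto simp: card_2_iff)
  obtain t s t' s' where e: "p = (t, s)" "q = (t', s')" by (metis surj_pair)
  have "(t, s) \<in> {(t, s). t < F \<and> s < 3 \<and> lab t s = e}"
    "(t', s') \<in> {(t, s). t < F \<and> s < 3 \<and> lab t s = e}"
    unfolding pq e by auto
  moreover have "(x, i) = (t, s) \<or> (x, i) = (t', s')" if "x < F" "i < 3" "lab x i = e" for x i
  proof -
    have "(x, i) \<in> {(t, s). t < F \<and> s < 3 \<and> lab t s = e}" using that by auto
    then show ?thesis unfolding pq e by auto
  qed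
  moreover have "(t, s) \<noteq> (t', s')" using pq(2) e by simp
  ultimately show ?thesis by (intro that [of t s t' s']) (simp_all add: gl_def)
qed

lemma surf_gl_ex:
  assumes "surf F m lab" "t < F" "s < 3"
  obtains t' s' where "gl F lab t s t' s'"
  using surf_sides [OF assms(1) surf_lab [OF assms]] assms(2,3) gl_sym
  by (smt (verit) prod.inject)

lemma surf_three:
  assumes "surf F m lab" "x < F" "i < 3" "y < F" "j < 3" "z < F" "k < 3"
    "lab x i = lab y j" "lab y j = lab z k"
  shows "(x, i) = (y, j) \<or> (y, j) = (z, k) \<or> (x, i) = (z, k)"
  using surf_sides [OF assms(1) surf_lab [OF assms(1-3)]] assms(2-)
  by (smt (verit))

lemma gl_unique: "surf F m lab \<Longrightarrow> gl F lab t s t1 s1 \<Longrightarrow> gl F lab t s t2 s2 \<Longrightarrow> t1 = t2 \<and> s1 = s2"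
  using surf_three [of F m lab t s t1 s1 t2 s2] by (auto simp: gl_def)

lemma sf_neq:
  assumes "surf F m lab" "sf F lab e j"
  shows "e \<noteq> j"
proof
  assume "e = j"
  with assms(2) obtain t s where "t < F" "s < 3" "lab t s = j" "lab t (nx s) = j" "lab t (nx (nx s)) = j"
    by (auto simp: sf_def)
  then show False
    using surf_three [OF assms(1), of t s t "nx s" t "nx (nx s)"] by auto
qed

lemma sf_less: "surf F m lab \<Longrightarrow> sf F lab e j \<Longrightarrow> e < m \<and> j < m"
  unfolding sf_def surf_def by (metis nx_simps(1))

lemma sf_radius_sides:
  assumes "surf F m lab" "t < F" "s < 3" "lab t (nx s) = j" "lab t (nx (nx s)) = j" "x < F" "i < 3" "lab x i = j"
  shows "x = t \<and> (i = nx s \<or> i = nx (nx s))"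
  using surf_three [OF assms(1), of t "nx s" t "nx (nx s)" x i] assms by auto

text \<open>Both sides of a radius lie in its self-folded triangle, whose remaining side is the
  loop.\<close>

lemma sf_radius_loop_unique:
  assumes "surf F m lab" "sf F lab e j" "sf F lab e' j"
  shows "e = e'"
proof -
  obtain t s where t: "t < F" "s < 3" "lab t s = e" "lab t (nx s) = j" "lab t (nx (nx s)) = j"
    using assms by (auto simp: sf_def)
  obtain t' s' where t': "t' < F" "s' < 3" "lab t' s' = e'" "lab t' (nx s') = j" "lab t' (nx (nx s')) = j"
    using assms by (auto simp: sf_def)
  have "t' = t \<and> (nx s' = nx s \<or> nx s' = nx (nx s))" "nx (nx s') = nx s \<or> nx (nx s') = nx (nx s)"
    using sf_radius_sides [OF assms(1) t(1,2,4,5), of t' "nx s'"]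
      sf_radius_sides [OF assms(1) t(1,2,4,5), of t' "nx (nx s')"] t t' by auto
  then have "t' = t" "s' = s"
    using t t' nx_simps(6) [of s] nx_simps(6) [of s'] by (auto, metis nx_simps(2))
  then show ?thesis using t t' by simp
qed

text \<open>With \<open>pi - ni\<close> and \<open>nj - pj\<close> as the matrix entries at
  \<open>i, k\<close> and \<open>k, j\<close>, the mutation increment becomes an antisymmetric
  bilinear expression in positive and negative parts. A flip changes the 2-form by just such an
  expression.\<close>

lemma mutation_arith:
  fixes pi ni pj nj :: int
  assumes "pi \<ge> 0" "ni \<ge> 0" "pj \<ge> 0" "nj \<ge> 0" "pi = 0 \<or> ni = 0" "pj = 0 \<or> nj = 0"
  shows "(\<bar>pi - ni\<bar> * (nj - pj) + (pi - ni) * \<bar>pj - nj\<bar>) div 2 = pi * nj - ni * pj"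
  using assms by auto

section \<open>Combinatorics of a flip in a quadrilateral\<close>

locale quad =
  fixes F m lab t s t' s' k
  assumes surf: "surf F m lab" and tF: "t < F" "s < 3" "t' < F" "s' < 3" and tt': "t \<noteq> t'"
    and k: "lab t s = k" "lab t' s' = k"
begin

abbreviation "ea \<equiv> lab t (nx s)"
abbreviation "eb \<equiv> lab t (nx (nx s))"
abbreviation "ec \<equiv> lab t' (nx s')"
abbreviation "ed \<equiv> lab t' (nx (nx s'))"

text \<open>The slot \<open>(x, i)\<close> of the flipped triangulation holds the former side
  \<open>rho x i\<close>. Counterclockwise the quadrilateral has sides \<open>ea\<close>,
  \<open>eb\<close>, \<open>ec\<close>, \<open>ed\<close>; afterwards \<open>t\<close> has
  \<open>ed\<close>, \<open>ea\<close>, \<open>k\<close> and \<open>t'\<close> has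
  \<open>eb\<close>, \<open>ec\<close>, \<open>k\<close>. With these slots \<open>rho\<close> is a
  4-cycle of sides, so label counts are preserved.\<close>

definition rho :: "nat \<Rightarrow> nat \<Rightarrow> nat \<times> nat" where
  "rho x i = (if (x, i) = (t, s) then (t', nx (nx s')) else if (x, i) = (t, nx (nx s)) then (t, s)
     else if (x, i) = (t', s') then (t, nx (nx s)) else if (x, i) = (t', nx (nx s')) then (t', s')
     else (x, i))"

definition irho :: "nat \<Rightarrow> nat \<Rightarrow> nat \<times> nat" where
  "irho x i = (if (x, i) = (t', nx (nx s')) then (t, s) else if (x, i) = (t, s) then (t, nx (nx s))
     else if (x, i) = (t, nx (nx s)) then (t', s') else if (x, i) = (t', s') then (t', nx (nx s'))
     else (x, i))"

definition lab2 :: "nat \<Rightarrow> nat \<Rightarrow> nat" where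
  "lab2 x i = lab (fst (rho x i)) (snd (rho x i))"

lemma nxs [simp]: "nx s < 3" "nx s \<noteq> s" "s \<noteq> nx s" "nx (nx s) \<noteq> s" "s \<noteq> nx (nx s)" "nx (nx (nx s)) = s"
    "nx (nx s) \<noteq> nx s" "nx s \<noteq> nx (nx s)" "nx (nx s) < 3"
    "nx s' < 3" "nx s' \<noteq> s'" "s' \<noteq> nx s'" "nx (nx s') \<noteq> s'" "s' \<noteq> nx (nx s')" "nx (nx (nx s')) = s'"
    "nx (nx s') \<noteq> nx s'" "nx s' \<noteq> nx (nx s')" "nx (nx s') < 3"
    "t \<noteq> t'" "t' \<noteq> t" "t < F" "s < 3" "t' < F" "s' < 3"
  using tF tt' by auto

lemma rho_irho: "irho (fst (rho x i)) (snd (rho x i)) = (x, i)"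
  by (auto simp: rho_def irho_def)

lemma irho_rho: "rho (fst (irho x i)) (snd (irho x i)) = (x, i)"
  by (auto simp: rho_def irho_def)

lemma rho_range: "x < F \<Longrightarrow> i < 3 \<Longrightarrow> fst (rho x i) < F \<and> snd (rho x i) < 3"
  by (auto simp: rho_def)

lemma irho_range: "x < F \<Longrightarrow> i < 3 \<Longrightarrow> fst (irho x i) < F \<and> snd (irho x i) < 3"
  by (auto simp: irho_def)

lemma lab2_simps [simp]:
  "lab2 t s = ed" "lab2 t (nx s) = ea" "lab2 t (nx (nx s)) = k"
  "lab2 t' s' = eb" "lab2 t' (nx s') = ec" "lab2 t' (nx (nx s')) = k"
  "x \<noteq> t \<Longrightarrow> x \<noteq> t' \<Longrightarrow> lab2 x i = lab x i"
  using k by (auto simp: lab2_def rho_def)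

lemma lab2_irho: "lab2 (fst (irho x i)) (snd (irho x i)) = lab x i"
  by (simp add: lab2_def irho_rho)

lemma surf2: "surf F m lab2"
proof -
  have "card {(x, i). x < F \<and> i < 3 \<and> lab2 x i = e} = 2" if "e < m" for e
  proof -
    have "bij_betw (\<lambda>(x, i). rho x i) {(x, i). x < F \<and> i < 3 \<and> lab2 x i = e}
        {(x, i). x < F \<and> i < 3 \<and> lab x i = e}"
      by (rule bij_betw_byWitness [where f' = "\<lambda>(x, i). irho x i"])
        (use rho_irho irho_rho rho_range irho_range lab2_irho in \<open>auto simp: lab2_def split: prod.splits\<close>,
          (metis fst_conv snd_conv)+)
    then have "card {(x, i). x < F \<and> i < 3 \<and> lab2 x i = e} = card {(x, i). x < F \<and> i < 3 \<and> lab x i = e}"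
      by (rule bij_betw_same_card)
    then show ?thesis using surf that by (simp add: surf_def)
  qed
  then show ?thesis using surf rho_range by (auto simp: surf_def lab2_def)
qed

lemma k_sides: "x < F \<Longrightarrow> i < 3 \<Longrightarrow> lab x i = k \<Longrightarrow> (x, i) = (t, s) \<or> (x, i) = (t', s')"
  using surf_three [OF surf, of t s t' s' x i] k by auto

lemma outer_neq_k [simp]: "ea \<noteq> k" "eb \<noteq> k" "ec \<noteq> k" "ed \<noteq> k"
  "k \<noteq> ea" "k \<noteq> eb" "k \<noteq> ec" "k \<noteq> ed"
proof -
  show "ea \<noteq> k" "eb \<noteq> k" "ec \<noteq> k" "ed \<noteq> k"
    using k_sides [of t "nx s"] k_sides [of t "nx (nx s)"] k_sides [of t' "nx s'"] k_sides [of t' "nx (nx s')"]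
    by auto
  then show "k \<noteq> ea" "k \<noteq> eb" "k \<noteq> ec" "k \<noteq> ed" by metis+
qed

lemma k_less: "k < m"
  using surf_lab [OF surf tF(1,2)] k by simp

lemma lab_neq_k: "x < F \<Longrightarrow> i < 3 \<Longrightarrow> x \<noteq> t \<Longrightarrow> x \<noteq> t' \<Longrightarrow> lab x i \<noteq> k"
  using k_sides by blast

lemma sf_k: "sf F lab k j \<longleftrightarrow> (ea = j \<and> eb = j) \<or> (ec = j \<and> ed = j)"
proof
  assume "sf F lab k j"
  then show "(ea = j \<and> eb = j) \<or> (ec = j \<and> ed = j)"
    unfolding sf_def using k_sides by blast
next
  assume "(ea = j \<and> eb = j) \<or> (ec = j \<and> ed = j)"
  then show "sf F lab k j"
    unfolding sf_def using tF k by blast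
qed

lemma k2_sides: "x < F \<Longrightarrow> i < 3 \<Longrightarrow> lab2 x i = k \<Longrightarrow> (x, i) = (t, nx (nx s)) \<or> (x, i) = (t', nx (nx s'))"
  using surf_three [OF surf2, of t "nx (nx s)" t' "nx (nx s')" x i] by auto

lemma sf2_k: "sf F lab2 k j \<longleftrightarrow> (ed = j \<and> ea = j) \<or> (eb = j \<and> ec = j)"
proof
  assume "sf F lab2 k j"
  then obtain x i where "x < F" "i < 3" "lab2 x i = k" "lab2 x (nx i) = j" "lab2 x (nx (nx i)) = j"
    by (auto simp: sf_def)
  then show "(ed = j \<and> ea = j) \<or> (eb = j \<and> ec = j)"
    using k2_sides [of x i] by auto
next
  assume "(ed = j \<and> ea = j) \<or> (eb = j \<and> ec = j)"
  then show "sf F lab2 k j"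
  proof
    assume "ed = j \<and> ea = j"
    then show ?thesis
      unfolding sf_def by (intro exI [of _ t] conjI exI [of _ "nx (nx s)"]) auto
  next
    assume "eb = j \<and> ec = j"
    then show ?thesis
      unfolding sf_def by (intro exI [of _ t'] conjI exI [of _ "nx (nx s')"]) auto
  qed
qed

end

locale flip = quad +
  assumes nonradius: "\<not> sf F lab e k"
begin

lemma sf_other_triangle:
  assumes "x < F" "i < 3" "lab x i = e" "lab x (nx i) = j" "lab x (nx (nx i)) = j" "e \<noteq> k"
  shows "x \<noteq> t \<and> x \<noteq> t'"
proof -
  have "j \<noteq> k" using nonradius assms by (auto simp: sf_def)
  then have "\<forall>q<3. lab x q \<noteq> k"
    using assms less3_cases [OF assms(2)] by metis
  then show ?thesis using k tF(2,4) by metis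
qed

text \<open>A self-folded triangle whose loop is not \<open>k\<close> could contain \<open>k\<close>
  only as its radius. Neither before nor after the flip is this possible, so it is one of the
  untouched triangles.\<close>

lemma sf2_other:
  assumes "e \<noteq> k"
  shows "sf F lab2 e j \<longleftrightarrow> sf F lab e j"
proof
  assume "sf F lab e j"
  then obtain x i where x: "x < F" "i < 3" "lab x i = e" "lab x (nx i) = j" "lab x (nx (nx i)) = j"
    by (auto simp: sf_def)
  then show "sf F lab2 e j" using sf_other_triangle [OF x assms] unfolding sf_def
    by (intro exI [of _ x] conjI exI [of _ i]) auto
next
  assume "sf F lab2 e j"
  then obtain x i where x: "x < F" "i < 3" "lab2 x i = e" "lab2 x (nx i) = j" "lab2 x (nx (nx i)) = j"
    by (auto simp: sf_def)
  have "x \<noteq> t \<and> x \<noteq> t'"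
  proof (rule ccontr)
    assume "\<not> (x \<noteq> t \<and> x \<noteq> t')"
    then obtain q where "q < 3" "lab2 x q = k" by (metis lab2_simps(3,6) nxs(9,18))
    then have "q = nx i \<or> q = nx (nx i)" "j = k"
      using x assms less3_cases [of i q] by auto
    then have "lab2 x (nx i) = k" "lab2 x (nx (nx i)) = k" using x by auto
    then have "(x, nx i) = (t, nx (nx s)) \<or> (x, nx i) = (t', nx (nx s'))"
      "(x, nx (nx i)) = (t, nx (nx s)) \<or> (x, nx (nx i)) = (t', nx (nx s'))"
      using k2_sides [of x "nx i"] k2_sides [of x "nx (nx i)"] x(1,2) by (simp_all only: nx_simps)
    then have "nx i = nx (nx i)" using tt' by (elim disjE) simp_all
    then show False using nx_simps(8) [OF x(2)] by simp
  qed
  then show "sf F lab e j" using x unfolding sf_def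
    by (intro exI [of _ x] conjI exI [of _ i]) auto
qed

lemma EE2_other: "e \<noteq> k \<Longrightarrow> EE F lab2 e = EE F lab e"
  by (auto simp: EE_def sf2_other)

lemma EE_at_k: "e \<noteq> k \<Longrightarrow> EE F lab e k = 0"
  using nonradius by (simp add: EE_def)

lemma EE_k: "EE F lab k j = (if j = k then 1 else 0) + (if sf F lab k j then 1 else 0)"
  "EE F lab2 k j = (if j = k then 1 else 0) + (if sf F lab2 k j then 1 else 0)"
  by (auto simp: EE_def)

lemma sf_k_k: "\<not> sf F lab k k" "\<not> sf F lab2 k k"
  using sf_neq [OF surf] sf_neq [OF surf2] by auto

text \<open>Exponent of the variable \<open>j\<close> in the common factor of the Ptolemy products
  \<open>lam ea * lam ec\<close> and \<open>lam eb * lam ed\<close>; removing that factor leaves the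
  exchange monomials.\<close>

definition mu :: "nat \<Rightarrow> nat" where
  "mu j = (if sf F lab k j then 1 else 0) + (if sf F lab2 k j then 1 else 0)"

text \<open>An arc shared by \<open>{ea, ec}\<close> and \<open>{eb, ed}\<close> is a radius of the loop \<open>k\<close> before or after the flip.\<close>

lemma min_EE: "min (EE F lab ea j + EE F lab ec j) (EE F lab eb j + EE F lab ed j) = mu j"
proof (cases "j \<in> {ea, eb, ec, ed}")
  case True
  have no: "\<not> sf F lab e j" if "e \<noteq> k" for e
  proof
    assume "sf F lab e j"
    then obtain x i where x: "x < F" "i < 3" "lab x i = e" "lab x (nx i) = j" "lab x (nx (nx i)) = j"
      by (auto simp: sf_def)
    have "\<And>y q. y < F \<Longrightarrow> q < 3 \<Longrightarrow> lab y q = j \<Longrightarrow> y = x"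
      using sf_radius_sides [OF surf x(1,2,4,5)] by auto
    then have "x = t \<or> x = t'" using True by (metis insert_iff empty_iff nxs(1,9,10,18,21,23))
    then show False using sf_other_triangle [OF x that] by auto
  qed
  have E: "EE F lab ea j = (if j = ea then 1 else 0)" "EE F lab eb j = (if j = eb then 1 else 0)"
    "EE F lab ec j = (if j = ec then 1 else 0)" "EE F lab ed j = (if j = ed then 1 else 0)"
    using no by (auto simp: EE_def)
  have three: "\<not> (j = ea \<and> j = eb \<and> j = ec)" "\<not> (j = ea \<and> j = eb \<and> j = ed)"
    "\<not> (j = ea \<and> j = ec \<and> j = ed)" "\<not> (j = eb \<and> j = ec \<and> j = ed)"
    using surf_three [OF surf, of t "nx s" t "nx (nx s)" t' "nx s'"]
      surf_three [OF surf, of t "nx s" t "nx (nx s)" t' "nx (nx s')"]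
      surf_three [OF surf, of t "nx s" t' "nx s'" t' "nx (nx s')"]
      surf_three [OF surf, of t "nx (nx s)" t' "nx s'" t' "nx (nx s')"]
    by auto
  show ?thesis
    unfolding mu_def E sf_k sf2_k using three
    by (cases "j = ea"; cases "j = eb"; cases "j = ec"; cases "j = ed"; simp)
next
  case False
  have mu0: "mu j = 0" using False by (auto simp: mu_def sf_k sf2_k)
  \<comment> \<open>A loop with radius \<open>j\<close> has one of its two sides inside the
    self-folded triangle, so it occupies at most one side of the quadrilateral.\<close>
  have no: "\<not> (sf F lab (lab x i) j \<and> sf F lab (lab y q) j)"
    if "x = t \<and> i \<in> {nx s, nx (nx s)} \<or> x = t' \<and> i \<in> {nx s', nx (nx s')}"
      "y = t \<and> q \<in> {nx s, nx (nx s)} \<or> y = t' \<and> q \<in> {nx s', nx (nx s')}" "(x, i) \<noteq> (y, q)" for x i y q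
  proof
    assume a: "sf F lab (lab x i) j \<and> sf F lab (lab y q) j"
    then have e: "lab x i = lab y q" using sf_radius_loop_unique [OF surf] by blast
    have nk: "lab x i \<noteq> k" using that(1) by auto
    obtain z p where z: "z < F" "p < 3" "lab z p = lab x i" "lab z (nx p) = j" "lab z (nx (nx p)) = j"
      using a by (auto simp: sf_def)
    have zt: "z \<noteq> t" "z \<noteq> t'" using sf_other_triangle [OF z nk] by auto
    have b: "x < F" "i < 3" "y < F" "q < 3" and xy: "x = t \<or> x = t'" "y = t \<or> y = t'"
      using that(1,2) by auto
    have "(x, i) = (y, q) \<or> (y, q) = (z, p) \<or> (x, i) = (z, p)"
      by (rule surf_three [OF surf b z(1,2) e]) (simp add: e z(3) flip: e)
    then show False
      using that(3) zt xy by (metis Pair_inject)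
  qed
  have E: "EE F lab ea j = (if sf F lab ea j then 1 else 0)" "EE F lab eb j = (if sf F lab eb j then 1 else 0)"
    "EE F lab ec j = (if sf F lab ec j then 1 else 0)" "EE F lab ed j = (if sf F lab ed j then 1 else 0)"
    using False by (auto simp: EE_def)
  show ?thesis
    unfolding mu0 E
    using no [of t "nx s" t "nx (nx s)"] no [of t "nx s" t' "nx (nx s')"]
      no [of t' "nx s'" t "nx (nx s)"] no [of t' "nx s'" t' "nx (nx s')"]
    by auto
qed

definition crest :: "nat \<Rightarrow> nat \<Rightarrow> int" where
  "crest i j = (\<Sum>x\<in>{..<F} - {t, t'}. \<Sum>q<3. wedge (EE F lab (lab x (nx q))) (EE F lab (lab x q)) i j)"

lemma sum_split:
  fixes f :: "nat \<Rightarrow> 'b::comm_monoid_add"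
  shows "(\<Sum>x<F. f x) = f t + (f t' + (\<Sum>x\<in>{..<F} - {t, t'}. f x))"
proof -
  have "(\<Sum>x<F. f x) = f t + sum f ({..<F} - {t})"
    by (rule sum.remove) auto
  also have "sum f ({..<F} - {t}) = f t' + sum f ({..<F} - {t} - {t'})"
    by (rule sum.remove) auto
  finally show ?thesis by (simp add: Diff_insert2 [symmetric] insert_commute)
qed

lemma cmat_split:
  "cmat F lab i j = crest i j
     + wedge (EE F lab ea) (EE F lab k) i j + wedge (EE F lab eb) (EE F lab ea) i j + wedge (EE F lab k) (EE F lab eb) i j
     + wedge (EE F lab ec) (EE F lab k) i j + wedge (EE F lab ed) (EE F lab ec) i j + wedge (EE F lab k) (EE F lab ed) i j"
  unfolding cmat_def sum_split crest_def
  by (subst sum_less3 [of s], simp, subst sum_less3 [of s'], simp, simp add: k)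

lemma cmat2_split:
  "cmat F lab2 i j = crest i j
     + wedge (EE F lab ea) (EE F lab ed) i j + wedge (EE F lab2 k) (EE F lab ea) i j + wedge (EE F lab ed) (EE F lab2 k) i j
     + wedge (EE F lab ec) (EE F lab eb) i j + wedge (EE F lab2 k) (EE F lab ec) i j + wedge (EE F lab eb) (EE F lab2 k) i j"
proof -
  have r: "(\<Sum>x\<in>{..<F} - {t, t'}. \<Sum>q<3. wedge (EE F lab2 (lab2 x (nx q))) (EE F lab2 (lab2 x q)) i j) = crest i j"
    unfolding crest_def
  proof (rule sum.cong [OF refl], rule sum.cong [OF refl])
    fix x q assume "x \<in> {..<F} - {t, t'}" "q \<in> {..<3::nat}"
    then have "x < F" "x \<noteq> t" "x \<noteq> t'" "q < 3" by auto
    then show "wedge (EE F lab2 (lab2 x (nx q))) (EE F lab2 (lab2 x q)) i j =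
        wedge (EE F lab (lab x (nx q))) (EE F lab (lab x q)) i j"
      using lab_neq_k [of x q] lab_neq_k [of x "nx q"] by (simp add: EE2_other)
  qed
  show ?thesis
    unfolding cmat_def sum_split r
    by (subst sum_less3 [of s], simp, subst sum_less3 [of s'], simp, simp add: EE2_other)
qed

lemma crest_k: "crest i k = 0" "crest k j = 0"
proof -
  have "wedge (EE F lab (lab x (nx q))) (EE F lab (lab x q)) i k = 0 \<and>
     wedge (EE F lab (lab x (nx q))) (EE F lab (lab x q)) k j = 0"
    if "x \<in> {..<F} - {t, t'}" "q < 3" for x q
    using that lab_neq_k [of x q] lab_neq_k [of x "nx q"] by (auto simp: wedge_def EE_at_k)
  then show "crest i k = 0" "crest k j = 0" by (simp_all add: crest_def)
qed

lemma cmat_col: "cmat F lab i k = int (EE F lab ea i + EE F lab ec i) - int (EE F lab eb i + EE F lab ed i)"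
proof -
  have "EE F lab k k = 1" using sf_k_k by (simp add: EE_def)
  then show ?thesis
    unfolding cmat_split crest_k by (simp add: wedge_def EE_at_k)
qed

lemma cmat_row: "cmat F lab k j = - cmat F lab j k"
proof -
  have "EE F lab k k = 1" using sf_k_k by (simp add: EE_def)
  then show ?thesis
    unfolding cmat_col by (simp add: cmat_split crest_k wedge_def EE_at_k)
qed

text \<open>Away from row and column \<open>k\<close>, the 2-forms before and after the flip differ
  by the wedge of \<open>P - mu\<close> and \<open>N - mu\<close>, the exponent vectors of the two
  exchange monomials; \<open>mutation_arith\<close> turns this into the mutation rule.\<close>

lemma cmat_mutate:
  "cmat F lab2 i j = (if k = i \<or> k = j then - cmat F lab i j
     else cmat F lab i j + (\<bar>cmat F lab i k\<bar> * cmat F lab k j + cmat F lab i k * \<bar>cmat F lab k j\<bar>) div 2)"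
proof (cases "k = i \<or> k = j")
  case True
  have "EE F lab k k = 1" "EE F lab2 k k = 1" using sf_k_k by (simp_all add: EE_def)
  then have "cmat F lab2 i k = - cmat F lab i k" "cmat F lab2 k j = - cmat F lab k j" for i j
    by (simp_all add: cmat_split cmat2_split crest_k wedge_def EE_at_k)
  then show ?thesis using True by auto
next
  case False
  define P N where "P j = EE F lab ea j + EE F lab ec j" and "N j = EE F lab eb j + EE F lab ed j" for j
  define p n where "p j = int (P j) - int (mu j)" and "n j = int (N j) - int (mu j)" for j
  have mu: "min (P j) (N j) = mu j" for j by (simp add: P_def N_def min_EE)
  have pn: "p j \<ge> 0" "n j \<ge> 0" "p j = 0 \<or> n j = 0" for j
    using mu [of j] by (auto simp: p_def n_def)
  have col: "cmat F lab i k = p i - n i" "cmat F lab k j = n j - p j" for i j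
    by (simp_all add: cmat_row cmat_col p_def n_def P_def N_def)
  have eqs: "EE F lab k i = (if sf F lab k i then 1 else 0)" "EE F lab k j = (if sf F lab k j then 1 else 0)"
    "EE F lab2 k i = (if sf F lab2 k i then 1 else 0)" "EE F lab2 k j = (if sf F lab2 k j then 1 else 0)"
    using False by (auto simp: EE_k)
  define r where "r j = (if sf F lab k j then 1 else 0 :: int)" for j
  define r2 where "r2 j = (if sf F lab2 k j then 1 else 0 :: int)" for j
  have rr: "int (EE F lab k i) = r i" "int (EE F lab k j) = r j" "int (EE F lab2 k i) = r2 i" "int (EE F lab2 k j) = r2 j"
    by (simp_all add: eqs r_def r2_def)
  have mur: "int (mu i) = r i + r2 i" "int (mu j) = r j + r2 j" by (simp_all add: mu_def r_def r2_def)
  have "cmat F lab2 i j - cmat F lab i j = p i * n j - n i * p j"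
    unfolding cmat_split cmat2_split wedge_def rr p_def n_def mur P_def N_def of_nat_add
    by (simp add: algebra_simps)
  also have "\<dots> = (\<bar>cmat F lab i k\<bar> * cmat F lab k j + cmat F lab i k * \<bar>cmat F lab k j\<bar>) div 2"
    using mutation_arith [of "p i" "n i" "p j" "n j"] pn
    by (simp add: col abs_minus_commute)
  finally show ?thesis using False by simp
qed

end

section \<open>Positive rational functions\<close>

definition posp :: "mpoly_rat \<Rightarrow> bool" where
  "posp p \<longleftrightarrow> p \<noteq> 0 \<and> (\<forall>k. Poly_Mapping.lookup p k \<ge> 0)"

text \<open>Subtraction-free functions: closed under sums, products and quotients, and never 0. This
  lets every lambda length met during mutation be inverted.\<close>

definition posr :: "ratfun \<Rightarrow> bool" where
  "posr f \<longleftrightarrow> (\<exists>p q. posp p \<and> posp q \<and> f = Fract p q)"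

lemma posp_mult: "posp p \<Longrightarrow> posp q \<Longrightarrow> posp (p * q)"
  unfolding posp_def
  by (auto simp: times_poly_mapping.rep_eq prod_fun_def Sum_any.expand_set when_def
      intro!: sum_nonneg mult_nonneg_nonneg)

lemma posp_add: "posp p \<Longrightarrow> posp q \<Longrightarrow> posp (p + q)"
  unfolding posp_def
  by (auto simp: lookup_add poly_mapping_eq_iff fun_eq_iff add_nonneg_eq_0_iff)

lemma posp_single: "c > 0 \<Longrightarrow> posp (Poly_Mapping.single k c)"
  by (auto simp: posp_def lookup_single when_def poly_mapping_eq_iff fun_eq_iff)

lemma posp_one: "posp 1"
  using posp_single [of 1 0] by simp

lemma posr_mult: "posr f \<Longrightarrow> posr g \<Longrightarrow> posr (f * g)"
  unfolding posr_def by (metis mult_fract posp_mult)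

lemma posr_add: "posr f \<Longrightarrow> posr g \<Longrightarrow> posr (f + g)"
  unfolding posr_def by (metis add_fract posp_add posp_mult posp_def)

lemma posr_inverse: "posr f \<Longrightarrow> posr (inverse f)"
  unfolding posr_def by (metis inverse_fract)

lemma posr_divide: "posr f \<Longrightarrow> posr g \<Longrightarrow> posr (f / g)"
  by (simp add: divide_inverse posr_mult posr_inverse)

lemma posr_one: "posr 1"
  unfolding posr_def One_fract_def using posp_one by blast

lemma posr_neq_0: "posr f \<Longrightarrow> f \<noteq> 0"
  by (auto simp: posr_def posp_def Zero_fract_def eq_fract)

lemma posr_power: "posr f \<Longrightarrow> posr (f ^ n)"
  by (induction n) (auto simp: posr_one posr_mult)

lemma posr_prod: "(\<And>i. i \<in> I \<Longrightarrow> posr (f i)) \<Longrightarrow> posr (prod f I)"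
  by (induction I rule: infinite_finite_induct) (auto simp: posr_one posr_mult)

lemma posr_var: "posr (var i)"
  unfolding posr_def var_def using posp_single posp_one by (metis zero_less_one)

section \<open>Decorated hyperbolic structures with fixed holonomy\<close>

lemma mat2_ext:
  fixes A B :: "'a::comm_ring_1 mat2"
  shows "mv A (1, 0) = mv B (1, 0) \<Longrightarrow> mv A (0, 1) = mv B (0, 1) \<Longrightarrow> A = B"
  by (cases A; cases B) simp

lemma mat2_eqI:
  fixes v w :: "'a::field \<times> 'a"
  assumes "dt v w \<noteq> 0" "mv A v = mv B v" "mv A w = mv B w"
  shows "A = B"
proof -
  have "dt (mv (adj A) x) v = dt (mv (adj B) x) v \<and> dt (mv (adj A) x) w = dt (mv (adj B) x) w" for x
    using assms by (metis dt_adj adj_adj)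
  then have "mv (adj A) x = mv (adj B) x" for x
    using dt_eq_imp_eq [OF assms(1)] by blast
  then have "adj A = adj B" by (intro mat2_ext)
  then show ?thesis by (metis adj_adj)
qed

text \<open>The matrix \<open>A\<close> carries the frame of \<open>t'\<close> to the frame of \<open>t\<close> across a glued side. The sign
  keeps both frames positively oriented although they traverse the side in opposite directions.\<close>

definition hop :: "nat \<Rightarrow> (nat \<Rightarrow> nat \<Rightarrow> nat) \<Rightarrow> (nat \<Rightarrow> nat \<Rightarrow> 'a \<times> 'a) \<Rightarrow>
    nat \<Rightarrow> nat \<Rightarrow> nat \<Rightarrow> nat \<Rightarrow> 'a::field mat2 \<Rightarrow> bool" where
  "hop F lab w t s t' s' A \<longleftrightarrow> gl F lab t s t' s' \<and> det2 A = 1 \<and>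
     mv A (w t' (nx s')) = w t s \<and> mv A (w t' s') = - w t (nx s)"

text \<open>In the developed picture the copy of \<open>t'\<close> moved by \<open>A\<close> is
  reached from \<open>t\<close> by crossing sides; \<open>A\<close> is the product of the gluing
  matrices on the way.\<close>

inductive gp :: "nat \<Rightarrow> (nat \<Rightarrow> nat \<Rightarrow> nat) \<Rightarrow> (nat \<Rightarrow> nat \<Rightarrow> 'a \<times> 'a) \<Rightarrow>
    nat \<Rightarrow> 'a::field mat2 \<Rightarrow> nat \<Rightarrow> bool" for F lab w where
  base: "t < F \<Longrightarrow> gp F lab w t 1 t"
| step: "gp F lab w t A t' \<Longrightarrow> hop F lab w t' s t'' s'' B \<Longrightarrow> gp F lab w t (A * B) t''"

lemma hop_rev: "hop F lab w t s t' s' A \<Longrightarrow> hop F lab w t' s' t s (- adj A)"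
proof -
  assume h: "hop F lab w t s t' s' A"
  then have "mv (adj A) (w t s) = w t' (nx s')" "mv (adj A) (- w t (nx s)) = w t' s'"
    using mv_adj_left [of A "w t' (nx s')"] mv_adj_left [of A "w t' s'"] by (simp_all add: hop_def)
  then show ?thesis using h gl_sym [of F lab t s t' s'] by (simp add: hop_def mv_uminus)
qed

lemma gp_less: "gp F lab w t A t' \<Longrightarrow> t < F \<and> t' < F"
  by (induction rule: gp.induct) (auto simp: hop_def gl_def)

lemma gp_hop: "hop F lab w t s t' s' A \<Longrightarrow> gp F lab w t A t'"
  using gp.step [OF gp.base] by (metis gl_def hop_def mult_1)

lemma gp_trans: "gp F lab w t' B t'' \<Longrightarrow> gp F lab w t A t' \<Longrightarrow> gp F lab w t (A * B) t''"
  by (induction arbitrary: rule: gp.induct) (auto simp: mult.assoc [symmetric] intro: gp.step)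

text \<open>Crossing a side and returning gives \<open>- 1\<close> because of the sign in
  \<open>hop\<close>; signs of paths can therefore be corrected at will.\<close>

lemma gp_uminus_one: "hop F lab w t s t' s' A \<Longrightarrow> gp F lab w t (- 1) t"
proof -
  assume h: "hop F lab w t s t' s' A"
  have "gp F lab w t (A * - adj A) t" by (rule gp_trans [OF gp_hop [OF hop_rev [OF h]] gp_hop [OF h]])
  then show ?thesis using adj_right [of A] h by (simp add: hop_def)
qed

lemma gp_hop_adj: "hop F lab w t s t' s' A \<Longrightarrow> gp F lab w t' (adj A) t"
proof -
  assume h: "hop F lab w t s t' s' A"
  have "gp F lab w t' (- adj A * - 1) t" by (rule gp_trans [OF gp_uminus_one [OF h] gp_hop [OF hop_rev [OF h]]])
  then show ?thesis by simp
qed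

lemma gp_rev: "gp F lab w t A t' \<Longrightarrow> gp F lab w t' (adj A) t"
proof (induction rule: gp.induct)
  case (step t A t' s t'' s'' B)
  then show ?case
    using gp_trans [OF step.IH gp_hop_adj [OF step.hyps(2)]] by (simp add: adj_mult)
qed (simp add: gp.base)

text \<open>That equally labelled corners are identified by the gluing is expressed by the invariance of
  all predicates that are compatible with the gluing, which is easy to transport along flips.\<close>

definition comb :: "nat \<Rightarrow> nat \<Rightarrow> nat \<Rightarrow> (nat \<Rightarrow> nat \<Rightarrow> nat) \<Rightarrow> (nat \<Rightarrow> nat \<Rightarrow> nat) \<Rightarrow> bool" where
  "comb F m n lab pun \<longleftrightarrow> surf F m lab \<and>
     (\<forall>t s t' s'. gl F lab t s t' s' \<longrightarrow> pun t s = pun t' (nx s')) \<and>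
     (\<forall>t<F. \<forall>s<3. pun t s < n) \<and> (\<forall>i<n. \<exists>t<F. \<exists>s<3. pun t s = i) \<and>
     (\<forall>f :: nat \<Rightarrow> nat \<Rightarrow> bool. (\<forall>t s t' s'. gl F lab t s t' s' \<longrightarrow> f t s = f t' (nx s')) \<longrightarrow>
        (\<forall>t<F. \<forall>s<3. \<forall>t'<F. \<forall>s'<3. pun t s = pun t' s' \<longrightarrow> f t s = f t' s')) \<and>
     (n = 1 \<or> 3 \<le> F)"

lemma combD:
  assumes "comb F m n lab pun"
  shows "surf F m lab" "gl F lab t s t' s' \<Longrightarrow> pun t s = pun t' (nx s')"
    "t < F \<Longrightarrow> s < 3 \<Longrightarrow> pun t s < n" "i < n \<Longrightarrow> \<exists>t<F. \<exists>s<3. pun t s = i"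
    "n = 1 \<or> 3 \<le> F"
  using assms unfolding comb_def by auto

lemma comb_sep:
  assumes "comb F m n lab pun"
    and "\<And>t s t' s'. gl F lab t s t' s' \<Longrightarrow> f t s = f t' (nx s')"
    and "t < F" "s < 3" "t' < F" "s' < 3" "pun t s = pun t' s'"
  shows "f t s = (f t' s' :: 'a)"
proof -
  have "\<forall>f :: nat \<Rightarrow> nat \<Rightarrow> bool. (\<forall>t s t' s'. gl F lab t s t' s' \<longrightarrow> f t s = f t' (nx s')) \<longrightarrow>
        (\<forall>t<F. \<forall>s<3. \<forall>t'<F. \<forall>s'<3. pun t s = pun t' s' \<longrightarrow> f t s = f t' s')"
    using assms(1) unfolding comb_def by (elim conjE)
  then have *: "(\<forall>t s t' s'. gl F lab t s t' s' \<longrightarrow> g t s = g t' (nx s')) \<Longrightarrow> g t s = g t' s'"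
    for g :: "nat \<Rightarrow> nat \<Rightarrow> bool"
    using assms(3-) by simp
  show ?thesis using * [of "\<lambda>x i. f x i = f t s"] assms(2) by auto
qed

text \<open>The length of the horocycle at the puncture \<open>i\<close>.\<close>

definition horo :: "nat \<Rightarrow> (nat \<Rightarrow> nat \<Rightarrow> nat) \<Rightarrow> (nat \<Rightarrow> nat \<Rightarrow> nat) \<Rightarrow> (nat \<Rightarrow> 'a::field) \<Rightarrow> nat \<Rightarrow> 'a" where
  "horo F lab pun lam i = (\<Sum>t<F. \<Sum>s<3. if pun t s = i
     then lam (lab t (nx s)) / (lam (lab t s) * lam (lab t (nx (nx s)))) else 0)"

definition seedrel :: "nat \<Rightarrow> nat \<Rightarrow> (nat \<Rightarrow> nat \<Rightarrow> nat) \<Rightarrow> (nat \<Rightarrow> ratfun) \<Rightarrow> seed \<Rightarrow> bool" where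
  "seedrel F m lab lam S \<longleftrightarrow> snd S = cmat F lab \<and> (\<forall>j<m. posr (fst S j)) \<and>
     (\<forall>e<m. lam e = (\<Prod>j<m. fst S j ^ EE F lab e j))"

text \<open>For a puncture \<open>i\<close>, \<open>u i\<close> is the decoration vector of one lift
  and \<open>c i\<close> the horocycle length, both in the reference tagging. None of these data
  change under flips.\<close>

locale holonomy =
  fixes G :: "ratfun mat2 set" and n :: nat and u :: "nat \<Rightarrow> ratfun \<times> ratfun" and c :: "nat \<Rightarrow> ratfun"
  assumes G_one: "1 \<in> G" and G_mult: "A \<in> G \<Longrightarrow> B \<in> G \<Longrightarrow> A * B \<in> G"
    and G_adj: "A \<in> G \<Longrightarrow> adj A \<in> G" and G_minus: "A \<in> G \<Longrightarrow> - A \<in> G" and G_det: "A \<in> G \<Longrightarrow> det2 A = 1"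
    and c_pos: "i < n \<Longrightarrow> posr (c i)"
begin

text \<open>Switching all tags at the puncture \<open>i\<close> replaces its vector \<open>u i\<close> by \<open>c i\<close> times \<open>u i\<close>
  and its horocycle length \<open>c i\<close> by the inverse.\<close>

definition tagged :: "(nat \<Rightarrow> ratfun \<times> ratfun) \<Rightarrow> (nat \<Rightarrow> ratfun) \<Rightarrow> bool" where
  "tagged uu kap \<longleftrightarrow> (\<forall>i<n. (uu i = u i \<and> kap i = c i) \<or> (uu i = sv (c i) (u i) \<and> kap i = 1 / c i))"

text \<open>A triangulation developed with the fixed group \<open>G\<close>. The clause on
  \<open>gp\<close> states that each element of \<open>G\<close> is realised by a path between any
  two triangles; it contains connectedness and lets properties of one frame spread along
  \<open>G\<close>.\<close>

definition geom where
  "geom F m lab pun w lam uu kap \<longleftrightarrow> comb F m n lab pun \<and>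
     (\<forall>t<F. \<forall>s<3. dt (w t s) (w t (nx s)) = lam (lab t s)) \<and> (\<forall>e<m. posr (lam e)) \<and>
     (\<forall>t s t' s'. gl F lab t s t' s' \<longrightarrow> (\<exists>A\<in>G. hop F lab w t s t' s' A)) \<and>
     (\<forall>A\<in>G. \<forall>t<F. \<forall>t'<F. gp F lab w t A t') \<and> tagged uu kap \<and>
     (\<forall>i<n. horo F lab pun lam i = kap i) \<and>
     (\<forall>t<F. \<forall>s<3. \<exists>A\<in>G. w t s = mv A (uu (pun t s)))"

lemma geomD:
  assumes "geom F m lab pun w lam uu kap"
  shows "comb F m n lab pun" "t < F \<Longrightarrow> s < 3 \<Longrightarrow> dt (w t s) (w t (nx s)) = lam (lab t s)"
    "e < m \<Longrightarrow> posr (lam e)" "gl F lab t s t' s' \<Longrightarrow> \<exists>A\<in>G. hop F lab w t s t' s' A"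
    "A \<in> G \<Longrightarrow> t < F \<Longrightarrow> t' < F \<Longrightarrow> gp F lab w t A t'" "tagged uu kap"
    "i < n \<Longrightarrow> horo F lab pun lam i = kap i"
    "t < F \<Longrightarrow> s < 3 \<Longrightarrow> \<exists>A\<in>G. w t s = mv A (uu (pun t s))"
  using assms unfolding geom_def by auto

end

lemma prod_pos_part:
  "(\<Prod>j\<in>{j. j < m \<and> e j > 0}. y j ^ nat (e j)) = (\<Prod>j<m. y j ^ nat (e j))"
  for y :: "nat \<Rightarrow> 'a::comm_semiring_1"
proof (rule prod.mono_neutral_left)
  show "\<forall>i\<in>{..<m} - {j. j < m \<and> e j > 0}. y i ^ nat (e i) = 1"
  proof
    fix i assume "i \<in> {..<m} - {j. j < m \<and> e j > 0}"
    then have "nat (e i) = 0" by auto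
    then show "y i ^ nat (e i) = 1" by simp
  qed
qed auto

lemma mutate_fst:
  "fst (mutate m k S) = (fst S)(k := ((\<Prod>j<m. fst S j ^ nat (snd S j k)) +
     (\<Prod>j<m. fst S j ^ nat (- snd S j k))) / fst S k)"
proof -
  have neg: "{j. j < m \<and> snd S j k < 0} = {j. j < m \<and> - snd S j k > 0}" by simp
  show ?thesis
    unfolding mutate_def Let_def fst_conv fun_upd_def neg prod_pos_part ..
qed

section \<open>Flips of decorated structures\<close>

locale geoflip = flip F m lab t s t' s' k + holonomy G n u c
  for F m lab t s t' s' k G n u c +
  fixes pun w lam uu kap M
  assumes geom: "geom F m lab pun w lam uu kap" and M_in: "M \<in> G" and M_hop: "hop F lab w t s t' s' M"
begin

text \<open>The corner opposite to \<open>k\<close> in one triangle is carried into the frame of the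
  other by \<open>M\<close> or its inverse; the minus sign keeps the determinants along the sides
  positive.\<close>

definition w2 where
  "w2 x i = (if (x, i) = (t, s) then - mv M (w t' (nx (nx s'))) else
     if (x, i) = (t', s') then mv (adj M) (w t (nx (nx s))) else w x i)"

definition pun2 where
  "pun2 x i = (if (x, i) = (t, s) then pun t' (nx (nx s')) else
     if (x, i) = (t', s') then pun t (nx (nx s)) else pun x i)"

definition lam2 where
  "lam2 = lam(k := (lam ea * lam ec + lam eb * lam ed) / lam k)"

text \<open>Only \<open>ed\<close> and \<open>eb\<close> change triangles, to \<open>t\<close> and
  \<open>t'\<close>; their old frames are moved along by \<open>- M\<close> and
  \<open>adj M\<close>.\<close>

definition shift where
  "shift x i = (if (x, i) = (t, s) then - M else if (x, i) = (t', s') then adj M else 1)"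

lemma M_det: "det2 M = 1" using M_hop by (simp add: hop_def)

lemma M_mv: "mv M (w t' (nx s')) = w t s" "mv M (w t' s') = - w t (nx s)"
  using M_hop by (auto simp: hop_def)

lemma adjM_mv: "mv (adj M) (w t s) = w t' (nx s')" "mv (adj M) (w t (nx s)) = - w t' s'"
proof -
  show "mv (adj M) (w t s) = w t' (nx s')" using M_mv(1) mv_adj_left [OF M_det] by metis
  show "mv (adj M) (w t (nx s)) = - w t' s'" using M_mv(2) mv_adj_left [OF M_det] mv_minus minus_minus by metis
qed

lemma gl_k: "gl F lab t s t' s'" "gl F lab t' s' t s"
  using M_hop gl_sym by (auto simp: hop_def)

lemmas comb = geomD(1) [OF geom]
lemmas lam_dt = geomD(2) [OF geom]

lemma lam_pos: "x < F \<Longrightarrow> i < 3 \<Longrightarrow> posr (lam (lab x i))" "posr (lam k)"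
  using geomD(3) [OF geom] surf_lab [OF surf] k_less by auto

lemma w2_simps [simp]:
  "w2 t s = - mv M (w t' (nx (nx s')))" "w2 t (nx s) = w t (nx s)" "w2 t (nx (nx s)) = w t (nx (nx s))"
  "w2 t' s' = mv (adj M) (w t (nx (nx s)))" "w2 t' (nx s') = w t' (nx s')" "w2 t' (nx (nx s')) = w t' (nx (nx s'))"
  "x \<noteq> t \<Longrightarrow> x \<noteq> t' \<Longrightarrow> w2 x i = w x i"
  by (auto simp: w2_def)

lemma pun2_simps [simp]:
  "pun2 t s = pun t' (nx (nx s'))" "pun2 t (nx s) = pun t (nx s)" "pun2 t (nx (nx s)) = pun t (nx (nx s))"
  "pun2 t' s' = pun t (nx (nx s))" "pun2 t' (nx s') = pun t' (nx s')" "pun2 t' (nx (nx s')) = pun t' (nx (nx s'))"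
  "x \<noteq> t \<Longrightarrow> x \<noteq> t' \<Longrightarrow> pun2 x i = pun x i"
  by (auto simp: pun2_def)

lemma lam2_simps: "lam2 k = (lam ea * lam ec + lam eb * lam ed) / lam k" "e \<noteq> k \<Longrightarrow> lam2 e = lam e"
  by (auto simp: lam2_def)

lemma side_cases:
  assumes "x < F" "i < 3"
  obtains "x = t" "i = s" | "x = t" "i = nx s" | "x = t" "i = nx (nx s)"
    | "x = t'" "i = s'" | "x = t'" "i = nx s'" | "x = t'" "i = nx (nx s')" | "x \<noteq> t" "x \<noteq> t'"
  using less3_cases [of s i] less3_cases [of s' i] assms tF by blast

text \<open>This is \<open>dt_plucker\<close> for the four corners of the quadrilateral, developed
  into the frame of \<open>t\<close>.\<close>

lemma ptolemy: "dt (w t (nx (nx s))) (- mv M (w t' (nx (nx s')))) = lam2 k"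
proof -
  let ?A = "w t (nx s)" and ?B = "w t (nx (nx s))" and ?C = "w t s" and ?D = "mv M (w t' (nx (nx s')))"
  have 1: "dt ?A ?B = lam ea" "dt ?B ?C = lam eb" "dt ?C ?A = lam k"
    using lam_dt [of t "nx s"] lam_dt [of t "nx (nx s)"] lam_dt [of t s] k by auto
  have 2: "dt ?C ?D = lam ec" "- dt ?D ?A = lam ed"
    using lam_dt [of t' "nx s'"] lam_dt [of t' "nx (nx s')"] dt_mv [of M "w t' (nx s')" "w t' (nx (nx s'))"]
      dt_mv [of M "w t' (nx (nx s'))" "w t' s'"] M_mv M_det by auto
  have "dt ?B ?A * dt ?C ?D + dt ?B ?C * dt ?D ?A + dt ?B ?D * dt ?A ?C = 0"
    by (rule dt_plucker)
  then have "lam ea * lam ec + lam eb * lam ed + dt ?B ?D * lam k = 0"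
    using 1 2 dt_swap [of ?B ?A] dt_swap [of ?A ?C] by (simp add: algebra_simps flip: 2(2))
  then have "lam ea * lam ec + lam eb * lam ed = dt ?B (- ?D) * lam k"
    by (simp add: eq_neg_iff_add_eq_0)
  then show ?thesis using posr_neq_0 [OF lam_pos(2)] by (simp add: lam2_simps)
qed

lemma lam2_dt:
  assumes "x < F" "i < 3"
  shows "dt (w2 x i) (w2 x (nx i)) = lam2 (lab2 x i)"
  using assms
proof (cases rule: side_cases)
  case 1
  have "dt (- mv M (w t' (nx (nx s')))) (w t (nx s)) = dt (mv M (w t' (nx (nx s')))) (mv M (w t' s'))"
    by (simp add: M_mv)
  also have "\<dots> = lam ed" using lam_dt [of t' "nx (nx s')"] by (simp add: dt_mv M_det)
  finally show ?thesis using 1 by (simp add: lam2_simps)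
next
  case 4
  have "dt (mv (adj M) (w t (nx (nx s)))) (w t' (nx s')) = lam eb"
    using lam_dt [of t "nx (nx s)"] by (simp add: dt_adj M_mv)
  then show ?thesis using 4 by (simp add: lam2_simps)
next
  case 3
  then show ?thesis using ptolemy by simp
next
  case 6
  have "dt (w t' (nx (nx s'))) (mv (adj M) (w t (nx (nx s)))) = dt (mv M (w t' (nx (nx s')))) (w t (nx (nx s)))"
    by (simp add: dt_adj)
  also have "\<dots> = lam2 k" using ptolemy dt_swap [of "mv M (w t' (nx (nx s')))"] by simp
  finally show ?thesis using 6 by simp
next
  case 7
  then show ?thesis using lam_dt assms lab_neq_k [OF assms] by (simp add: lam2_simps)
qed (use lam_dt in \<open>simp_all add: lam2_simps\<close>)

lemma lam2_pos: "e < m \<Longrightarrow> posr (lam2 e)"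
  using geomD(3) [OF geom] lam_pos nxs tF
  by (cases "e = k") (auto simp: lam2_simps intro!: posr_divide posr_add posr_mult)

lemma shift_frame:
  assumes "x < F" "i < 3" "lab2 x i \<noteq> k"
  shows "mv (shift x i) (w (fst (rho x i)) (snd (rho x i))) = w2 x i"
    "mv (shift x i) (w (fst (rho x i)) (nx (snd (rho x i)))) = w2 x (nx i)"
    "pun2 x i = pun (fst (rho x i)) (snd (rho x i))" "pun2 x (nx i) = pun (fst (rho x i)) (nx (snd (rho x i)))"
proof -
  have "mv (shift x i) (w (fst (rho x i)) (snd (rho x i))) = w2 x i \<and>
    mv (shift x i) (w (fst (rho x i)) (nx (snd (rho x i)))) = w2 x (nx i) \<and>
    pun2 x i = pun (fst (rho x i)) (snd (rho x i)) \<and> pun2 x (nx i) = pun (fst (rho x i)) (nx (snd (rho x i)))"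
    using assms(1,2)
    by (cases rule: side_cases)
      (use assms(3) combD(2) [OF comb gl_k(1)] combD(2) [OF comb gl_k(2)] in
        \<open>simp_all add: shift_def rho_def mv_uminus M_mv adjM_mv\<close>)
  then show "mv (shift x i) (w (fst (rho x i)) (snd (rho x i))) = w2 x i"
    "mv (shift x i) (w (fst (rho x i)) (nx (snd (rho x i)))) = w2 x (nx i)"
    "pun2 x i = pun (fst (rho x i)) (snd (rho x i))" "pun2 x (nx i) = pun (fst (rho x i)) (nx (snd (rho x i)))"
    by simp_all
qed

lemma shift_in: "shift x i \<in> G" "det2 (shift x i) = 1"
  using M_in M_det by (auto simp: shift_def G_one G_minus G_adj)

lemma rho_gl:
  assumes "gl F lab2 x i y j"
  shows "gl F lab (fst (rho x i)) (snd (rho x i)) (fst (rho y j)) (snd (rho y j))"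
proof -
  have "rho x i \<noteq> rho y j" using assms rho_irho [of x i] rho_irho [of y j] by (auto simp: gl_def)
  then show ?thesis using assms rho_range by (auto simp: gl_def lab2_def prod_eq_iff)
qed

lemma irho_gl:
  assumes "gl F lab x i y j"
  shows "gl F lab2 (fst (irho x i)) (snd (irho x i)) (fst (irho y j)) (snd (irho y j))"
proof -
  have "irho x i \<noteq> irho y j" using assms irho_rho [of x i] irho_rho [of y j] by (auto simp: gl_def)
  then show ?thesis using assms irho_range by (auto simp: gl_def lab2_irho prod_eq_iff)
qed

lemma gl2_k: "gl F lab2 t (nx (nx s)) t' (nx (nx s'))"
  by (simp add: gl_def)

lemma hop2_k: "hop F lab2 w2 t (nx (nx s)) t' (nx (nx s')) M"
  using gl2_k M_det by (simp add: hop_def)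

lemma gl2_k_cases:
  assumes "gl F lab2 x i y j" "lab2 x i = k"
  shows "(x, i, y, j) = (t, nx (nx s), t', nx (nx s')) \<or> (x, i, y, j) = (t', nx (nx s'), t, nx (nx s))"
  using k2_sides [of x i] k2_sides [of y j] assms by (auto simp: gl_def)

lemma gl_k_cases:
  assumes "gl F lab x i y j" "lab x i = k"
  shows "(x, i, y, j) = (t, s, t', s') \<or> (x, i, y, j) = (t', s', t, s)"
  using k_sides [of x i] k_sides [of y j] assms by (auto simp: gl_def)

lemma hop2_shift:
  assumes "gl F lab2 x i y j" "lab2 x i \<noteq> k"
    and "hop F lab w (fst (rho x i)) (snd (rho x i)) (fst (rho y j)) (snd (rho y j)) A"
  shows "hop F lab2 w2 x i y j (shift x i * A * adj (shift y j))"
proof -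
  have xy: "x < F" "i < 3" "y < F" "j < 3" "lab2 y j \<noteq> k" using assms by (auto simp: gl_def)
  show ?thesis
    unfolding hop_def
    using assms(1,3) shift_in shift_frame [OF xy(1,2) assms(2)] shift_frame [OF xy(3-5)]
    by (simp add: hop_def det2_mult mv_mult flip: shift_frame(1,2) [OF xy(3-5)] shift_frame(1,2) [OF xy(1,2) assms(2)])
qed

lemma hop2_ex:
  assumes "gl F lab2 x i y j"
  shows "\<exists>A\<in>G. hop F lab2 w2 x i y j A"
proof (cases "lab2 x i = k")
  case True
  then show ?thesis using gl2_k_cases [OF assms] hop2_k hop_rev [OF hop2_k] M_in G_minus G_adj by fast
next
  case False
  obtain A where "A \<in> G" "hop F lab w (fst (rho x i)) (snd (rho x i)) (fst (rho y j)) (snd (rho y j)) A"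
    using geomD(4) [OF geom rho_gl [OF assms]] by blast
  then show ?thesis
    using hop2_shift [OF assms False, of A] shift_in(1) [of x i] shift_in(1) [of y j]
    by (intro bexI [of _ "shift x i * A * adj (shift y j)"] G_mult G_adj)
qed

lemma gp2_shift:
  assumes "x < F" "i < 3" "lab2 x i \<noteq> k"
  shows "gp F lab2 w2 x (shift x i) (fst (rho x i))"
proof -
  have "gp F lab2 w2 t (- M) t'"
    using gp_trans [OF gp_hop [OF hop2_k] gp_uminus_one [OF hop2_k]] by simp
  note g = this gp_hop_adj [OF hop2_k]
  show ?thesis
    using assms(1,2)
    by (cases rule: side_cases) (use assms g in \<open>auto simp: shift_def rho_def intro: gp.base\<close>)
qed

text \<open>The new diagonal is glued by the same \<open>M\<close>, and each \<open>shift\<close> is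
  itself a path across it. An old crossing is thus a new path, with detours through the new
  diagonal, and all of \<open>G\<close> stays reachable.\<close>

lemma hop_imp_gp2:
  assumes "hop F lab w x i y j A"
  shows "gp F lab2 w2 x A y"
proof (cases "lab x i = k")
  case True
  have "dt (w t' (nx s')) (w t' s') \<noteq> 0" "dt (w t (nx s)) (w t s) \<noteq> 0"
    using lam_dt [of t' s'] lam_dt [of t s] posr_neq_0 [OF lam_pos(2)] k dt_swap
    by (metis neg_equal_0_iff_equal nxs(22,24,23,21))+
  then have "B = M" if "hop F lab w t s t' s' B" for B
    using that M_hop mat2_eqI [of "w t' (nx s')" "w t' s'" B M] by (auto simp: hop_def)
  then have "A = M \<and> x = t \<and> y = t' \<or> - adj A = M \<and> x = t' \<and> y = t"
    using gl_k_cases [of x i y j] True assms hop_rev [OF assms] by (auto simp: hop_def)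
  then show ?thesis
  proof
    assume "A = M \<and> x = t \<and> y = t'"
    then show ?thesis using gp_hop [OF hop2_k] by simp
  next
    assume a: "- adj A = M \<and> x = t' \<and> y = t"
    then have "A = - adj M" by (metis adj_adj adj_uminus minus_minus)
    then show ?thesis using gp_hop [OF hop_rev [OF hop2_k]] a by simp
  qed
next
  case False
  define x' i' y' j' where xy: "x' = fst (irho x i)" "i' = snd (irho x i)" "y' = fst (irho y j)" "j' = snd (irho y j)"
  have gl: "gl F lab x i y j" using assms by (simp add: hop_def)
  then have gl2: "gl F lab2 x' i' y' j'" using irho_gl xy by blast
  have r: "rho x' i' = (x, i)" "rho y' j' = (y, j)" using irho_rho xy by auto
  have l: "lab2 x' i' \<noteq> k" "lab2 y' j' \<noteq> k" using gl2 False r by (auto simp: lab2_def gl_def)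
  have h: "hop F lab2 w2 x' i' y' j' (shift x' i' * A * adj (shift y' j'))"
    using hop2_shift [OF gl2 l(1)] r assms by simp
  have "gp F lab2 w2 x (adj (shift x' i')) x'" "gp F lab2 w2 y' (shift y' j') y"
    using gp_rev [OF gp2_shift [OF _ _ l(1)]] gp2_shift [OF _ _ l(2)] gl2 r by (auto simp: gl_def)
  then have "gp F lab2 w2 x (adj (shift x' i') * (shift x' i' * A * adj (shift y' j')) * shift y' j') y"
    using gp_trans gp_hop [OF h] by blast
  moreover have "adj (shift x' i') * (shift x' i' * A * adj (shift y' j')) * shift y' j' =
      (adj (shift x' i') * shift x' i') * A * (adj (shift y' j') * shift y' j')"
    by (simp only: mult.assoc)
  ultimately show ?thesis by (simp add: adj_left shift_in)
qed

lemma gp_imp_gp2: "gp F lab w x A y \<Longrightarrow> gp F lab2 w2 x A y"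
  by (induction rule: gp.induct) (auto intro: gp.base gp_trans hop_imp_gp2)

lemma comb2: "comb F m n lab2 pun2"
proof -
  have compat: "pun2 x i = pun2 y (nx j)" if g: "gl F lab2 x i y j" for x i y j
  proof (cases "lab2 x i = k")
    case True
    then show ?thesis using gl2_k_cases [OF g] by auto
  next
    case False
    have xy: "x < F" "i < 3" "y < F" "j < 3" "lab2 y j \<noteq> k" using g False by (auto simp: gl_def)
    show ?thesis using combD(2) [OF comb rho_gl [OF g]] shift_frame [OF xy(1,2) False] shift_frame [OF xy(3-5)]
      by simp
  qed
  have onto: "\<exists>x<F. \<exists>q<3. pun2 x q = i" if i: "i < n" for i
  proof -
    obtain x q where x: "x < F" "q < 3" "pun x q = i" using combD(4) [OF comb i] by blast
    consider "(x, q) = (t, s)" | "(x, q) = (t', s')" | "(x, q) \<noteq> (t, s)" "(x, q) \<noteq> (t', s')" by blast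
    then show ?thesis
    proof cases
      case 1
      then have "pun2 t' (nx s') = i" using x combD(2) [OF comb gl_k(1)] by simp
      then show ?thesis using nxs by blast
    next
      case 2
      then have "pun2 t (nx s) = i" using x combD(2) [OF comb gl_k(2)] by simp
      then show ?thesis using nxs by blast
    next
      case 3
      then have "pun2 x q = i" using x by (auto simp: pun2_def)
      then show ?thesis using x by blast
    qed
  qed
  have sep: "f x i = f y j"
    if f: "\<forall>x i y j. gl F lab2 x i y j \<longrightarrow> f x i = f y (nx j)"
      and xy: "x < F" "i < 3" "y < F" "j < 3" "pun2 x i = pun2 y j" for f :: "nat \<Rightarrow> nat \<Rightarrow> bool" and x i y j
  proof -
    \<comment> \<open>Transport of the predicate to the old corners. The slots \<open>(t, s)\<close>
      and \<open>(t', s')\<close> have moved to other corners of the quadrilateral, so their old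
      values are read off in the opposite triangle at the corner glued to them.\<close>
    define f0 where "f0 x i = (if (x, i) = (t, s) then f t' (nx s') else
      if (x, i) = (t', s') then f t (nx s) else f x i)" for x i
    have f0s: "f0 t s = f t' (nx s')" "f0 t (nx s) = f t (nx s)" "f0 t (nx (nx s)) = f t (nx (nx s))"
      "f0 t' s' = f t (nx s)" "f0 t' (nx s') = f t' (nx s')" "f0 t' (nx (nx s')) = f t' (nx (nx s'))"
      "\<And>x i. x \<noteq> t \<Longrightarrow> x \<noteq> t' \<Longrightarrow> f0 x i = f x i"
      by (auto simp: f0_def)
    have fk: "f t (nx (nx s)) = f t' s'" "f t' (nx (nx s')) = f t s"
      using f gl2_k gl_sym [OF gl2_k] by fastforce+
    have fr: "f x i = f0 (fst (rho x i)) (snd (rho x i)) \<and> f x (nx i) = f0 (fst (rho x i)) (nx (snd (rho x i)))"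
      if "x < F" "i < 3" "lab2 x i \<noteq> k" for x i
      using that(1,2) by (cases rule: side_cases) (use that(3) in \<open>simp_all add: rho_def f0s fk\<close>)
    have c0: "f0 x i = f0 y (nx j)" if g: "gl F lab x i y j" for x i y j
    proof (cases "lab x i = k")
      case True
      then show ?thesis using gl_k_cases [OF g] by (auto simp: f0s)
    next
      case False
      define x' i' y' j' where xy: "x' = fst (irho x i)" "i' = snd (irho x i)" "y' = fst (irho y j)" "j' = snd (irho y j)"
      have gl2: "gl F lab2 x' i' y' j'" using irho_gl [OF g] xy by blast
      have r: "rho x' i' = (x, i)" "rho y' j' = (y, j)" using irho_rho xy by auto
      have l: "lab2 x' i' \<noteq> k" "lab2 y' j' \<noteq> k" using gl2 False r by (auto simp: lab2_def gl_def)
      have "f0 x i = f x' i'" "f0 y (nx j) = f y' (nx j')"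
        using fr [OF _ _ l(1)] fr [OF _ _ l(2)] gl2 r by (auto simp: gl_def)
      then show ?thesis using f gl2 by simp
    qed
    \<comment> \<open>For each new corner an old corner at the same vertex of the
      quadrilateral.\<close>
    define o1 where "o1 x i = (if (x, i) = (t, s) then (t', nx (nx s')) else if (x, i) = (t', s') then (t, nx (nx s)) else (x, i))" for x i
    have o1: "f x i = f0 (fst (o1 x i)) (snd (o1 x i))" "pun2 x i = pun (fst (o1 x i)) (snd (o1 x i))"
      "x < F \<Longrightarrow> i < 3 \<Longrightarrow> fst (o1 x i) < F \<and> snd (o1 x i) < 3" for x i
      using fk by (auto simp: o1_def f0_def pun2_def)
    show ?thesis
      using comb_sep [OF comb, of f0 "fst (o1 x i)" "snd (o1 x i)" "fst (o1 y j)" "snd (o1 y j)"] c0 xy o1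
      by auto
  qed
  have rng: "pun2 x i < n" if "x < F" "i < 3" for x i
    using combD(3) [OF comb] that by (auto simp: pun2_def)
  show ?thesis
    unfolding comb_def
    by (intro conjI allI impI surf2 combD(5) [OF comb]) (fact compat rng onto sep)+
qed

text \<open>At each end of the old diagonal two corners merge, at each end of the new one a corner
  is split. By the Ptolemy relation the contributions agree: \<open>idA\<close> and
  \<open>idC\<close> treat the merging, \<open>idB\<close> and \<open>idD\<close> the
  splitting.\<close>

lemma horo2: "horo F lab2 pun2 lam2 i = horo F lab pun lam i"
proof -
  let ?q = "\<lambda>lab pun lam x s. if pun x s = i then lam (lab x (nx s)) / (lam (lab x s) * lam (lab x (nx (nx s)))) else (0::ratfun)"
  have rest: "(\<Sum>x\<in>{..<F} - {t, t'}. \<Sum>j<3. ?q lab2 pun2 lam2 x j) = (\<Sum>x\<in>{..<F} - {t, t'}. \<Sum>j<3. ?q lab pun lam x j)"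
  proof (rule sum.cong [OF refl], rule sum.cong [OF refl])
    fix x j assume "x \<in> {..<F} - {t, t'}" "j \<in> {..<3::nat}"
    then have "x < F" "x \<noteq> t" "x \<noteq> t'" "j < 3" by auto
    then show "?q lab2 pun2 lam2 x j = ?q lab pun lam x j"
      using lab_neq_k [of x j] lab_neq_k [of x "nx j"] lab_neq_k [of x "nx (nx j)"]
      by (simp add: lam2_simps)
  qed
  define a b c d l l2 where abcd: "a = lam ea" "b = lam eb" "c = lam ec" "d = lam ed" "l = lam k" "l2 = lam2 k"
  have nz: "a \<noteq> 0" "b \<noteq> 0" "c \<noteq> 0" "d \<noteq> 0" "l \<noteq> 0" "l2 \<noteq> 0"
    using lam_pos lam2_pos [OF k_less] posr_neq_0 by (auto simp: abcd)
  have l2: "a * c + b * d = l2 * l" using nz by (simp add: abcd lam2_simps)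
  have l2': "l2 = (a * c + b * d) / l" using nz l2 by (simp add: field_simps)
  have nz2: "a * c + b * d \<noteq> 0" using nz l2 by simp
  have idA: "b / (a * l) + c / (l * d) = l2 / (a * d)"
    using nz by (simp add: l2' field_simps)
  have idC: "a / (l * b) + d / (c * l) = l2 / (c * b)"
    using nz by (simp add: l2' field_simps)
  have idB: "d / (l2 * a) + c / (b * l2) = l / (b * a)"
    using nz nz2 by (simp add: l2' divide_simps) (simp add: algebra_simps)
  have idD: "a / (d * l2) + b / (l2 * c) = l / (d * c)"
    using nz nz2 by (simp add: l2' divide_simps) (simp add: algebra_simps)
  have p: "pun t s = pun t' (nx s')" "pun t' s' = pun t (nx s)"
    using combD(2) [OF comb gl_k(1)] combD(2) [OF comb gl_k(2)] by auto
  have old: "(\<Sum>j<3. ?q lab pun lam t j) + (\<Sum>j<3. ?q lab pun lam t' j) =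
      (if pun t (nx s) = i then l2 / (a * d) else 0) + (if pun t' (nx s') = i then l2 / (c * b) else 0)
      + (if pun t (nx (nx s)) = i then l / (b * a) else 0) + (if pun t' (nx (nx s')) = i then l / (d * c) else 0)"
    unfolding idA [symmetric] idC [symmetric]
    by (subst sum_less3 [of s], simp, subst sum_less3 [of s'], simp) (simp add: p k abcd)
  have new: "(\<Sum>j<3. ?q lab2 pun2 lam2 t j) + (\<Sum>j<3. ?q lab2 pun2 lam2 t' j) =
      (if pun t (nx s) = i then l2 / (a * d) else 0) + (if pun t' (nx s') = i then l2 / (c * b) else 0)
      + (if pun t (nx (nx s)) = i then l / (b * a) else 0) + (if pun t' (nx (nx s')) = i then l / (d * c) else 0)"
    unfolding idB [symmetric] idD [symmetric]
    by (subst sum_less3 [of s], simp, subst sum_less3 [of s'], simp) (simp add: abcd lam2_simps(2))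
  show ?thesis
    unfolding horo_def sum_split rest using old new by (simp add: add.assoc [symmetric])
qed

lemma geom2: "geom F m lab2 pun2 w2 lam2 uu kap"
proof -
  have "\<exists>A\<in>G. w2 x i = mv A (uu (pun2 x i))" if "x < F" "i < 3" for x i
  proof -
    obtain A where A: "A \<in> G" "w t' (nx (nx s')) = mv A (uu (pun t' (nx (nx s'))))"
      using geomD(8) [OF geom, of t' "nx (nx s')"] by auto
    obtain B where B: "B \<in> G" "w t (nx (nx s)) = mv B (uu (pun t (nx (nx s))))"
      using geomD(8) [OF geom, of t "nx (nx s)"] by auto
    consider "(x, i) = (t, s)" | "(x, i) = (t', s')" | "(x, i) \<noteq> (t, s)" "(x, i) \<noteq> (t', s')" by blast
    then show ?thesis
    proof cases
      case 1
      then have "w2 x i = mv (- (M * A)) (uu (pun2 x i))"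
        using A by (simp add: mv_mult mv_uminus)
      then show ?thesis using A M_in G_mult G_minus by blast
    next
      case 2
      then have "w2 x i = mv (adj M * B) (uu (pun2 x i))"
        using B by (simp add: mv_mult)
      then show ?thesis using B M_in G_mult G_adj by blast
    next
      case 3
      then show ?thesis using geomD(8) [OF geom that] by (auto simp: w2_def pun2_def)
    qed
  qed
  then show ?thesis
    unfolding geom_def using comb2 lam2_dt lam2_pos hop2_ex geomD(5,6,7) [OF geom] gp_imp_gp2 horo2 by auto
qed

text \<open>The numerator of the Ptolemy relation is the exchange binomial times
  \<open>R * R2\<close>, where \<open>R\<close> and \<open>R2\<close> are the radii appearing when
  \<open>k\<close> is a loop before or after the flip. Division by \<open>lam k = y k * R\<close>
  leaves the new variable times \<open>R2\<close>.\<close>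

lemma seedrel2:
  assumes S: "seedrel F m lab lam S"
  shows "seedrel F m lab2 lam2 (mutate m k S)"
proof -
  define y where "y = fst S"
  have y: "\<And>j. j < m \<Longrightarrow> posr (y j)" "\<And>e. e < m \<Longrightarrow> lam e = (\<Prod>j<m. y j ^ EE F lab e j)"
    and C: "snd S = cmat F lab" using S by (auto simp: seedrel_def y_def)
  define Pp where "Pp = (\<Prod>j<m. y j ^ nat (cmat F lab j k))"
  define Pm where "Pm = (\<Prod>j<m. y j ^ nat (- cmat F lab j k))"
  define y' where "y' = fst (mutate m k S)"
  have y': "y' = y(k := (Pp + Pm) / y k)"
    unfolding y'_def mutate_fst by (simp add: C y_def Pp_def Pm_def)
  have pos': "posr (y' j)" if "j < m" for j
    using that y k_less by (auto simp: y' Pp_def Pm_def intro!: posr_divide posr_add posr_prod posr_power)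
  have other: "lam2 e = (\<Prod>j<m. y' j ^ EE F lab2 e j)" if "e < m" "e \<noteq> k" for e
  proof -
    have "lam2 e = (\<Prod>j<m. y j ^ EE F lab e j)" using that y by (simp add: lam2_simps)
    also have "\<dots> = (\<Prod>j<m. y' j ^ EE F lab2 e j)"
      using that EE_at_k by (intro prod.cong) (auto simp: y' EE2_other)
    finally show ?thesis .
  qed
  define r where "r j = (if sf F lab k j then 1 else 0 :: nat)" for j
  define r2 where "r2 j = (if sf F lab2 k j then 1 else 0 :: nat)" for j
  have mur: "mu j = r j + r2 j" for j by (simp add: mu_def r_def r2_def)
  have split_k: "(\<Prod>j<m. z j ^ EE F lab k j) = z k * (\<Prod>j<m. z j ^ r j)"
    "(\<Prod>j<m. z j ^ EE F lab2 k j) = z k * (\<Prod>j<m. z j ^ r2 j)" for z :: "nat \<Rightarrow> ratfun"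
  proof -
    have "(\<Prod>j<m. z j ^ (if j = k then 1 else 0)) = z k"
    proof -
      have "(\<Prod>j<m. z j ^ (if j = k then 1 else 0)) = (\<Prod>j<m. if j = k then z j else 1)"
        by (rule prod.cong) auto
      then show ?thesis using k_less by simp
    qed
    then show "(\<Prod>j<m. z j ^ EE F lab k j) = z k * (\<Prod>j<m. z j ^ r j)"
      "(\<Prod>j<m. z j ^ EE F lab2 k j) = z k * (\<Prod>j<m. z j ^ r2 j)"
      by (simp_all add: EE_k power_add prod.distrib r_def r2_def)
  qed
  have P: "EE F lab ea j + EE F lab ec j = mu j + nat (cmat F lab j k)"
    "EE F lab eb j + EE F lab ed j = mu j + nat (- cmat F lab j k)" for j
    using min_EE [of j] unfolding cmat_col by linarith+
  have "lam ea * lam ec = (\<Prod>j<m. y j ^ (EE F lab ea j + EE F lab ec j))"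
    using y(2) surf_lab [OF surf] by (simp add: power_add prod.distrib)
  then have ac: "lam ea * lam ec = (\<Prod>j<m. y j ^ mu j) * Pp"
    unfolding P by (simp add: power_add prod.distrib Pp_def)
  have "lam eb * lam ed = (\<Prod>j<m. y j ^ (EE F lab eb j + EE F lab ed j))"
    using y(2) surf_lab [OF surf] by (simp add: power_add prod.distrib)
  then have bd: "lam eb * lam ed = (\<Prod>j<m. y j ^ mu j) * Pm"
    unfolding P by (simp add: power_add prod.distrib Pm_def)
  define R R2 where RR: "R = (\<Prod>j<m. y j ^ r j)" "R2 = (\<Prod>j<m. y j ^ r2 j)"
  have MU: "(\<Prod>j<m. y j ^ mu j) = R * R2" by (simp add: mur power_add prod.distrib RR)
  have nz: "R \<noteq> 0" "y k \<noteq> 0"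
    unfolding RR by (rule posr_neq_0, intro posr_prod posr_power y(1), use k_less in simp)+
  have "lam2 k = R * R2 * (Pp + Pm) / (y k * R)"
    using k_less by (simp add: lam2_simps ac bd MU y(2) split_k RR [symmetric] distrib_left)
  also have "\<dots> = y' k * R2" using nz by (simp add: y' field_simps)
  also have "R2 = (\<Prod>j<m. y' j ^ r2 j)"
    unfolding RR using sf_k_k(2) by (intro prod.cong) (auto simp: y' r2_def)
  also have "y' k * \<dots> = (\<Prod>j<m. y' j ^ EE F lab2 k j)" by (simp add: split_k)
  finally have "lam2 k = (\<Prod>j<m. y' j ^ EE F lab2 k j)" .
  moreover have "snd (mutate m k S) = cmat F lab2"
    unfolding mutate_def Let_def snd_conv C by (intro ext) (simp only: cmat_mutate)
  ultimately show ?thesis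
    using other pos' by (auto simp: seedrel_def y'_def)
qed

end

section \<open>Changing tags and closure under mutation\<close>

lemma sv_minus [simp]: "sv k (- v) = - sv k v"
  by (cases v) simp

lemma wedge_swap: "wedge f g i j = - wedge g f i j"
  by (simp add: wedge_def)

lemma wedge_self [simp]: "wedge f f i j = 0"
  by (simp add: wedge_def)

text \<open>A self-folded triangle with loop \<open>l\<close> and radius \<open>r\<close>.
  Exchanging the two labels amounts to switching the tags at the enclosed puncture: the seed stays
  the same, but \<open>r\<close> now labels the loop and can be flipped.\<close>

locale geoswap = holonomy +
  fixes F m lab pun w lam uu kap t s l r
  assumes geom: "geom F m lab pun w lam uu kap" and tF: "t < F" "s < 3"
    and lr: "lab t s = l" "lab t (nx s) = r" "lab t (nx (nx s)) = r"
begin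

lemmas comb = geomD(1) [OF geom]
lemmas surf = combD(1) [OF comb]

lemma nxs [simp]: "nx s < 3" "nx (nx s) < 3" "s < 3" "t < F" "nx (nx (nx s)) = s"
  "nx s \<noteq> s" "nx (nx s) \<noteq> s" "s \<noteq> nx s" "s \<noteq> nx (nx s)" "nx (nx s) \<noteq> nx s" "nx s \<noteq> nx (nx s)"
  using tF by auto

lemma sf_lr: "sf F lab l r" using tF lr unfolding sf_def by blast

lemma l_neq_r [simp]: "l \<noteq> r" "r \<noteq> l" using sf_neq [OF surf sf_lr] by auto

lemma lr_less: "l < m" "r < m" using sf_less [OF surf sf_lr] by auto

lemma r_sides: "x < F \<Longrightarrow> i < 3 \<Longrightarrow> lab x i = r \<Longrightarrow> x = t \<and> (i = nx s \<or> i = nx (nx s))"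
  by (rule sf_radius_sides [OF surf tF lr(2,3)])

lemma t_l: "i < 3 \<Longrightarrow> lab t i = l \<Longrightarrow> i = s"
  using less3_cases [of s i] lr l_neq_r tF by metis

abbreviation "v \<equiv> pun t (nx (nx s))"

text \<open>The two sides at this corner are glued to each other, so the predicate singling out the
  corner is compatible with the gluing.\<close>

lemma cusp_unique:
  assumes "x < F" "i < 3" "pun x i = v"
  shows "x = t \<and> i = nx (nx s)"
proof -
  let ?f = "\<lambda>x i. x = t \<and> i = nx (nx s)"
  have "?f x i = ?f y (nx j)" if g: "gl F lab x i y j" for x i y j
  proof
    assume "?f x i"
    then have "lab y j = r" "(y, j) \<noteq> (t, nx (nx s))" "y < F" "j < 3" using g lr by (auto simp: gl_def)
    then show "?f y (nx j)" using r_sides by auto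
  next
    assume a: "?f y (nx j)"
    then have "j = nx s" using g nx_simps(6) [of j] by (auto simp: gl_def)
    then have "lab x i = r" "(x, i) \<noteq> (t, nx s)" "x < F" "i < 3" using g lr a by (auto simp: gl_def)
    then show "?f x i" using r_sides by auto
  qed
  then have "?f x i = ?f t (nx (nx s))"
    using comb_sep [OF comb, of ?f x i t "nx (nx s)"] assms by simp
  then show ?thesis by simp
qed

text \<open>Two self-folded triangles with a common loop would fill a sphere with three punctures.\<close>

lemma loop_radius_unique:
  assumes "sf F lab l j"
  shows "j = r"
proof (rule ccontr)
  assume "j \<noteq> r"
  obtain t1 s1 where t1: "t1 < F" "s1 < 3" "lab t1 s1 = l" "lab t1 (nx s1) = j" "lab t1 (nx (nx s1)) = j"
    using assms by (auto simp: sf_def)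
  have "t1 \<noteq> t" using t_l t1 \<open>j \<noteq> r\<close> lr by auto
  have t1_sides: "lab t1 i = l \<and> i = s1 \<or> lab t1 i = j" if "i < 3" for i
    using less3_cases [OF t1(2) that] t1 by auto
  have t_sides: "lab t i = l \<and> i = s \<or> lab t i = r" if "i < 3" for i
    using less3_cases [OF tF(2) that] lr by auto
  have closed: "y \<in> {t, t1}" if "gl F lab x i y q" "x \<in> {t, t1}" for x i y q
  proof -
    have xy: "x < F" "i < 3" "y < F" "q < 3" "lab y q = lab x i" using that by (auto simp: gl_def)
    have "x = t \<or> x = t1" using that(2) by simp
    then consider "lab y q = r" | "lab y q = j" | "lab y q = l"
      using t_sides [OF xy(2)] t1_sides [OF xy(2)] xy(5) by metis
    then show ?thesis
    proof cases
      case 1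
      then show ?thesis using r_sides xy by auto
    next
      case 2
      then show ?thesis using sf_radius_sides [OF surf t1(1,2,4,5), of y q] xy by auto
    next
      case 3
      then show ?thesis using surf_three [OF surf tF t1(1,2) xy(3,4)] lr t1 \<open>t1 \<noteq> t\<close> by auto
    qed
  qed
  have reach: "y \<in> {t, t1}" if "gp F lab w x A y" "x \<in> {t, t1}" for x A y
    using that by (induction rule: gp.induct) (auto simp: hop_def dest: closed)
  have "{..<F} \<subseteq> {t, t1}"
    using reach geomD(5) [OF geom G_one tF(1)] by fastforce
  \<comment> \<open>With so few triangles \<open>comb\<close> leaves a single puncture, but
    \<open>v\<close> has only one of the corners.\<close>
  then have "F \<le> 2" using card_mono [of "{t, t1}" "{..<F}"] \<open>t1 \<noteq> t\<close> by simp
  then have "n = 1" using combD(5) [OF comb] by simp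
  then have "pun t s = v" using combD(3) [OF comb] tF by (metis less_one nxs(2))
  then show False using cusp_unique [of t s] by simp
qed

definition tau where "tau = Transposition.transpose l r"
definition lab3 where "lab3 x i = tau (lab x i)"
definition sc where "sc i = (if i = v then kap v else 1)"
definition w3 where "w3 x i = sv (sc (pun x i)) (w x i)"
text \<open>The new radius \<open>l\<close> has length \<open>lam l / lam r\<close>, which is
  \<open>kap v * lam r\<close> by \<open>kap_v\<close>: the old radius with its vector at
  \<open>v\<close> rescaled. The loop keeps its length under the label \<open>r\<close>.\<close>

definition lam3 where "lam3 = lam(r := lam l, l := lam l / lam r)"
definition uu3 where "uu3 i = sv (sc i) (uu i)"
definition kap3 where "kap3 = kap(v := 1 / kap v)"

lemma tau_simps: "tau l = r" "tau r = l" "e \<noteq> l \<Longrightarrow> e \<noteq> r \<Longrightarrow> tau e = e" "tau (tau e) = e"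
  by (auto simp: tau_def transpose_def)

lemma tau_eq: "tau a = b \<longleftrightarrow> a = tau b" "tau a = tau b \<longleftrightarrow> a = b"
  using tau_simps(4) by metis+

lemma gl3: "gl F lab3 x i y j = gl F lab x i y j"
  by (auto simp: gl_def lab3_def tau_eq(2))

lemma tau_less: "tau e < m \<longleftrightarrow> e < m"
  using lr_less tau_simps by (metis (full_types))

lemma surf3: "surf F m lab3"
  using surf tau_less by (auto simp: surf_def lab3_def tau_eq(1))

lemma sf3: "sf F lab3 e j \<longleftrightarrow> sf F lab (tau e) (tau j)"
  by (simp add: sf_def lab3_def tau_eq(1))

lemma not_sf_r: "\<not> sf F lab r j"
proof
  assume "sf F lab r j"
  then obtain x i where x: "x < F" "i < 3" "lab x i = r" "lab x (nx i) = j" "lab x (nx (nx i)) = j"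
    by (auto simp: sf_def)
  then show False using r_sides [of x i] lr l_neq_r nxs(5) by metis
qed

lemma not_sf_l: "\<not> sf F lab e l"
proof
  assume "sf F lab e l"
  then obtain x i where x: "x < F" "i < 3" "lab x i = e" "lab x (nx i) = l" "lab x (nx (nx i)) = l"
    by (auto simp: sf_def)
  then have "x = t" using sf_radius_sides [OF surf x(1,2,4,5), of t s] lr by auto
  then have "nx i = s" "nx (nx i) = s" using t_l x by auto
  then show False using x by auto
qed

lemma EE3: "EE F lab3 r = EE F lab l" "EE F lab3 l j = (if j = l then 1 else 0)"
  "EE F lab r j = (if j = r then 1 else 0)"
  "EE F lab l j = (if j = l then 1 else 0) + (if j = r then 1 else 0)"
  "e \<noteq> l \<Longrightarrow> e \<noteq> r \<Longrightarrow> EE F lab3 e = EE F lab e"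
proof -
  have l: "sf F lab l j \<longleftrightarrow> j = r" for j using loop_radius_unique sf_lr by blast
  show 1: "EE F lab l j = (if j = l then 1 else 0) + (if j = r then 1 else 0)" for j by (simp add: EE_def l)
  show "EE F lab3 r = EE F lab l"
    by (rule ext) (simp add: 1, simp add: EE_def sf3 tau_simps l tau_eq)
  show "EE F lab3 l j = (if j = l then 1 else 0)" "EE F lab r j = (if j = r then 1 else 0)"
    by (simp_all add: EE_def sf3 tau_simps not_sf_r)
  show "EE F lab3 e = EE F lab e" if "e \<noteq> l" "e \<noteq> r"
  proof -
    have "sf F lab e (tau j) \<longleftrightarrow> sf F lab e j" for j
      using not_sf_l [of e] sf_radius_loop_unique [OF surf sf_lr, of e] that tau_simps by metis
    then show ?thesis using that by (auto simp: EE_def sf3 tau_simps)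
  qed
qed

lemma lab_neq_r: "x < F \<Longrightarrow> i < 3 \<Longrightarrow> x \<noteq> t \<Longrightarrow> lab x i \<noteq> r"
  using r_sides by blast

lemma EE3_lab: "x < F \<Longrightarrow> i < 3 \<Longrightarrow> x \<noteq> t \<Longrightarrow> EE F lab3 (lab3 x i) = EE F lab (lab x i)"
  using lab_neq_r [of x i] by (cases "lab x i = l") (simp_all add: lab3_def tau_simps EE3)

lemma lab3_t: "lab3 t s = r" "lab3 t (nx s) = l" "lab3 t (nx (nx s)) = l"
  by (simp_all add: lab3_def lr tau_simps)

text \<open>The self-folded triangle contributes 0 under both labellings, and elsewhere only the
  loop is visible, with unchanged exponents.\<close>

lemma cmat3: "cmat F lab3 = cmat F lab"
proof (intro ext)
  fix i j
  have "(\<Sum>q<3. wedge (EE F lab3 (lab3 x (nx q))) (EE F lab3 (lab3 x q)) i j) =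
      (\<Sum>q<3. wedge (EE F lab (lab x (nx q))) (EE F lab (lab x q)) i j)" if "x < F" for x
  proof (cases "x = t")
    case True
    show ?thesis
      unfolding True
      by (subst (1 2) sum_less3 [of s], simp, simp)
        (simp add: lab3_t lr wedge_swap [of "EE F lab3 l" "EE F lab3 r"] wedge_swap [of "EE F lab l"])
  next
    case False
    then show ?thesis using that EE3_lab by (intro sum.cong) auto
  qed
  then show "cmat F lab3 i j = cmat F lab i j" by (simp add: cmat_def)
qed

lemma lam_pos: "x < F \<Longrightarrow> i < 3 \<Longrightarrow> posr (lam (lab x i))" "posr (lam l)" "posr (lam r)"
  using geomD(3) [OF geom] surf_lab [OF surf] lr_less by auto

lemma lam_nz: "lam l \<noteq> 0" "lam r \<noteq> 0" using lam_pos posr_neq_0 by auto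

lemma lam3_simps: "lam3 r = lam l" "lam3 l = lam l / lam r" "e \<noteq> l \<Longrightarrow> e \<noteq> r \<Longrightarrow> lam3 e = lam e"
  by (auto simp: lam3_def)

lemma lam3_lab: "x < F \<Longrightarrow> i < 3 \<Longrightarrow> x \<noteq> t \<Longrightarrow> lam3 (lab3 x i) = lam (lab x i)"
  using lab_neq_r [of x i] by (cases "lab x i = l") (simp_all add: lab3_def tau_simps lam3_simps)

lemma v_less: "v < n" using combD(3) [OF comb] by simp

lemma pun_t: "pun t s \<noteq> v" "pun t (nx s) \<noteq> v"
  using cusp_unique [of t s] cusp_unique [of t "nx s"] by auto

lemma pun_other: "x < F \<Longrightarrow> i < 3 \<Longrightarrow> x \<noteq> t \<Longrightarrow> pun x i \<noteq> v"
  using cusp_unique by blast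

lemma horo_split: "horo F lab' pun lam' i =
  (\<Sum>q<3. if pun t q = i then lam' (lab' t (nx q)) / (lam' (lab' t q) * lam' (lab' t (nx (nx q)))) else 0) +
  (\<Sum>x\<in>{..<F} - {t}. \<Sum>q<3. if pun x q = i then lam' (lab' x (nx q)) / (lam' (lab' x q) * lam' (lab' x (nx (nx q)))) else 0)"
  unfolding horo_def by (rule sum.remove) auto

lemma kap_v: "kap v = lam l / (lam r * lam r)"
proof -
  have "kap v = horo F lab pun lam v" using geomD(7) [OF geom v_less] by simp
  also have "\<dots> = lam l / (lam r * lam r)"
    unfolding horo_split
    by (subst sum_less3 [of s], simp) (use pun_t pun_other lr in \<open>simp\<close>)
  finally show ?thesis .
qed

lemma dt3:
  assumes "x < F" "i < 3"
  shows "dt (w3 x i) (w3 x (nx i)) = lam3 (lab3 x i)"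
proof (cases "x = t")
  case True
  have "dt (w t s) (w t (nx s)) = lam l" "dt (w t (nx s)) (w t (nx (nx s))) = lam r"
    "dt (w t (nx (nx s))) (w t s) = lam r"
    using geomD(2) [OF geom, of t s] geomD(2) [OF geom, of t "nx s"] geomD(2) [OF geom, of t "nx (nx s)"] lr by auto
  then show ?thesis
    using less3_cases [OF tF(2) assms(2)] True pun_t
    by (auto simp: w3_def sc_def lab3_t lam3_simps dt_sv_left dt_sv_right kap_v lam_nz)
next
  case False
  then show ?thesis
    using geomD(2) [OF geom assms] lam3_lab [OF assms False] pun_other [OF assms(1)] assms
    by (simp add: w3_def sc_def)
qed

lemma hop3:
  assumes "hop F lab w x i y j A"
  shows "hop F lab3 w3 x i y j A"
proof -
  have g: "gl F lab x i y j" using assms by (simp add: hop_def)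
  show ?thesis
    using assms combD(2) [OF comb g] combD(2) [OF comb gl_sym [OF g]]
    by (simp add: hop_def gl3 w3_def mv_sv)
qed

lemma gp3: "gp F lab w x A y \<Longrightarrow> gp F lab3 w3 x A y"
  by (induction rule: gp.induct) (auto intro: gp.intros hop3)

lemma horo3:
  assumes "i < n"
  shows "horo F lab3 pun lam3 i = kap3 i"
proof -
  let ?q = "\<lambda>lab lam x q. if pun x q = i then lam (lab x (nx q)) / (lam (lab x q) * lam (lab x (nx (nx q)))) else (0::ratfun)"
  have rest: "(\<Sum>x\<in>{..<F} - {t}. \<Sum>q<3. ?q lab3 lam3 x q) = (\<Sum>x\<in>{..<F} - {t}. \<Sum>q<3. ?q lab lam x q)"
    by (intro sum.cong refl) (auto simp: lam3_lab)
  show ?thesis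
  proof (cases "i = v")
    case True
    have "horo F lab3 pun lam3 v = lam l / ((lam l / lam r) * (lam l / lam r))"
      unfolding horo_split
      by (subst sum_less3 [of s], simp) (use pun_t pun_other in \<open>simp add: lab3_t lam3_simps\<close>)
    also have "\<dots> = 1 / kap v" using lam_nz by (simp add: kap_v field_simps)
    finally show ?thesis by (simp add: True kap3_def)
  next
    case False
    have "(\<Sum>q<3. ?q lab3 lam3 t q) = (\<Sum>q<3. ?q lab lam t q)"
      by (subst (1 2) sum_less3 [of s], simp, simp)
        (use False lam_nz in \<open>simp add: lab3_t lam3_simps lr\<close>)
    then have "horo F lab3 pun lam3 i = horo F lab pun lam i"
      unfolding horo_split rest by simp
    then show ?thesis using geomD(7) [OF geom assms] False by (simp add: kap3_def)
  qed
qed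

lemma comb3: "comb F m n lab3 pun"
  using comb unfolding comb_def gl3 using surf3 by (elim conjE) (intro conjI)

lemma tagged3: "tagged uu3 kap3"
  unfolding tagged_def
proof (intro allI impI)
  fix i assume "i < n"
  then have "(uu i = u i \<and> kap i = c i) \<or> (uu i = sv (c i) (u i) \<and> kap i = 1 / c i)" "c i \<noteq> 0"
    using geomD(6) [OF geom] posr_neq_0 [OF c_pos] by (auto simp: tagged_def)
  then show "(uu3 i = u i \<and> kap3 i = c i) \<or> (uu3 i = sv (c i) (u i) \<and> kap3 i = 1 / c i)"
    by (cases "i = v") (auto simp: uu3_def kap3_def sc_def sv_sv)
qed

lemma geom3: "geom F m lab3 pun w3 lam3 uu3 kap3"
proof -
  have "posr (lam3 e)" if "e < m" for e
    using geomD(3) [OF geom that] lam_pos(2,3) by (auto simp: lam3_def intro: posr_divide)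
  moreover have "\<exists>A\<in>G. hop F lab3 w3 x i y j A" if "gl F lab3 x i y j" for x i y j
    using geomD(4) [OF geom] that hop3 gl3 by blast
  moreover have "\<exists>A\<in>G. w3 x i = mv A (uu3 (pun x i))" if x: "x < F" "i < 3" for x i
    using geomD(8) [OF geom x] by (auto simp: w3_def uu3_def mv_sv)
  ultimately show ?thesis
    unfolding geom_def using comb3 dt3 geomD(5) [OF geom] gp3 tagged3 horo3 by simp
qed

lemma prod_delta: "k < m \<Longrightarrow> (\<Prod>j<m. z j ^ (if j = k then 1 else 0)) = (z k :: ratfun)"
proof -
  assume "k < m"
  moreover have "(\<Prod>j<m. z j ^ (if j = k then 1 else 0)) = (\<Prod>j<m. if j = k then z j else 1)"
    by (rule prod.cong) auto
  ultimately show ?thesis by simp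
qed

lemma seedrel3:
  assumes "seedrel F m lab lam S"
  shows "seedrel F m lab3 lam3 S"
proof -
  have y: "\<And>e. e < m \<Longrightarrow> lam e = (\<Prod>j<m. fst S j ^ EE F lab e j)"
    using assms by (auto simp: seedrel_def)
  have r: "lam r = fst S r"
    using y [OF lr_less(2)] prod_delta [OF lr_less(2)] by (simp add: EE3)
  have l: "lam l = fst S l * fst S r"
    using y [OF lr_less(1)] prod_delta [OF lr_less(1)] prod_delta [OF lr_less(2)]
    by (simp add: EE3 power_add prod.distrib)
  have "lam3 e = (\<Prod>j<m. fst S j ^ EE F lab3 e j)" if "e < m" for e
  proof -
    consider "e = l" | "e = r" | "e \<noteq> l" "e \<noteq> r" by blast
    then show ?thesis
    proof cases
      case 1
      then show ?thesis using l r lam_nz prod_delta [OF lr_less(1)] by (simp add: EE3 lam3_simps)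
    next
      case 2
      then show ?thesis using y [OF lr_less(1)] by (simp add: EE3 lam3_simps)
    next
      case 3
      then show ?thesis using y [OF that] by (simp add: EE3 lam3_simps)
    qed
  qed
  then show ?thesis using assms by (auto simp: seedrel_def cmat3)
qed

lemma nonradius3: "\<not> sf F lab3 e r"
  by (simp add: sf3 tau_simps not_sf_l)

end

lemma nonradius_sides:
  assumes "surf F m lab" "k < m" "\<And>e. \<not> sf F lab e k"
  obtains t s t' s' where "quad F m lab t s t' s' k"
proof -
  obtain t s t' s' where g: "gl F lab t s t' s'" "lab t s = k" "lab t' s' = k"
    using surf_sides [OF assms(1,2)] by metis
  have "t \<noteq> t'"
  proof
    assume "t = t'"
    then have "s' = nx s \<or> s' = nx (nx s)" "t < F" "s < 3" using g less3_cases [of s s'] by (auto simp: gl_def)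
    then have "sf F lab (lab t (nx (nx s))) k \<or> sf F lab (lab t (nx s)) k"
      unfolding sf_def using g \<open>t = t'\<close> by (metis nx_simps(1,6))
    then show False using assms(3) by blast
  qed
  then have "quad F m lab t s t' s' k" using g assms(1) by (auto simp: quad_def gl_def)
  then show ?thesis using that by blast
qed

section \<open>Closure under mutation; cluster variables as skein elements\<close>

context holonomy
begin

definition good where
  "good F m S \<longleftrightarrow> (\<exists>lab pun w lam uu kap. geom F m lab pun w lam uu kap \<and> seedrel F m lab lam S)"

lemma good_flip:
  assumes "geom F m lab pun w lam uu kap" "seedrel F m lab lam S" "k < m" "\<And>e. \<not> sf F lab e k"
  shows "good F m (mutate m k S)"
proof -
  obtain t s t' s' where q: "quad F m lab t s t' s' k"
    using nonradius_sides [OF combD(1) [OF geomD(1) [OF assms(1)]] assms(3,4)] by blast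
  then have "gl F lab t s t' s'" by (auto simp: quad_def gl_def)
  then obtain M where "M \<in> G" "hop F lab w t s t' s' M" using geomD(4) [OF assms(1)] by blast
  then interpret geoflip F m lab t s t' s' k G n u c pun w lam uu kap M
    using q assms by (simp add: geoflip_def flip_def flip_axioms_def geoflip_axioms_def holonomy_axioms)
  show ?thesis unfolding good_def using geom2 seedrel2 [OF assms(2)] by blast
qed

text \<open>A radius cannot be flipped, so the tags at its puncture are switched first; the same
  seed then has \<open>k\<close> on a loop.\<close>

lemma good_mutate:
  assumes "good F m S" "k < m"
  shows "good F m (mutate m k S)"
proof -
  obtain lab pun w lam uu kap where g: "geom F m lab pun w lam uu kap" "seedrel F m lab lam S"
    using assms(1) by (auto simp: good_def)
  show ?thesis
  proof (cases "\<exists>e. sf F lab e k")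
    case True
    then obtain e t s where e: "t < F" "s < 3" "lab t s = e" "lab t (nx s) = k" "lab t (nx (nx s)) = k"
      by (auto simp: sf_def)
    then interpret geoswap G n u c F m lab pun w lam uu kap t s e k
      using g by (simp add: geoswap_def geoswap_axioms_def holonomy_axioms)
    show ?thesis using good_flip [OF geom3 seedrel3 [OF g(2)] assms(2)] nonradius3 by blast
  next
    case False
    then show ?thesis using good_flip [OF g assms(2)] by blast
  qed
qed

lemma good_seeds: "S \<in> seeds m B \<Longrightarrow> good F m (var, B) \<Longrightarrow> good F m S"
  by (induction rule: seeds.induct) (auto intro: good_mutate)

definition punc :: "(ratfun \<times> ratfun) set" where
  "punc = u ` {..<n} \<union> (\<lambda>i. sv (c i) (u i)) ` {..<n}"

definition skein :: "ratfun set" where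
  "skein = subring_gen (inv_gens G punc)"

lemma uu_punc: "tagged uu kap \<Longrightarrow> i < n \<Longrightarrow> uu i \<in> punc"
  by (force simp: tagged_def punc_def)

lemma punc_cases:
  assumes "tagged uu kap" "a \<in> punc"
  obtains i where "i < n" "a = uu i" | i where "i < n" "a = sv (kap i) (uu i)"
proof -
  obtain i where i: "i < n" "a = u i \<or> a = sv (c i) (u i)" using assms(2) by (auto simp: punc_def)
  have "c i \<noteq> 0" using posr_neq_0 [OF c_pos [OF i(1)]] .
  then have "a = uu i \<or> a = sv (kap i) (uu i)"
    using i assms(1) by (auto simp: tagged_def sv_sv)
  then show ?thesis using that i by blast
qed

lemma arc_in_skein:
  assumes "geom F m lab pun w lam uu kap" "seedrel F m lab lam S" "e < m" "\<And>j. \<not> sf F lab e j"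
  shows "\<exists>A a b. A \<in> G \<and> a \<in> punc \<and> b \<in> punc \<and> fst S e = dt (mv A a) b"
proof -
  note surf = combD(1) [OF geomD(1) [OF assms(1)]]
  obtain t s where t: "t < F" "s < 3" "lab t s = e"
    using surf_sides [OF surf assms(3)] by (metis gl_def)
  have "lam e = (\<Prod>j<m. fst S j ^ (if j = e then 1 else 0))"
    using assms(2-4) by (simp add: seedrel_def EE_def)
  also have "\<dots> = (\<Prod>j<m. if j = e then fst S j else 1)" by (rule prod.cong) auto
  also have "\<dots> = fst S e" using assms(3) by simp
  finally have e: "dt (w t s) (w t (nx s)) = fst S e" using geomD(2) [OF assms(1) t(1,2)] t(3) by simp
  obtain A where A: "A \<in> G" "w t s = mv A (uu (pun t s))" using geomD(8) [OF assms(1) t(1,2)] by blast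
  obtain B where B: "B \<in> G" "w t (nx s) = mv B (uu (pun t (nx s)))"
    using geomD(8) [OF assms(1) t(1), of "nx s"] t by auto
  have "fst S e = dt (mv (adj B * A) (uu (pun t s))) (uu (pun t (nx s)))"
    using e A B by (simp add: mv_mult dt_adj [of "adj B"])
  moreover have "uu (pun t s) \<in> punc" "uu (pun t (nx s)) \<in> punc"
    using uu_punc [OF geomD(6) [OF assms(1)]] combD(3) [OF geomD(1) [OF assms(1)]] t by auto
  ultimately show ?thesis using A B G_mult G_adj by blast
qed

text \<open>The variable on a loop around a radius is the doubly tagged radius. After the tag switch
  it labels an ordinary arc, to which \<open>arc_in_skein\<close> applies.\<close>

lemma good_arc:
  assumes "good F m S" "e < m"
  shows "\<exists>A a b. A \<in> G \<and> a \<in> punc \<and> b \<in> punc \<and> fst S e = dt (mv A a) b"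
proof -
  obtain lab pun w lam uu kap where g: "geom F m lab pun w lam uu kap" "seedrel F m lab lam S"
    using assms(1) by (auto simp: good_def)
  show ?thesis
  proof (cases "\<exists>j. sf F lab e j")
    case True
    then obtain j t s where e: "t < F" "s < 3" "lab t s = e" "lab t (nx s) = j" "lab t (nx (nx s)) = j"
      by (auto simp: sf_def)
    then interpret geoswap G n u c F m lab pun w lam uu kap t s e j
      using g by (simp add: geoswap_def geoswap_axioms_def holonomy_axioms)
    show ?thesis using arc_in_skein [OF geom3 seedrel3 [OF g(2)] assms(2)] by (simp add: sf3 tau_simps not_sf_r)
  next
    case False
    then show ?thesis using arc_in_skein [OF g assms(2)] by blast
  qed
qed

lemma cluster_algebra_subset_skein:
  assumes "good F m (var, B)"
  shows "cluster_algebra m B \<subseteq> skein"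
  unfolding cluster_algebra_def skein_def
proof (rule subring_gen_mono, rule subsetI)
  fix x assume "x \<in> {fst S i | S i. S \<in> seeds m B \<and> i < m}"
  then obtain S i where "x = fst S i" "S \<in> seeds m B" "i < m" by auto
  then obtain A a b where "A \<in> G" "a \<in> punc" "b \<in> punc" "x = dt (mv A a) b"
    using good_arc [OF good_seeds [OF _ assms]] by blast
  then have "x \<in> inv_gens G punc" unfolding inv_gens_def by blast
  then show "x \<in> subring_gen (inv_gens G punc)" by (rule subring_gen.gen)
qed

end

section \<open>Laurent integrality\<close>

text \<open>Membership in the lattice spanned over \<open>L\<close> by the corner vectors of
  \<open>t\<close>, phrased dually; the two notions agree once the lambda lengths are units of
  \<open>L\<close>.\<close>

definition integral_at :: "(nat \<Rightarrow> nat \<Rightarrow> 'a \<times> 'a) \<Rightarrow> 'a::field set \<Rightarrow> nat \<Rightarrow> 'a \<times> 'a \<Rightarrow> bool" where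
  "integral_at w L t x \<longleftrightarrow> (\<forall>s<3. dt x (w t s) \<in> L)"

locale integrality =
  fixes F m lab and w :: "nat \<Rightarrow> nat \<Rightarrow> 'a::field \<times> 'a" and lam and L :: "'a set"
  assumes L: "is_subring L" and surf: "surf F m lab"
    and dt_lam: "\<And>t s. t < F \<Longrightarrow> s < 3 \<Longrightarrow> dt (w t s) (w t (nx s)) = lam (lab t s)"
    and lam_L: "\<And>e. e < m \<Longrightarrow> lam e \<in> L" "\<And>e. e < m \<Longrightarrow> inverse (lam e) \<in> L" "\<And>e. e < m \<Longrightarrow> lam e \<noteq> 0"
begin

text \<open>The Pluecker relation solved for one pairing, inverting nothing but a lambda length.
  This formula and the next two are used again in the specialisation, where they carry values from
  one field to the other.\<close>

lemma third:
  assumes "t < F" "s < 3"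
  shows "dt x (w t (nx (nx s))) =
    - (lam (lab t (nx s)) * dt x (w t s) + lam (lab t (nx (nx s))) * dt x (w t (nx s))) * inverse (lam (lab t s))"
proof -
  have d: "dt (w t (nx s)) (w t (nx (nx s))) = lam (lab t (nx s))" "dt (w t (nx (nx s))) (w t s) = lam (lab t (nx (nx s)))"
    "dt (w t s) (w t (nx s)) = lam (lab t s)" "lam (lab t s) \<noteq> 0"
    using dt_lam [of t "nx s"] dt_lam [of t "nx (nx s)"] dt_lam [of t s] assms lam_L(3) surf_lab [OF surf] by auto
  have "dt x (w t s) * dt (w t (nx s)) (w t (nx (nx s))) + dt x (w t (nx s)) * dt (w t (nx (nx s))) (w t s)
      + dt x (w t (nx (nx s))) * dt (w t s) (w t (nx s)) = 0" by (rule dt_plucker)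
  then have "dt x (w t (nx (nx s))) * lam (lab t s) =
      - (lam (lab t (nx s)) * dt x (w t s) + lam (lab t (nx (nx s))) * dt x (w t (nx s)))"
    unfolding d by (simp add: algebra_simps eq_neg_iff_add_eq_0)
  then show ?thesis using d(4) by (simp add: field_simps)
qed

lemma integral_atI:
  assumes "t < F" "s < 3" "dt x (w t s) \<in> L" "dt x (w t (nx s)) \<in> L"
  shows "integral_at w L t x"
proof -
  have "dt x (w t (nx (nx s))) \<in> L"
    unfolding third [OF assms(1,2)]
    using assms lam_L surf_lab [OF surf] by (auto intro!: is_subringD [OF L])
  then show ?thesis using assms less3_cases [OF assms(2)] by (auto simp: integral_at_def)
qed

lemma dt_formula:
  assumes "t < F"
  shows "dt x y = (dt x (w t 0) * dt y (w t 1) - dt x (w t 1) * dt y (w t 0)) * inverse (lam (lab t 0))"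
proof -
  have n: "nx 0 = 1" by (simp add: nx_values)
  have d: "dt (w t 0) (w t 1) = lam (lab t 0)" "lam (lab t 0) \<noteq> 0"
    using dt_lam [of t 0] assms lam_L surf_lab [OF surf] by (auto simp: n)
  have "dt x y * dt (w t 0) (w t 1) = dt x (w t 0) * dt y (w t 1) - dt x (w t 1) * dt y (w t 0)"
    using dt_plucker [of x y "w t 0" "w t 1"] dt_swap [of "w t 1" y] by (simp add: algebra_simps)
  then show ?thesis
    using d by (simp add: field_simps)
qed

lemma tr_formula:
  assumes "t < F"
  shows "tr A = (dt (mv A (w t 0)) (w t 1) + dt (w t 0) (mv A (w t 1))) * inverse (lam (lab t 0))"
proof -
  have n: "nx 0 = 1" by (simp add: nx_values)
  have d: "dt (w t 0) (w t 1) = lam (lab t 0)" "lam (lab t 0) \<noteq> 0"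
    using dt_lam [of t 0] assms lam_L surf_lab [OF surf] by (auto simp: n)
  have "tr A * lam (lab t 0) = dt (mv A (w t 0)) (w t 1) + dt (w t 0) (mv A (w t 1))"
    using tr_dt [of A "w t 0" "w t 1"] unfolding d(1) .
  then show ?thesis
    using d by (simp add: field_simps)
qed

lemma dt_integral:
  assumes "t < F" "integral_at w L t x" "integral_at w L t y"
  shows "dt x y \<in> L"
  unfolding dt_formula [OF assms(1), of x y]
  using assms lam_L surf_lab [OF surf] by (auto simp: integral_at_def intro!: is_subringD [OF L])

lemma integral_corner:
  assumes "t < F" "s < 3"
  shows "integral_at w L t (w t s)"
  using assms dt_lam [OF assms] lam_L surf_lab [OF surf] dt_swap [of "w t s"]
  by (intro integral_atI [of t s]) (auto simp: is_subringD [OF L])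

text \<open>Adjacent triangles share two corner vectors, and pairings with two corners determine
  integrality; so both triangles define the same lattice.\<close>

lemma integral_hop:
  assumes "hop F lab w t s t' s' A" "integral_at w L t' x"
  shows "integral_at w L t (mv A x)"
proof (rule integral_atI [of t s])
  have h: "mv A (w t' (nx s')) = w t s" "- mv A (w t' s') = w t (nx s)" "det2 A = 1"
    and b: "t < F" "s < 3" "t' < F" "s' < 3"
    using assms(1) by (auto simp: hop_def gl_def)
  show "t < F" "s < 3" using b by auto
  show "dt (mv A x) (w t s) \<in> L" "dt (mv A x) (w t (nx s)) \<in> L"
    unfolding h(1,2) [symmetric] using assms(2) b h(3)
    by (auto simp: dt_mv integral_at_def intro!: is_subringD [OF L])
qed

lemma integral_gp: "gp F lab w t A t' \<Longrightarrow> integral_at w L t' x \<Longrightarrow> integral_at w L t (mv A x)"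
proof (induction arbitrary: x rule: gp.induct)
  case (step t A t' s t'' s'' B)
  show ?case unfolding mv_mult by (rule step.IH, rule integral_hop) (fact step)+
qed simp

lemma tr_integral:
  assumes "gp F lab w t A t"
  shows "tr A \<in> L"
proof -
  have t: "t < F" using gp_less [OF assms] by simp
  have "dt (mv A (w t 0)) (w t 1) \<in> L" "dt (w t 0) (mv A (w t 1)) \<in> L"
    by (rule dt_integral [OF t integral_gp [OF assms integral_corner] integral_corner]; simp add: t)
      (rule dt_integral [OF t integral_corner integral_gp [OF assms integral_corner]]; simp add: t)
  then show ?thesis
    unfolding tr_formula [OF t] using t lam_L surf_lab [OF surf] by (auto intro!: is_subringD [OF L])
qed

end

lemma is_subring_laurent_ring [simp]: "is_subring (laurent_ring m y)"
  by (simp add: laurent_ring_def)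

lemma laurent_ring_gens:
  "i < m \<Longrightarrow> y i \<in> laurent_ring m y" "i < m \<Longrightarrow> inverse (y i) \<in> laurent_ring m y"
  by (auto simp: laurent_ring_def intro!: subring_gen.gen)

context holonomy
begin

lemma geom_integrality:
  assumes "geom F m lab pun w lam uu kap" "seedrel F m lab lam S"
  shows "integrality F m lab w lam (laurent_ring m (fst S))"
proof
  show "surf F m lab" using combD(1) [OF geomD(1) [OF assms(1)]] .
  have e: "lam e = (\<Prod>j<m. fst S j ^ EE F lab e j)" if "e < m" for e
    using assms(2) that by (simp add: seedrel_def)
  show "lam e \<in> laurent_ring m (fst S)" if "e < m" for e
    unfolding e [OF that] by (intro is_subring_prod is_subring_power) (auto simp: laurent_ring_gens)
  show "inverse (lam e) \<in> laurent_ring m (fst S)" if "e < m" for e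
    unfolding e [OF that] prod_inversef [symmetric] comp_def power_inverse [symmetric]
    by (intro is_subring_prod is_subring_power) (auto simp: laurent_ring_gens)
  show "lam e \<noteq> 0" if "e < m" for e using geomD(3) [OF assms(1) that] posr_neq_0 by blast
qed (use geomD(2) [OF assms(1)] in auto)

lemma kap_integral:
  assumes "geom F m lab pun w lam uu kap" "seedrel F m lab lam S" "i < n"
  shows "kap i \<in> laurent_ring m (fst S)"
proof -
  interpret integrality F m lab w lam "laurent_ring m (fst S)" by (rule geom_integrality [OF assms(1,2)])
  have "kap i = horo F lab pun lam i" using geomD(7) [OF assms(1,3)] by simp
  also have "\<dots> \<in> laurent_ring m (fst S)"
    unfolding horo_def divide_inverse inverse_mult_distrib
    using lam_L surf_lab [OF surf] by (intro is_subring_sum L) (auto intro!: is_subringD [OF L])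
  finally show ?thesis .
qed

lemma uu_gp:
  assumes "geom F m lab pun w lam uu kap" "i < n" "t0 < F"
  obtains A t s where "A \<in> G" "gp F lab w t0 A t" "t < F" "s < 3" "pun t s = i" "uu i = mv A (w t s)"
proof -
  obtain t s where t: "t < F" "s < 3" "pun t s = i" using combD(4) [OF geomD(1) [OF assms(1)] assms(2)] by blast
  obtain A where A: "A \<in> G" "w t s = mv A (uu i)" using geomD(8) [OF assms(1) t(1,2)] t by auto
  have "uu i = mv (adj A) (w t s)" using A G_det by simp
  then show ?thesis using that [OF G_adj [OF A(1)] geomD(5) [OF assms(1) G_adj [OF A(1)] assms(3) t(1)] t] by simp
qed

lemma F_pos:
  assumes "geom F m lab pun w lam uu kap" shows "0 < F"
  using combD(4,5) [OF geomD(1) [OF assms]] by (metis gr_zeroI less_one not_less_zero not_numeral_le_zero)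

lemma good_laurent:
  assumes "good F m S"
  shows "skein \<subseteq> laurent_ring m (fst S)"
proof -
  obtain lab pun w lam uu kap where g: "geom F m lab pun w lam uu kap" "seedrel F m lab lam S"
    using assms by (auto simp: good_def)
  let ?L = "laurent_ring m (fst S)"
  interpret integrality F m lab w lam ?L by (rule geom_integrality [OF g])
  note F0 = F_pos [OF g(1)]
  have uu: "integral_at w ?L 0 (uu i)" if i: "i < n" for i
  proof -
    obtain A t s where "gp F lab w 0 A t" "t < F" "s < 3" "uu i = mv A (w t s)"
      using uu_gp [OF g(1) i F0] by metis
    then show ?thesis using integral_gp integral_corner by metis
  qed
  have p: "integral_at w ?L 0 a" if a: "a \<in> punc" for a
  proof (rule punc_cases [OF geomD(6) [OF g(1)] a])
    fix i assume i: "i < n" "a = sv (kap i) (uu i)"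
    then show "integral_at w ?L 0 a"
      using uu [OF i(1)] kap_integral [OF g i(1)] by (auto simp: integral_at_def dt_sv_left intro!: is_subringD [OF L])
  qed (use uu in auto)
  have gp: "gp F lab w 0 A 0" if "A \<in> G" for A using geomD(5) [OF g(1) that F0 F0] .
  have "inv_gens G punc \<subseteq> ?L"
  proof
    fix x assume "x \<in> inv_gens G punc"
    then consider A where "A \<in> G" "x = tr A"
      | A a b where "A \<in> G" "a \<in> punc" "b \<in> punc" "x = dt (mv A a) b"
      by (auto simp: inv_gens_def)
    then show "x \<in> ?L"
    proof cases
      case 1
      then show ?thesis using tr_integral [OF gp] by simp
    next
      case 2
      then show ?thesis using dt_integral [OF F0 integral_gp [OF gp p] p] by simp
    qed
  qed
  then show ?thesis unfolding skein_def by (intro subring_gen_least) auto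
qed

lemma skein_subset_upper:
  assumes "good F m (var, B)"
  shows "skein \<subseteq> upper_cluster_algebra m B"
  unfolding upper_cluster_algebra_def
  by (rule INT_greatest, rule good_laurent, rule good_seeds [OF _ assms])

end

section \<open>The holonomy of the initial triangulation\<close>

lemma hop_unique:
  assumes "hop F lab w t s t' s' A" "hop F lab w t s t' s' B" "dt (w t' s') (w t' (nx s')) \<noteq> 0"
  shows "A = B"
  using assms mat2_eqI [of "w t' s'" "w t' (nx s')" A B] by (simp add: hop_def)

lemma gp_det: "gp F lab w t A t' \<Longrightarrow> det2 A = 1"
  by (induction rule: gp.induct) (auto simp: hop_def det2_mult)

lemma posr_sum':
  assumes "finite I" "\<And>i. i \<in> I \<Longrightarrow> f i = 0 \<or> posr (f i)" "j \<in> I" "posr (f j)"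
  shows "posr (sum f I)"
proof -
  have "sum f I = 0 \<or> posr (sum f I)" if "finite I" "\<And>i. i \<in> I \<Longrightarrow> f i = 0 \<or> posr (f i)" for I
    using that
  proof (induction I rule: finite_induct)
    case (insert x I)
    then have "f x = 0 \<or> posr (f x)" "sum f I = 0 \<or> posr (sum f I)" by blast+
    then show ?case using insert.hyps posr_add by auto
  qed simp
  from this [of "I - {j}"] show ?thesis
    using assms by (auto simp: sum.remove posr_add)
qed

locale triangulation =
  fixes g n F m :: nat and lab :: "nat \<Rightarrow> nat \<Rightarrow> nat"
  assumes tri: "is_triangulation g n F m lab" and n: "n \<ge> 1" "(g, n) \<noteq> (0, 3)"
begin

lemma surf: "surf F m lab"
  using tri by (simp add: is_triangulation_def surf_def)

lemma distinct_labels: "t < F \<Longrightarrow> s < 3 \<Longrightarrow> lab t s \<noteq> lab t (nx s)"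
proof -
  assume "t < F" "s < 3"
  then have "lab t 0 \<noteq> lab t 1 \<and> lab t 1 \<noteq> lab t 2 \<and> lab t 0 \<noteq> lab t 2" "s = 0 \<or> s = 1 \<or> s = 2"
    using tri by (auto simp: is_triangulation_def)
  then show ?thesis by (auto simp: nx_values)
qed

lemma no_sf: "\<not> sf F lab e j"
proof
  assume "sf F lab e j"
  then obtain t s where "t < F" "s < 3" "lab t (nx s) = j" "lab t (nx (nx s)) = j" by (auto simp: sf_def)
  then show False using distinct_labels [of t "nx s"] by simp
qed

lemma EE_init: "EE F lab e j = (if j = e then 1 else 0)"
  by (simp add: EE_def no_sf)

lemma exch_matrix_cmat: "exch_matrix F lab = cmat F lab"
proof -
  have "wedge (EE F lab a) (EE F lab b) i j =
      (if a = i \<and> b = j then 1 else 0) - (if b = i \<and> a = j then 1 else 0)" for a b i j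
    unfolding wedge_def EE_init
    by (cases "i = a"; cases "j = b"; cases "i = b"; cases "j = a"; simp only: simp_thms if_True if_False if_cancel)
      auto
  then show ?thesis unfolding exch_matrix_def cmat_def nx_def fun_eq_iff by (simp only: simp_thms)
qed

definition crel where "crel = (corner_rel F lab \<union> (corner_rel F lab)\<inverse>)\<^sup>*"

lemma equiv_crel: "equiv UNIV crel"
  unfolding crel_def
  by (rule equivI) (simp_all add: refl_rtrancl trans_rtrancl sym_rtrancl sym_Un_converse)

lemma finite_sides: "finite (sides F)"
  unfolding sides_def by (rule finite_subset [of _ "{..<F} \<times> {..<3}"]) auto

lemma card_classes: "card (sides F // crel) = n"
  using tri by (simp add: is_triangulation_def num_vertices_def crel_def)

definition classnum where
  "classnum = (SOME h. bij_betw h (sides F // crel) {0..<n})"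

lemma classnum: "bij_betw classnum (sides F // crel) {0..<n}"
proof -
  have "finite (sides F // crel)"
    using finite_sides by (simp add: quotient_def)
  then obtain h where "bij_betw h (sides F // crel) {0..<n}"
    using ex_bij_betw_finite_nat card_classes by blast
  then show ?thesis unfolding classnum_def by (rule someI [where P = "\<lambda>h. bij_betw h (sides F // crel) {0..<n}"])
qed

definition pun where "pun t s = classnum (crel `` {(t, s)})"

lemma class_in: "t < F \<Longrightarrow> s < 3 \<Longrightarrow> crel `` {(t, s)} \<in> sides F // crel"
  by (rule quotientI) (simp add: sides_def)

lemma gl_crel: "gl F lab t s t' s' \<Longrightarrow> ((t, s), (t', nx s')) \<in> corner_rel F lab"
  by (auto simp: corner_rel_def gl_def sides_def nx_def)

lemma pun_compat: "gl F lab t s t' s' \<Longrightarrow> pun t s = pun t' (nx s')"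
proof -
  assume "gl F lab t s t' s'"
  then have "((t, s), (t', nx s')) \<in> crel"
    using gl_crel unfolding crel_def by blast
  then have "crel `` {(t, s)} = crel `` {(t', nx s')}"
    by (rule equiv_class_eq [OF equiv_crel])
  then show ?thesis by (simp add: pun_def)
qed

lemma pun_less: "t < F \<Longrightarrow> s < 3 \<Longrightarrow> pun t s < n"
  using bij_betwE [OF classnum] class_in by (auto simp: pun_def)

lemma pun_onto: "i < n \<Longrightarrow> \<exists>t<F. \<exists>s<3. pun t s = i"
proof -
  assume "i < n"
  then have "i \<in> classnum ` (sides F // crel)" using classnum by (simp add: bij_betw_def)
  then show ?thesis by (auto simp: quotient_def sides_def pun_def)
qed

lemma pun_sep:
  fixes f :: "nat \<Rightarrow> nat \<Rightarrow> bool"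
  assumes f: "\<And>t s t' s'. gl F lab t s t' s' \<Longrightarrow> f t s = f t' (nx s')"
    and "t < F" "s < 3" "t' < F" "s' < 3" "pun t s = pun t' s'"
  shows "f t s = f t' s'"
proof -
  have "inj_on classnum (sides F // crel)" using classnum by (simp add: bij_betw_def)
  then have "crel `` {(t, s)} = crel `` {(t', s')}"
    using assms(2-) class_in by (auto simp: pun_def inj_on_def)
  then have "((t, s), (t', s')) \<in> crel" using eq_equiv_class [OF _ equiv_crel] by blast
  moreover have step: "f (fst p) (snd p) = f (fst q) (snd q)" if "(p, q) \<in> corner_rel F lab" for p q
  proof -
    have "\<exists>t s t' s'. p = (t, s) \<and> q = (t', nx s') \<and> gl F lab t s t' s'"
      using that by (simp add: corner_rel_def gl_def sides_def nx_def)
    then show ?thesis using f by auto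
  qed
  have "f (fst p) (snd p) = f (fst q) (snd q)" if "(p, q) \<in> crel" for p q
    using that unfolding crel_def by (induction rule: rtrancl_induct) (use step in blast)+
  ultimately show ?thesis by fastforce
qed

lemma card_sides: "3 * F = 2 * m"
proof -
  have "sides F = (\<Union>e\<in>{..<m}. {(t, s). t < F \<and> s < 3 \<and> lab t s = e})"
    using surf_lab [OF surf] by (auto simp: sides_def)
  then have "card (sides F) = (\<Sum>e<m. card {(t, s). t < F \<and> s < 3 \<and> lab t s = e})"
    using surf_finite by (simp only:) (rule card_UN_disjoint, auto)
  also have "\<dots> = 2 * m" using surf by (simp add: surf_def)
  finally have "card (sides F) = 2 * m" .
  moreover have "sides F = {..<F} \<times> {..<3}" by (auto simp: sides_def)
  ultimately show ?thesis by simp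
qed

text \<open>Euler's formula and \<open>3 * F = 2 * m\<close> give
  \<open>F = 2 * n + 4 * g - 4\<close>. At most two triangles leave only \<open>n = 1\<close> or the
  excluded pair \<open>(0, 3)\<close>.\<close>

lemma F_large: "n = 1 \<or> 3 \<le> F" and F_pos: "0 < F"
proof -
  have e: "int n - int m + int F = 2 - 2 * int g" using tri by (simp add: is_triangulation_def)
  show "0 < F"
  proof (rule ccontr)
    assume "\<not> 0 < F"
    then have "sides F = {}" by (simp add: sides_def)
    then show False using card_classes n by (simp add: quotient_def)
  qed
  then show "n = 1 \<or> 3 \<le> F"
    using card_sides n e by (cases "F \<le> 2"; cases "g = 0"; simp; presburger)
qed

lemma comb: "comb F m n lab pun"
  unfolding comb_def
  by (intro conjI allI impI surf F_large) (fact pun_compat pun_less pun_onto | (rule pun_sep, blast+))+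

section \<open>Developing the initial triangulation\<close>

definition w0 where
  "w0 t s = (if s = 0 then (1, 0) else if s = 1 then (0, var (lab t 0))
     else (- var (lab t 1) / var (lab t 0), - var (lab t 2)))"

lemma var_nz [simp]: "var i \<noteq> 0" using posr_neq_0 [OF posr_var] .

lemma w0_dt: "s < 3 \<Longrightarrow> dt (w0 t s) (w0 t (nx s)) = var (lab t s)"
proof -
  assume "s < 3"
  then have "s = 0 \<or> s = 1 \<or> s = 2" by auto
  then show ?thesis by (auto simp: w0_def nx_values)
qed

lemma hop0_ex: "gl F lab t s t' s' \<Longrightarrow> \<exists>A. hop F lab w0 t s t' s' A"
proof -
  assume g: "gl F lab t s t' s'"
  then have "dt (w0 t s) (- w0 t (nx s)) = dt (w0 t' (nx s')) (w0 t' s')" "dt (w0 t s) (- w0 t (nx s)) \<noteq> 0"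
    using w0_dt [of s t] w0_dt [of s' t'] dt_swap [of "w0 t' (nx s')"] by (auto simp: gl_def)
  then show ?thesis using ex_mat2_frame g unfolding hop_def by metis
qed

lemma path0_ex: "t < F \<Longrightarrow> \<exists>A. gp F lab w0 0 A t"
proof -
  assume "t < F"
  then have "(0, t) \<in> (tri_adj F lab)\<^sup>*" using tri F_pos by (simp add: is_triangulation_def)
  then show ?thesis
  proof (induction rule: rtrancl_induct)
    case base
    then show ?case using gp.base F_pos by blast
  next
    case (step y z)
    then obtain A where A: "gp F lab w0 0 A y" by blast
    obtain s s' where s: "y < F" "z < F" "s < 3" "s' < 3" "lab y s = lab z s'"
      using step(2) by (auto simp: tri_adj_def)
    show ?case
    proof (cases "(y, s) = (z, s')")
      case True
      then show ?thesis using A by auto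
    next
      case False
      then obtain B where "hop F lab w0 y s z s' B" using hop0_ex s unfolding gl_def by blast
      then show ?thesis using A gp.step by blast
    qed
  qed
qed

text \<open>All frames are developed to triangle 0 along these paths. The value 1 at triangle 0
  ensures that after development the identity connects any two triangles (\<open>gp_one\<close>), so
  every gluing matrix lies in one group.\<close>

definition path where "path t = (if t = 0 then 1 else SOME A. gp F lab w0 0 A t)"

lemma path: "t < F \<Longrightarrow> gp F lab w0 0 (path t) t"
  using someI_ex [OF path0_ex, of t] gp.base [OF F_pos, of lab w0] by (auto simp: path_def)

lemma path_det: "t < F \<Longrightarrow> det2 (path t) = 1"
  using gp_det path by blast

definition w where "w t s = mv (path t) (w0 t s)"

lemma w_dt: "t < F \<Longrightarrow> s < 3 \<Longrightarrow> dt (w t s) (w t (nx s)) = var (lab t s)"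
  by (simp add: w_def dt_mv path_det w0_dt)

lemma hop_conj: "hop F lab w0 x i y j A \<Longrightarrow> hop F lab w x i y j (path x * A * adj (path y))"
  by (auto simp: hop_def gl_def w_def mv_mult det2_mult path_det)

lemma gp_conj: "gp F lab w0 x A y \<Longrightarrow> gp F lab w x (path x * A * adj (path y)) y"
proof (induction rule: gp.induct)
  case (base t)
  then show ?case using adj_right [OF path_det] gp.base by simp
next
  case (step t A t' s t'' s'' B)
  have "t' < F" using gp_less [OF step(1)] by simp
  then have "path t * A * adj (path t') * (path t' * B * adj (path t'')) = path t * A * (adj (path t') * path t') * B * adj (path t'')"
    by (simp only: mult.assoc)
  also have "\<dots> = path t * (A * B) * adj (path t'')"
    using adj_left [OF path_det [OF \<open>t' < F\<close>]] by (simp add: mult.assoc)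
  finally show ?case using gp.step [OF step.IH hop_conj [OF step(2)]] by simp
qed

definition hopset where "hopset = {A. \<exists>t s t' s'. hop F lab w t s t' s' A}"

lemma hop_ex: "gl F lab t s t' s' \<Longrightarrow> \<exists>A\<in>hopset. hop F lab w t s t' s' A"
  using hop0_ex hop_conj unfolding hopset_def by blast

lemma hopset_det: "A \<in> hopset \<Longrightarrow> det2 A = 1"
  by (auto simp: hopset_def hop_def)

lemma finite_hopset: "finite hopset"
proof -
  have "hopset \<subseteq> (\<lambda>(t, s, t', s'). THE A. hop F lab w t s t' s' A) ` ({..<F} \<times> {..<3} \<times> {..<F} \<times> {..<3})"
  proof
    fix A assume "A \<in> hopset"
    then obtain t s t' s' where h: "hop F lab w t s t' s' A" by (auto simp: hopset_def)
    then have b: "t < F" "s < 3" "t' < F" "s' < 3" by (auto simp: hop_def gl_def)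
    have nz: "dt (w t' s') (w t' (nx s')) \<noteq> 0" using w_dt [OF b(3,4)] by simp
    have "(THE A. hop F lab w t s t' s' A) = A"
      by (rule the_equality, rule h, rule hop_unique [OF _ h nz])
    then show "A \<in> (\<lambda>(t, s, t', s'). THE A. hop F lab w t s t' s' A) ` ({..<F} \<times> {..<3} \<times> {..<F} \<times> {..<3})"
      using b by (intro image_eqI [of _ _ "(t, s, t', s')"]) auto
  qed
  then show ?thesis by (rule finite_subset) auto
qed

abbreviation "G \<equiv> mat_monoid hopset"

lemma G_minus_one: "- 1 \<in> G"
proof -
  obtain t' s' where "gl F lab 0 0 t' s'" using surf_gl_ex [OF surf F_pos, of 0] by auto
  then obtain A where h: "hop F lab w 0 0 t' s' A" using hop_ex by blast
  then have "A \<in> hopset" "- adj A \<in> hopset" using hop_rev [OF h] by (auto simp: hopset_def)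
  then have "A * - adj A \<in> G" by (intro mat_monoid_mult mat_monoid_gen)
  then show ?thesis using adj_right [of A] h by (simp add: hop_def)
qed

lemma G_minus: "A \<in> G \<Longrightarrow> - A \<in> G"
  using mat_monoid_mult [OF G_minus_one] by fastforce

lemma G_adj: "A \<in> G \<Longrightarrow> adj A \<in> G"
proof (induction rule: mat_monoid.induct)
  case (mult h A)
  then obtain t s t' s' where "hop F lab w t s t' s' h" by (auto simp: hopset_def)
  then have "- adj h \<in> hopset" unfolding hopset_def using hop_rev by blast
  then have "adj h \<in> G" using G_minus [OF mat_monoid_gen] by fastforce
  then show ?case using mult by (auto simp: adj_mult intro: mat_monoid_mult)
qed (simp add: mat_monoid.one)

lemma gp_one: "t < F \<Longrightarrow> t' < F \<Longrightarrow> gp F lab w t 1 t'"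
proof -
  assume t: "t < F" "t' < F"
  have "gp F lab w 0 1 x" if "x < F" for x
    using gp_conj [OF path [OF that]] adj_right [OF path_det [OF that]] by (simp add: path_def)
  then show ?thesis using gp_trans [of F lab w 0 1 t' t 1] gp_rev [of F lab w 0 1 t] t by simp
qed

lemma gp_full: "A \<in> G \<Longrightarrow> t < F \<Longrightarrow> t' < F \<Longrightarrow> gp F lab w t A t'"
proof (induction arbitrary: t rule: mat_monoid.induct)
  case one
  then show ?case using gp_one by simp
next
  case (mult h A)
  then obtain x i y j where h: "hop F lab w x i y j h" by (auto simp: hopset_def)
  then have xy: "x < F" "y < F" by (auto simp: hop_def gl_def)
  have "gp F lab w t (1 * h) y" using gp_trans [OF gp_hop [OF h] gp_one] mult xy by blast
  moreover have "gp F lab w y A t'" using mult xy by blast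
  ultimately show ?case using gp_trans by fastforce
qed

definition base where "base i = (SOME p. fst p < F \<and> snd p < 3 \<and> pun (fst p) (snd p) = i)"
definition u where "u i = w (fst (base i)) (snd (base i))"
definition c where "c = horo F lab pun var"

lemma base: "i < n \<Longrightarrow> fst (base i) < F \<and> snd (base i) < 3 \<and> pun (fst (base i)) (snd (base i)) = i"
proof -
  assume "i < n"
  then have "\<exists>p. fst p < F \<and> snd p < 3 \<and> pun (fst p) (snd p) = i" using pun_onto by auto
  then show ?thesis unfolding base_def by (rule someI_ex)
qed

text \<open>Lying in the orbit of \<open>u i\<close> is compatible with the gluing, because glued
  corners are related by a hop; so it spreads from the base corner to all corners at the
  puncture.\<close>

lemma w_orbit: "t < F \<Longrightarrow> s < 3 \<Longrightarrow> \<exists>A\<in>G. w t s = mv A (u (pun t s))"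
proof -
  assume t: "t < F" "s < 3"
  let ?i = "pun t s"
  define f where "f x j = (\<exists>A\<in>G. w x j = mv A (u ?i))" for x j :: nat
  have "f x i = f y (nx j)" if xy: "gl F lab x i y j" for x i y j
  proof -
    obtain A where A: "A \<in> hopset" "hop F lab w x i y j A" using hop_ex [OF xy] by blast
    then have AG: "A \<in> G" "adj A \<in> G" using G_adj mat_monoid_gen by auto
    have e: "w x i = mv A (w y (nx j))" "w y (nx j) = mv (adj A) (w x i)"
      using A mv_adj_left [of A "w y (nx j)"] by (auto simp: hop_def)
    show ?thesis
    proof
      assume "f x i"
      then obtain B where B: "B \<in> G" "w x i = mv B (u ?i)" by (auto simp: f_def)
      then have "w y (nx j) = mv (adj A * B) (u ?i)" using e(2) by (simp add: mv_mult)
      then show "f y (nx j)" using mat_monoid_mult [OF AG(2) B(1)] by (auto simp: f_def)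
    next
      assume "f y (nx j)"
      then obtain B where B: "B \<in> G" "w y (nx j) = mv B (u ?i)" by (auto simp: f_def)
      then have "w x i = mv (A * B) (u ?i)" using e(1) by (simp add: mv_mult)
      then show "f x i" using mat_monoid_mult [OF AG(1) B(1)] by (auto simp: f_def)
    qed
  qed
  then have "f t s = f (fst (base ?i)) (snd (base ?i))"
    using comb_sep [OF comb, of f t s "fst (base ?i)" "snd (base ?i)"] base [OF pun_less [OF t]] t by auto
  moreover have "f (fst (base ?i)) (snd (base ?i))"
    unfolding f_def u_def by (rule bexI [of _ 1]) (simp_all add: mat_monoid.one)
  ultimately show ?thesis by (simp add: f_def)
qed

lemma c_pos: "i < n \<Longrightarrow> posr (c i)"
proof -
  assume "i < n"
  then obtain t s where t: "t < F" "s < 3" "pun t s = i" using pun_onto by blast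
  let ?q = "\<lambda>t s. if pun t s = i then var (lab t (nx s)) / (var (lab t s) * var (lab t (nx (nx s)))) else 0"
  have q: "?q x j = 0 \<or> posr (?q x j)" for x j by (auto intro!: posr_divide posr_mult posr_var)
  have nn: "(\<Sum>j<3. ?q x j) = 0 \<or> posr (\<Sum>j<3. ?q x j)" for x
  proof (cases "\<exists>j<3. posr (?q x j)")
    case True
    then obtain j where "j < 3" "posr (?q x j)" by blast
    then have "posr (\<Sum>j<3. ?q x j)" using posr_sum' [of "{..<3}" "?q x" j] q by blast
    then show ?thesis ..
  next
    case False
    then have "(\<Sum>j<3. ?q x j) = 0" using q by (intro sum.neutral) blast
    then show ?thesis ..
  qed
  have "posr (?q t s)" using t by (auto intro!: posr_divide posr_mult posr_var)
  then have "posr (\<Sum>j<3. ?q t j)" using posr_sum' [of "{..<3}" "?q t" s] q t by blast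
  then show ?thesis
    unfolding c_def horo_def using posr_sum' [of "{..<F}" "\<lambda>t. \<Sum>j<3. ?q t j" t] nn t by blast
qed

sublocale holonomy G n u c
proof
  show "det2 A = 1" if "A \<in> G" for A using det2_mat_monoid [OF that hopset_det] .
qed (fact mat_monoid.one mat_monoid_mult G_minus G_adj c_pos)+

lemma geom_init: "geom F m lab pun w var u c"
  unfolding geom_def
proof (intro conjI allI impI ballI)
  show "\<exists>A\<in>G. hop F lab w t s t' s' A" if "gl F lab t s t' s'" for t s t' s'
    using hop_ex [OF that] mat_monoid_gen by blast
  show "tagged u c" by (simp add: tagged_def)
  show "horo F lab pun var i = c i" for i by (simp add: c_def)
qed (use comb w_dt posr_var gp_full w_orbit in auto)

lemma seedrel_init: "seedrel F m lab var (var, exch_matrix F lab)"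
proof -
  have "(\<Prod>j<m. var j ^ EE F lab e j) = var e" if "e < m" for e
  proof -
    have "(\<Prod>j<m. var j ^ EE F lab e j) = (\<Prod>j<m. if j = e then var j else 1)"
      by (rule prod.cong) (auto simp: EE_init)
    then show ?thesis using that by simp
  qed
  then show ?thesis by (simp add: seedrel_def exch_matrix_cmat posr_var)
qed

lemma good_init: "good F m (var, exch_matrix F lab)"
  unfolding good_def using geom_init seedrel_init by blast

lemma skein_between:
  "cluster_algebra m (exch_matrix F lab) \<subseteq> skein" "skein \<subseteq> upper_cluster_algebra m (exch_matrix F lab)"
  using cluster_algebra_subset_skein skein_subset_upper good_init by auto

lemma skein_finitely_generated: "finitely_generated_ring skein"
  unfolding skein_def
  by (rule finitely_generated_invariants [OF finite_hopset hopset_det]) (auto simp: punc_def)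

lemma not_finitely_generated_imp_neq:
  "\<not> finitely_generated_ring (cluster_algebra m (exch_matrix F lab)) \<Longrightarrow>
    cluster_algebra m (exch_matrix F lab) \<noteq> upper_cluster_algebra m (exch_matrix F lab)"
  using skein_between skein_finitely_generated by auto

end

section \<open>Cocycles on a triangulated surface\<close>

lemma underdetermined_system_rat:
  fixes c :: "'e \<Rightarrow> 'u \<Rightarrow> rat"
  assumes "finite E" "finite U" "card E < card U"
  shows "\<exists>x. (\<exists>u\<in>U. x u \<noteq> 0) \<and> (\<forall>e\<in>E. (\<Sum>u\<in>U. c e u * x u) = 0)"
  using assms
proof (induction E arbitrary: U c rule: finite_induct)
  case empty
  then obtain v where "v \<in> U" by fastforce
  then show ?case by (intro exI [of _ "\<lambda>_. 1"]) auto
next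
  case (insert e0 E)
  show ?case
  proof (cases "\<forall>u\<in>U. c e0 u = 0")
    case True
    then show ?thesis using insert.IH [of U c] insert.prems insert.hyps by auto
  next
    case False
    then obtain v where v: "v \<in> U" "c e0 v \<noteq> 0" by blast
    define U' where "U' = U - {v}"
    have U': "finite U'" "card E < card U'" "\<And>f. sum f U = f v + sum f U'" for f :: "'u \<Rightarrow> rat"
      using insert v by (auto simp: U'_def sum.remove)
    define c' where "c' e u = c e u - c e v / c e0 v * c e0 u" for e u
    obtain x where x: "\<exists>u\<in>U'. x u \<noteq> 0" "\<And>e. e \<in> E \<Longrightarrow> (\<Sum>u\<in>U'. c' e u * x u) = 0"
      using insert.IH [OF U'(1,2), of c'] by blast
    define z where "z = - (\<Sum>u\<in>U'. c e0 u * x u) / c e0 v"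
    define x' where "x' = x(v := z)"
    have x'U': "(\<Sum>u\<in>U'. c e u * x' u) = (\<Sum>u\<in>U'. c e u * x u)" for e
      by (rule sum.cong) (auto simp: x'_def U'_def)
    have "(\<Sum>u\<in>U. c e0 u * x' u) = 0"
      unfolding U'(3) x'U' using v by (simp add: x'_def z_def)
    moreover have "(\<Sum>u\<in>U. c e u * x' u) = 0" if "e \<in> E" for e
    proof -
      have "0 = (\<Sum>u\<in>U'. c e u * x u) - c e v / c e0 v * (\<Sum>u\<in>U'. c e0 u * x u)"
        using x(2) [OF that] by (simp add: c'_def left_diff_distrib sum_subtractf sum_distrib_left mult.assoc)
      then show ?thesis unfolding U'(3) x'U' by (simp add: x'_def z_def)
    qed
    moreover have "\<exists>u\<in>U. x' u \<noteq> 0" using x(1) by (auto simp: x'_def U'_def)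
    ultimately show ?thesis by (intro exI [of _ x']) auto
  qed
qed

lemma common_denominator:
  fixes x :: "'u \<Rightarrow> rat"
  assumes "finite U"
  shows "\<exists>d::int. d > 0 \<and> (\<forall>u\<in>U. \<exists>z::int. of_int d * x u = of_int z)"
  using assms
proof (induction U rule: finite_induct)
  case empty
  show ?case by (intro exI [of _ 1]) auto
next
  case (insert v U)
  then obtain d :: int where d: "d > 0" "\<forall>u\<in>U. \<exists>z::int. of_int d * x u = of_int z" by blast
  obtain a b :: int where ab: "b > 0" "x v = of_int a / of_int b"
    using quotient_of_denom_pos quotient_of_div by (metis surj_pair)
  have "\<exists>z::int. of_int (d * b) * x u = of_int z" if u: "u \<in> insert v U" for u
  proof (cases "u = v")
    case True
    then have "of_int (d * b) * x u = of_int (d * a)" using ab by simp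
    then show ?thesis by blast
  next
    case False
    then obtain z :: int where "of_int d * x u = of_int z" using d u by auto
    then have "of_int (d * b) * x u = of_int (z * b)" by (simp add: algebra_simps)
    then show ?thesis by blast
  qed
  then show ?case using d ab by (intro exI [of _ "d * b"]) auto
qed

text \<open>Integers are required because the solution will provide exponents of the holonomy
  eigenvalue.\<close>

lemma underdetermined_system:
  fixes c :: "'e \<Rightarrow> 'u \<Rightarrow> int"
  assumes "finite E" "finite U" "card E < card U"
  shows "\<exists>x :: 'u \<Rightarrow> int. (\<exists>u\<in>U. x u \<noteq> 0) \<and> (\<forall>e\<in>E. (\<Sum>u\<in>U. c e u * x u) = 0)"
proof -
  obtain x where x: "\<exists>u\<in>U. x u \<noteq> 0" "\<And>e. e \<in> E \<Longrightarrow> (\<Sum>u\<in>U. of_int (c e u) * x u) = (0::rat)"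
    using underdetermined_system_rat [OF assms, of "\<lambda>e u. of_int (c e u)"] by blast
  obtain d :: int where d: "d > 0" "\<forall>u\<in>U. \<exists>z::int. of_int d * x u = of_int z"
    using common_denominator [OF assms(2)] by blast
  then obtain z :: "'u \<Rightarrow> int" where z: "\<And>u. u \<in> U \<Longrightarrow> of_int d * x u = of_int (z u)" by metis
  have "\<exists>u\<in>U. z u \<noteq> 0"
  proof -
    obtain v where "v \<in> U" "x v \<noteq> 0" using x by blast
    then have "of_int (z v) \<noteq> (0::rat)" using z [of v] d by (metis less_irrefl mult_eq_0_iff of_int_eq_0_iff)
    then show ?thesis using \<open>v \<in> U\<close> by auto
  qed
  moreover have "(\<Sum>u\<in>U. c e u * z u) = 0" if "e \<in> E" for e
  proof -
    have "of_int (\<Sum>u\<in>U. c e u * z u) = (\<Sum>u\<in>U. of_int (c e u) * of_int (z u) :: rat)" by simp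
    also have "\<dots> = (\<Sum>u\<in>U. of_int (c e u) * (of_int d * x u))" by (rule sum.cong) (simp_all add: z)
    also have "\<dots> = of_int d * (\<Sum>u\<in>U. of_int (c e u) * x u)" by (simp add: sum_distrib_left algebra_simps)
    finally show ?thesis using x(2) [OF that] by (simp flip: of_int_eq_0_iff [where 'a = rat])
  qed
  ultimately show ?thesis by blast
qed

section \<open>Sums over glued sides and harmonic cocycles\<close>

lemma surf_side: "surf F m lab \<Longrightarrow> e < m \<Longrightarrow> \<exists>t<F. \<exists>s<3. lab t s = e"
  by (rule surf_sides) (auto simp: gl_def)

definition mate :: "nat \<Rightarrow> (nat \<Rightarrow> nat \<Rightarrow> nat) \<Rightarrow> nat \<times> nat \<Rightarrow> nat \<times> nat" where
  "mate F lab p = (SOME q. gl F lab (fst p) (snd p) (fst q) (snd q))"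

lemma mate:
  assumes "surf F m lab" "t < F" "s < 3"
  shows "gl F lab t s (fst (mate F lab (t, s))) (snd (mate F lab (t, s)))"
proof -
  obtain t' s' where "gl F lab t s t' s'" by (rule surf_gl_ex [OF assms])
  then have "\<exists>q. gl F lab t s (fst q) (snd q)" by (intro exI [of _ "(t', s')"]) simp
  then show ?thesis unfolding mate_def fst_conv snd_conv
    by (rule someI_ex [where P = "\<lambda>q. gl F lab t s (fst q) (snd q)"])
qed

lemma mate_eq: "surf F m lab \<Longrightarrow> gl F lab t s t' s' \<Longrightarrow> mate F lab (t, s) = (t', s')"
proof -
  assume a: "surf F m lab" "gl F lab t s t' s'"
  then have "gl F lab t s (fst (mate F lab (t, s))) (snd (mate F lab (t, s)))"
    by (intro mate) (simp_all add: gl_def)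
  then show ?thesis using gl_unique [OF a(1) _ a(2)] by (simp add: prod_eq_iff)
qed

lemma sum_mate:
  fixes f :: "nat \<Rightarrow> nat \<Rightarrow> 'b::comm_monoid_add"
  assumes "surf F m lab" "\<And>t s t' s'. gl F lab t s t' s' \<Longrightarrow> f t s = k t' s'"
  shows "(\<Sum>t<F. \<Sum>s<3. f t s) = (\<Sum>t<F. \<Sum>s<3. k t s)"
proof -
  let ?S = "{..<F} \<times> {..<3::nat}"
  have *: "mate F lab (mate F lab p) = p \<and> mate F lab p \<in> ?S \<and>
      (case mate F lab p of (t, s) \<Rightarrow> k t s) = (case p of (t, s) \<Rightarrow> f t s)" if pS: "p \<in> ?S" for p
  proof -
    obtain t s where p: "p = (t, s)" "t < F" "s < 3" using pS by auto
    obtain t' s' where g: "gl F lab t s t' s'" by (rule surf_gl_ex [OF assms(1) p(2,3)])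
    then have m: "mate F lab (t, s) = (t', s')" "mate F lab (t', s') = (t, s)"
      using mate_eq [OF assms(1) g] mate_eq [OF assms(1) gl_sym [OF g]] by auto
    show ?thesis using g assms(2) [OF g] by (simp add: m p) (simp add: gl_def)
  qed
  have "(\<Sum>(t, s)\<in>?S. f t s) = (\<Sum>(t, s)\<in>?S. k t s)"
    by (rule sum.reindex_bij_witness [of _ "mate F lab" "mate F lab"]) (simp_all only: *)
  then show ?thesis by (simp add: sum.cartesian_product)
qed

text \<open>Integral 1-cocycles of the closed surface with the punctures as vertices:
  \<open>h t s\<close> is the value on the side oriented along \<open>t\<close>, and loops around a
  puncture have period 0.\<close>

definition cocycle :: "nat \<Rightarrow> (nat \<Rightarrow> nat \<Rightarrow> nat) \<Rightarrow> (nat \<Rightarrow> nat \<Rightarrow> int) \<Rightarrow> bool" where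
  "cocycle F lab h \<longleftrightarrow> (\<forall>t s t' s'. gl F lab t s t' s' \<longrightarrow> h t' s' = - h t s) \<and> (\<forall>t<F. (\<Sum>s<3. h t s) = 0)"

definition ip :: "nat \<Rightarrow> (nat \<Rightarrow> nat \<Rightarrow> int) \<Rightarrow> (nat \<Rightarrow> nat \<Rightarrow> int) \<Rightarrow> int" where
  "ip F h h' = (\<Sum>t<F. \<Sum>s<3. h t s * h' t s)"

text \<open>The triangle equations and the divergence equations at the punctures, less one redundant
  equation of each kind, are fewer than the arcs.\<close>

lemma harmonic_cocycle:
  assumes comb: "comb F m n lab pun" and count: "0 < F" "0 < n" "F + n < m + 2"
  shows "\<exists>h. cocycle F lab h \<and> ip F h h \<noteq> 0 \<and>
    (\<forall>G. (\<forall>t s t' s'. gl F lab t s t' s' \<longrightarrow> G t s = G t' (nx s')) \<longrightarrow>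
      ip F h (\<lambda>t s. G t (nx s) - G t s) = 0)"
proof -
  note surf = combD(1) [OF comb]
  define side where "side e = (SOME p. fst p < F \<and> snd p < 3 \<and> lab (fst p) (snd p) = e)" for e
  have side: "fst (side e) < F \<and> snd (side e) < 3 \<and> lab (fst (side e)) (snd (side e)) = e" if "e < m" for e
  proof -
    have "\<exists>t<F. \<exists>s<3. lab t s = e" using surf_side [OF surf that] .
    then obtain t s where "t < F" "s < 3" "lab t s = e" by blast
    then have "\<exists>p. fst p < F \<and> snd p < 3 \<and> lab (fst p) (snd p) = e" by (intro exI [of _ "(t, s)"]) auto
    then show ?thesis unfolding side_def by (rule someI_ex)
  qed
  define sg where "sg t s = (if side (lab t s) = (t, s) then 1 else - 1 :: int)" for t s
  have sg: "sg t' s' = - sg t s" if g: "gl F lab t s t' s'" for t s t' s'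
  proof -
    have b: "t < F" "s < 3" "t' < F" "s' < 3" "lab t s = lab t' s'" "(t, s) \<noteq> (t', s')"
      using g by (auto simp: gl_def)
    define p q where "p = fst (side (lab t s))" and "q = snd (side (lab t s))"
    have pq: "side (lab t s) = (p, q)" "p < F" "q < 3" "lab p q = lab t s"
      using side [OF surf_lab [OF surf b(1,2)]] by (simp_all add: p_def q_def)
    have "(t, s) = (t', s') \<or> (t', s') = (p, q) \<or> (t, s) = (p, q)"
      by (rule surf_three [OF surf b(1-4) pq(2,3) b(5)]) (simp add: pq(4) b(5))
    then have "side (lab t s) = (t, s) \<or> side (lab t s) = (t', s')" using b(6) pq(1) by metis
    then show ?thesis unfolding sg_def b(5) [symmetric] using b(6) by (metis minus_minus)
  qed
  define coef where "coef q e = (case q of Inl t \<Rightarrow> (\<Sum>s<3. if lab t s = e then sg t s else 0)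
    | Inr i \<Rightarrow> (\<Sum>t<F. \<Sum>s<3. if pun t s = i \<and> lab t s = e then sg t s else 0))" for q :: "nat + nat" and e
  \<comment> \<open>The inequality says that the Euler characteristic is below that of the
    sphere.\<close>
  have "card ({..<F - 1} <+> {..<n - 1}) < card {..<m}"
    using count by (simp add: card_Plus)
  then obtain x :: "nat \<Rightarrow> int" where x: "\<exists>e<m. x e \<noteq> 0"
    "\<And>q. q \<in> {..<F - 1} <+> {..<n - 1} \<Longrightarrow> (\<Sum>e<m. coef q e * x e) = 0"
    using underdetermined_system [of "{..<F - 1} <+> {..<n - 1}" "{..<m}" coef] by auto
  define h where "h t s = sg t s * x (lab t s)" for t s
  have pick: "(\<Sum>e<m. (if P \<and> lab t s = e then sg t s else 0) * x e) = (if P then h t s else 0)"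
    if "t < F" "s < 3" for t s P
  proof -
    have "(\<Sum>e<m. (if P \<and> lab t s = e then sg t s else 0) * x e) =
        (\<Sum>e<m. if e = lab t s then (if P then sg t s * x e else 0) else 0)"
      by (rule sum.cong) auto
    then show ?thesis using surf_lab [OF surf that] by (simp add: h_def)
  qed
  have anti: "h t' s' = - h t s" if "gl F lab t s t' s'" for t s t' s'
    using sg [OF that] that by (auto simp: h_def gl_def)
  have tri: "(\<Sum>s<3. h t s) = 0" if "t < F - 1" for t
  proof -
    have "0 = (\<Sum>e<m. (\<Sum>s<3. (if lab t s = e then sg t s else 0) * x e))"
      using x(2) [of "Inl t"] that by (auto simp: coef_def sum_distrib_right)
    also have "\<dots> = (\<Sum>s<3. \<Sum>e<m. (if True \<and> lab t s = e then sg t s else 0) * x e)"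
      by (subst sum.swap) simp
    also have "\<dots> = (\<Sum>s<3. h t s)"
      using that by (intro sum.cong refl) (subst pick, auto)
    finally show ?thesis by simp
  qed
  \<comment> \<open>Glued sides carry opposite values, so the omitted triangle equation follows from
    the others; the omitted puncture equation is recovered from the same total.\<close>
  have total: "(\<Sum>t<F. \<Sum>s<3. h t s) = 0"
  proof -
    have "(\<Sum>t<F. \<Sum>s<3. h t s) = (\<Sum>t<F. \<Sum>s<3. - h t s)"
      using anti by (intro sum_mate [OF surf]) fastforce
    then show ?thesis by (simp add: sum_negf)
  qed
  have tri': "(\<Sum>s<3. h t s) = 0" if "t < F" for t
  proof (cases "t < F - 1")
    case False
    then have "F = Suc t" using that by simp
    then have "(\<Sum>t<F. \<Sum>s<3. h t s) = (\<Sum>i<t. \<Sum>s<3. h i s) + (\<Sum>s<3. h t s)" by simp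
    moreover have "(\<Sum>i<t. \<Sum>s<3. h i s) = 0" using tri \<open>F = Suc t\<close> by (intro sum.neutral) auto
    ultimately show ?thesis using total by linarith
  qed (use tri in auto)
  define dv where "dv i = (\<Sum>t<F. \<Sum>s<3. if pun t s = i then h t s else 0)" for i
  have dv: "dv i = 0" if "i < n - 1" for i
  proof -
    have "0 = (\<Sum>e<m. \<Sum>t<F. \<Sum>s<3. (if pun t s = i \<and> lab t s = e then sg t s else 0) * x e)"
      using x(2) [of "Inr i"] that by (auto simp: coef_def sum_distrib_right)
    also have "\<dots> = (\<Sum>t<F. \<Sum>e<m. \<Sum>s<3. (if pun t s = i \<and> lab t s = e then sg t s else 0) * x e)"
      by (rule sum.swap)
    also have "\<dots> = (\<Sum>t<F. \<Sum>s<3. \<Sum>e<m. (if pun t s = i \<and> lab t s = e then sg t s else 0) * x e)"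
      by (rule sum.cong [OF refl], rule sum.swap)
    also have "\<dots> = dv i"
      unfolding dv_def by (intro sum.cong refl pick) auto
    finally show ?thesis by simp
  qed
  have weighted: "(\<Sum>t<F. \<Sum>s<3. h t s * a (pun t s)) = (\<Sum>i<n. a i * dv i)" for a :: "nat \<Rightarrow> int"
  proof -
    have "(\<Sum>i<n. a i * dv i) = (\<Sum>i<n. \<Sum>t<F. \<Sum>s<3. if pun t s = i then h t s * a i else 0)"
      unfolding dv_def sum_distrib_left by (intro sum.cong refl) auto
    also have "\<dots> = (\<Sum>t<F. \<Sum>i<n. \<Sum>s<3. if pun t s = i then h t s * a i else 0)"
      by (rule sum.swap)
    also have "\<dots> = (\<Sum>t<F. \<Sum>s<3. \<Sum>i<n. if pun t s = i then h t s * a i else 0)"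
      by (rule sum.cong [OF refl], rule sum.swap)
    also have "\<dots> = (\<Sum>t<F. \<Sum>s<3. h t s * a (pun t s))"
      using combD(3) [OF comb] by (intro sum.cong refl) (simp add: eq_commute)
    finally show ?thesis by simp
  qed
  have dv': "dv i = 0" if "i < n" for i
  proof (cases "i < n - 1")
    case False
    then have "n = Suc i" using that by simp
    have "(\<Sum>i<n. dv i) = 0" using weighted [of "\<lambda>_. 1"] total by simp
    moreover have "(\<Sum>j<n. dv j) = (\<Sum>j<i. dv j) + dv i" by (simp add: \<open>n = Suc i\<close>)
    moreover have "(\<Sum>j<i. dv j) = 0" using dv \<open>n = Suc i\<close> by (intro sum.neutral) auto
    ultimately show ?thesis by linarith
  qed (use dv in auto)
  have "ip F h h \<noteq> 0"
  proof -
    obtain e where e: "e < m" "x e \<noteq> 0" using x by blast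
    define t s where "t = fst (side e)" and "s = snd (side e)"
    have ts: "t < F" "s < 3" "lab t s = e" using side [OF e(1)] by (auto simp: t_def s_def)
    then have "h t s \<noteq> 0" using e by (simp add: h_def sg_def)
    then have "0 < h t s * h t s" by (meson not_square_less_zero linorder_neqE mult_eq_0_iff)
    also have "\<dots> \<le> (\<Sum>s<3. h t s * h t s)" using ts by (intro member_le_sum) auto
    also have "\<dots> \<le> ip F h h"
      unfolding ip_def using ts by (intro member_le_sum [where f = "\<lambda>t. \<Sum>s<3. h t s * h t s"] sum_nonneg) auto
    finally show ?thesis by simp
  qed
  \<comment> \<open>Summation by parts reduces the pairing with a coboundary to the divergences of
    \<open>h\<close>. Hence a cocycle that pairs nontrivially with \<open>h\<close> is not a
    coboundary.\<close>
  moreover have "ip F h (\<lambda>t s. G t (nx s) - G t s) = 0"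
    if G: "\<forall>t s t' s'. gl F lab t s t' s' \<longrightarrow> G t s = G t' (nx s')" for G
  proof -
    have "(\<Sum>t<F. \<Sum>s<3. h t s * G t (nx s)) = (\<Sum>t<F. \<Sum>s<3. - (h t s * G t s))"
    proof (rule sum_mate [OF surf])
      fix t s t' s' assume g: "gl F lab t s t' s'"
      show "h t s * G t (nx s) = - (h t' s' * G t' s')"
        using anti [OF g] G gl_sym [OF g] by fastforce
    qed
    then have 1: "ip F h (\<lambda>t s. G t (nx s) - G t s) = - 2 * (\<Sum>t<F. \<Sum>s<3. h t s * G t s)"
      by (simp add: ip_def right_diff_distrib sum_subtractf sum_negf)
    define a where "a i = (SOME v. \<exists>t<F. \<exists>s<3. pun t s = i \<and> v = G t s)" for i
    have "G t s = a (pun t s)" if t: "t < F" "s < 3" for t s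
    proof -
      have "\<exists>t'<F. \<exists>s'<3. pun t' s' = pun t s \<and> a (pun t s) = G t' s'"
        unfolding a_def by (rule someI [of _ "G t s"]) (use t in blast)
      then show ?thesis using comb_sep [OF comb, of G] G t by metis
    qed
    then have "(\<Sum>t<F. \<Sum>s<3. h t s * G t s) = (\<Sum>t<F. \<Sum>s<3. h t s * a (pun t s))"
      by (intro sum.cong refl) simp
    also have "\<dots> = 0" unfolding weighted using dv' by simp
    finally show ?thesis using 1 by simp
  qed
  ultimately show ?thesis using anti tri' unfolding cocycle_def by blast
qed

lemma cocycle_lin:
  "cocycle F lab h \<Longrightarrow> cocycle F lab h' \<Longrightarrow> cocycle F lab (\<lambda>t s. h t s + N * h' t s)"
proof -
  assume h: "cocycle F lab h" "cocycle F lab h'"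
  have "h t' s' + N * h' t' s' = - (h t s + N * h' t s)" if "gl F lab t s t' s'" for t s t' s'
  proof -
    have "h t' s' = - h t s" "h' t' s' = - h' t s" using h that unfolding cocycle_def by blast+
    then show ?thesis by simp
  qed
  moreover have "(\<Sum>s<3. h t s + N * h' t s) = 0" if "t < F" for t
  proof -
    have "(\<Sum>s<3. h t s) = 0" "(\<Sum>s<3. h' t s) = 0" using h that unfolding cocycle_def by blast+
    then show ?thesis unfolding sum.distrib sum_distrib_left [symmetric] by simp
  qed
  ultimately show ?thesis unfolding cocycle_def by blast
qed

lemma cocycle_zero: "cocycle F lab (\<lambda>t s. 0)"
  by (simp add: cocycle_def)

text \<open>Finitely many proper hyperplanes do not cover the cocycles: on a line
  \<open>h + N h'\<close> through suitable cocycles each functional vanishes for at most one integer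
  \<open>N\<close>.\<close>

lemma generic_cocycle:
  fixes Phi :: "((nat \<Rightarrow> nat \<Rightarrow> int) \<Rightarrow> int) set"
  assumes "finite Phi"
    and "\<And>f h h' N. f \<in> Phi \<Longrightarrow> f (\<lambda>t s. h t s + N * h' t s) = f h + N * f h'"
    and "\<And>f. f \<in> Phi \<Longrightarrow> \<exists>h. cocycle F lab h \<and> f h \<noteq> 0"
  shows "\<exists>h. cocycle F lab h \<and> (\<forall>f\<in>Phi. f h \<noteq> 0)"
  using assms
proof (induction Phi rule: finite_induct)
  case empty
  then show ?case using cocycle_zero by blast
next
  case (insert f0 Phi)
  have "\<exists>h. cocycle F lab h \<and> (\<forall>f\<in>Phi. f h \<noteq> 0)"
    by (rule insert.IH; rule insert.prems) simp_all
  then obtain h where h: "cocycle F lab h" "\<forall>f\<in>Phi. f h \<noteq> 0" by blast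
  obtain h' where h': "cocycle F lab h'" "f0 h' \<noteq> 0" using insert.prems by blast
  have nz: "f h \<noteq> 0 \<or> f h' \<noteq> 0" if "f \<in> insert f0 Phi" for f using h h' that by auto
  have "finite {N. f h + N * f h' = 0}" if "f \<in> insert f0 Phi" for f
  proof (cases "f h' = 0")
    case True
    then show ?thesis using nz [OF that] by simp
  next
    case False
    have "N = (- f h) div f h'" if "f h + N * f h' = 0" for N
    proof -
      have "- f h = N * f h'" using that by simp
      then show ?thesis using False by simp
    qed
    then have "{N. f h + N * f h' = 0} \<subseteq> {(- f h) div f h'}" by blast
    then show ?thesis by (rule finite_subset) simp
  qed
  then have "finite (\<Union>f\<in>insert f0 Phi. {N. f h + N * f h' = 0})"
    using insert.hyps by blast
  then obtain N where N: "N \<notin> (\<Union>f\<in>insert f0 Phi. {N. f h + N * f h' = 0})"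
    using infinite_UNIV_int ex_new_if_finite by blast
  then have "\<forall>f\<in>insert f0 Phi. f (\<lambda>t s. h t s + N * h' t s) \<noteq> 0"
    using insert.prems(1) by simp
  then show ?case using cocycle_lin [OF h(1) h'(1)] by blast
qed

section \<open>Specialisation of algebraically independent clusters\<close>

text \<open>Integral polynomials as syntax, so that one expression can be evaluated both in the
  field of rational functions and in characteristic two.\<close>

datatype pexp = PC int | PV nat | PA pexp pexp | PM pexp pexp

primrec ev :: "(nat \<Rightarrow> 'a::comm_ring_1) \<Rightarrow> pexp \<Rightarrow> 'a" where
  "ev a (PC c) = of_int c"
| "ev a (PV i) = a i"
| "ev a (PA e f) = ev a e + ev a f"
| "ev a (PM e f) = ev a e * ev a f"

type_synonym mpoly_int = "(nat \<Rightarrow>\<^sub>0 nat) \<Rightarrow>\<^sub>0 int"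

definition mon_val :: "(nat \<Rightarrow> 'a::comm_ring_1) \<Rightarrow> (nat \<Rightarrow>\<^sub>0 nat) \<Rightarrow> 'a" where
  "mon_val a k = (\<Prod>i\<in>Poly_Mapping.keys k. a i ^ Poly_Mapping.lookup k i)"

definition ins :: "(nat \<Rightarrow> 'a::comm_ring_1) \<Rightarrow> mpoly_int \<Rightarrow> 'a" where
  "ins a p = (\<Sum>k\<in>Poly_Mapping.keys p. of_int (Poly_Mapping.lookup p k) * mon_val a k)"

lemma mon_val_superset:
  assumes "finite A" "Poly_Mapping.keys k \<subseteq> A"
  shows "mon_val a k = (\<Prod>i\<in>A. a i ^ Poly_Mapping.lookup k i)"
  unfolding mon_val_def
  by (rule prod.mono_neutral_left) (use assms in \<open>auto simp: in_keys_iff\<close>)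

lemma ins_superset:
  assumes "finite A" "Poly_Mapping.keys p \<subseteq> A"
  shows "ins a p = (\<Sum>k\<in>A. of_int (Poly_Mapping.lookup p k) * mon_val a k)"
  unfolding ins_def
  by (rule sum.mono_neutral_left) (use assms in \<open>auto simp: in_keys_iff\<close>)

lemma mon_val_add: "mon_val a (k + l) = mon_val a k * mon_val a l"
proof -
  let ?A = "Poly_Mapping.keys k \<union> Poly_Mapping.keys l"
  have "Poly_Mapping.keys (k + l) \<subseteq> ?A" by (rule Poly_Mapping.keys_add)
  then show ?thesis
    by (simp add: mon_val_superset [of ?A] lookup_add power_add prod.distrib)
qed

lemma ins_add: "ins a (p + q) = ins a p + ins a q"
proof -
  let ?A = "Poly_Mapping.keys p \<union> Poly_Mapping.keys q"
  have "Poly_Mapping.keys (p + q) \<subseteq> ?A" by (rule Poly_Mapping.keys_add)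
  then show ?thesis
    by (simp add: ins_superset [of ?A] lookup_add distrib_right sum.distrib)
qed

lemma ins_single: "ins a (Poly_Mapping.single k c) = of_int c * mon_val a k"
  by (subst ins_superset [of "{k}"]) auto

lemma ins_zero: "ins a 0 = 0"
  by (simp add: ins_def)

lemma poly_mapping_sum_single:
  fixes p :: "'k \<Rightarrow>\<^sub>0 'v::comm_monoid_add"
  shows "(\<Sum>k\<in>Poly_Mapping.keys p. Poly_Mapping.single k (Poly_Mapping.lookup p k)) = p"
  by (rule poly_mapping_eqI) (simp add: lookup_sum lookup_single when_def in_keys_iff)

lemma poly_mapping_add_induct [case_names zero single add]:
  fixes p :: "'k \<Rightarrow>\<^sub>0 'v::comm_monoid_add"
  assumes z: "P 0" and s: "\<And>k c. P (Poly_Mapping.single k c)" and a: "\<And>p q. P p \<Longrightarrow> P q \<Longrightarrow> P (p + q)"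
  shows "P p"
proof -
  have "P (\<Sum>k\<in>A. Poly_Mapping.single k (Poly_Mapping.lookup p k))" for A
    by (induction A rule: infinite_finite_induct) (auto intro: z s a)
  then show ?thesis by (metis poly_mapping_sum_single)
qed

lemma ins_mult: "ins a (p * q) = ins a p * ins a q"
proof (induction p rule: poly_mapping_add_induct)
  case (single k c)
  show ?case
    by (induction q rule: poly_mapping_add_induct)
      (simp_all add: ins_zero mult_single ins_single mon_val_add ins_add distrib_left algebra_simps)
qed (simp_all add: ins_zero ins_add distrib_right)

primrec ipoly :: "pexp \<Rightarrow> mpoly_int" where
  "ipoly (PC c) = Poly_Mapping.single 0 c"
| "ipoly (PV i) = Poly_Mapping.single (Poly_Mapping.single i 1) 1"
| "ipoly (PA e f) = ipoly e + ipoly f"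
| "ipoly (PM e f) = ipoly e * ipoly f"

lemma ins_ipoly: "ins a (ipoly e) = ev a e"
proof (induction e)
  case (PV i)
  have "mon_val a (Poly_Mapping.single i 1) = a i"
    by (subst mon_val_superset [of "{i}"]) auto
  then show ?case by (simp add: ins_single)
qed (simp_all add: ins_single ins_add ins_mult mon_val_def)

definition rpoly :: "mpoly_rat \<Rightarrow> ratfun" where "rpoly p = Fract p 1"

lemma rpoly_simps: "rpoly (p + q) = rpoly p + rpoly q" "rpoly (p * q) = rpoly p * rpoly q"
  "rpoly 0 = 0" "rpoly 1 = 1" "rpoly p = 0 \<longleftrightarrow> p = 0"
  by (simp_all add: rpoly_def Zero_fract_def One_fract_def eq_fract)

lemma rpoly_power: "rpoly (p ^ k) = rpoly p ^ k"
  by (induction k) (simp_all add: rpoly_simps)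

lemma rpoly_prod: "rpoly (prod f A) = prod (\<lambda>i. rpoly (f i)) A"
  by (induction A rule: infinite_finite_induct) (simp_all add: rpoly_simps)

lemma rpoly_sum: "rpoly (sum f A) = sum (\<lambda>i. rpoly (f i)) A"
  by (induction A rule: infinite_finite_induct) (simp_all add: rpoly_simps)

lemma rpoly_of_int: "rpoly (of_int c) = of_int c"
proof -
  have n: "rpoly (of_nat k) = of_nat k" for k
    by (induction k) (simp_all only: rpoly_simps of_nat_0 of_nat_Suc)
  have neg: "rpoly (- p) = - rpoly p" for p unfolding rpoly_def by (rule minus_fract [symmetric])
  show ?thesis
    by (cases c rule: int_cases2) (simp_all only: of_int_minus of_int_of_nat_eq neg n)
qed

lemma mon_val_var: "mon_val var k = rpoly (Poly_Mapping.single k 1)"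
proof -
  have pow: "Poly_Mapping.single (Poly_Mapping.single i 1) 1 ^ e = (Poly_Mapping.single (Poly_Mapping.single i e) 1 :: mpoly_rat)"
    for i e :: nat
    by (induction e) (simp_all add: mult_single single_add [symmetric])
  have prd: "(\<Prod>i\<in>A. Poly_Mapping.single (f i) 1) = (Poly_Mapping.single (sum f A) 1 :: mpoly_rat)"
    for A :: "nat set" and f :: "nat \<Rightarrow> nat \<Rightarrow>\<^sub>0 nat"
    by (induction A rule: infinite_finite_induct) (simp_all add: mult_single)
  have "mon_val var k = rpoly (\<Prod>i\<in>Poly_Mapping.keys k. Poly_Mapping.single (Poly_Mapping.single i (Poly_Mapping.lookup k i)) 1)"
  proof -
    have "var i ^ e = rpoly (Poly_Mapping.single (Poly_Mapping.single i e) 1)" for i e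
    proof -
      have "var i = rpoly (Poly_Mapping.single (Poly_Mapping.single i 1) 1)" by (simp only: var_def rpoly_def)
      then have "var i ^ e = rpoly (Poly_Mapping.single (Poly_Mapping.single i 1) 1 ^ e)" by (simp only: rpoly_power)
      then show ?thesis by (simp only: pow)
    qed
    then show ?thesis unfolding rpoly_prod mon_val_def by (simp only:)
  qed
  then show ?thesis unfolding prd poly_mapping_sum_single .
qed

lemma ins_var_eq_0: "ins var p = 0 \<Longrightarrow> p = 0"
proof -
  assume a: "ins var p = 0"
  define r :: mpoly_rat where "r = (\<Sum>k\<in>Poly_Mapping.keys p. Poly_Mapping.single k (of_int (Poly_Mapping.lookup p k)))"
  have "Poly_Mapping.single k (of_int c) = (of_int c * Poly_Mapping.single k 1 :: mpoly_rat)" for k c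
    using mult_single [of 0 "of_int c :: rat" k 1] by simp
  then have "rpoly r = (\<Sum>k\<in>Poly_Mapping.keys p. rpoly (of_int (Poly_Mapping.lookup p k) * Poly_Mapping.single k 1))"
    by (simp only: r_def rpoly_sum)
  also have "\<dots> = ins var p"
    unfolding ins_def rpoly_simps rpoly_of_int mon_val_var ..
  finally have "r = 0" using a rpoly_simps by simp
  have "Poly_Mapping.lookup p k = 0" for k
  proof -
    have "Poly_Mapping.lookup r k = (if k \<in> Poly_Mapping.keys p then of_int (Poly_Mapping.lookup p k) else 0)"
      by (simp add: r_def lookup_sum lookup_single when_def)
    then show ?thesis using \<open>r = 0\<close> by (auto simp: in_keys_iff split: if_splits)
  qed
  then show "p = 0" by (simp add: poly_mapping_eqI)
qed

text \<open>Laurent series in a scaling parameter over Laurent series in a holonomy eigenvalue, with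
  coefficients in the field of two elements.\<close>

type_synonym chartwo = "bit fls fls"

text \<open>Integral polynomial relations between the entries of \<open>y\<close> persist under specialisation.
  For clusters this means algebraic independence, but only this consequence is needed.\<close>

definition indep :: "(nat \<Rightarrow> ratfun) \<Rightarrow> bool" where
  "indep y \<longleftrightarrow> (\<forall>e. ev y e = 0 \<longrightarrow> (\<forall>a :: nat \<Rightarrow> chartwo. (\<forall>i. a i \<noteq> 0) \<longrightarrow> ev a e = 0))"

lemma indep_var: "indep var"
  unfolding indep_def
proof (intro allI impI)
  fix e and a :: "nat \<Rightarrow> chartwo" assume "ev var e = 0"
  then have "ipoly e = 0" using ins_var_eq_0 ins_ipoly by metis
  then show "ev a e = 0" using ins_ipoly [of a e] ins_zero by metis
qed

section \<open>Independence of mutated clusters\<close>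

primrec ppow :: "nat \<Rightarrow> nat \<Rightarrow> pexp" where
  "ppow i 0 = PC 1"
| "ppow i (Suc d) = PM (PV i) (ppow i d)"

primrec pmon :: "(nat \<Rightarrow> nat) \<Rightarrow> nat \<Rightarrow> pexp" where
  "pmon f 0 = PC 1"
| "pmon f (Suc j) = PM (pmon f j) (ppow j (f j))"

lemma ev_ppow [simp]: "ev a (ppow i d) = a i ^ d"
  by (induction d) auto

lemma ev_pmon [simp]: "ev a (pmon f m) = (\<Prod>j<m. a j ^ f j)"
  by (induction m) auto

text \<open>Substitutes the exchange binomial over variable \<open>k\<close> for that variable and
  clears denominators; the second component is the power of variable \<open>k\<close> multiplied
  in.\<close>

fun clear :: "nat \<Rightarrow> (nat \<Rightarrow> nat) \<Rightarrow> (nat \<Rightarrow> nat) \<Rightarrow> nat \<Rightarrow> pexp \<Rightarrow> pexp \<times> nat" where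
  "clear k p q m (PC c) = (PC c, 0)"
| "clear k p q m (PV i) = (if i = k then (PA (pmon p m) (pmon q m), 1) else (PV i, 0))"
| "clear k p q m (PA e f) =
    (PA (PM (fst (clear k p q m e)) (ppow k (snd (clear k p q m f))))
        (PM (fst (clear k p q m f)) (ppow k (snd (clear k p q m e)))),
     snd (clear k p q m e) + snd (clear k p q m f))"
| "clear k p q m (PM e f) = (PM (fst (clear k p q m e)) (fst (clear k p q m f)),
     snd (clear k p q m e) + snd (clear k p q m f))"

lemma ev_clear:
  fixes z :: "nat \<Rightarrow> 'a::field"
  assumes "z k \<noteq> 0"
  shows "ev z (fst (clear k p q m e)) = z k ^ snd (clear k p q m e) *
    ev (z(k := ((\<Prod>j<m. z j ^ p j) + (\<Prod>j<m. z j ^ q j)) / z k)) e"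
proof (induction e)
  case (PV i)
  then show ?case using assms by simp
qed (simp_all add: algebra_simps power_add)

lemma ev_line:
  fixes a :: "nat \<Rightarrow> 'a::comm_ring_1"
  shows "\<exists>P. \<forall>z. poly P z = ev (a(b := a b + z)) e"
proof (induction e)
  case (PC c)
  show ?case by (intro exI [of _ "[:of_int c:]"]) simp
next
  case (PV i)
  show ?case
  proof (cases "i = b")
    case True
    then show ?thesis by (intro exI [of _ "[:a b, 1:]"]) simp
  next
    case False
    then show ?thesis by (intro exI [of _ "[:a i:]"]) simp
  qed
next
  case (PA e f)
  then obtain P Q where "\<forall>z. poly P z = ev (a(b := a b + z)) e" "\<forall>z. poly Q z = ev (a(b := a b + z)) f" by blast
  then show ?case by (intro exI [of _ "P + Q"]) (simp only: poly_add ev.simps simp_thms)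
next
  case (PM e f)
  then obtain P Q where "\<forall>z. poly P z = ev (a(b := a b + z)) e" "\<forall>z. poly Q z = ev (a(b := a b + z)) f" by blast
  then show ?case by (intro exI [of _ "P * Q"]) (simp only: poly_mult ev.simps simp_thms)
qed

lemma infinite_chartwo: "infinite (UNIV :: chartwo set)"
proof -
  have "inj (\<lambda>n::nat. fls_X ^ n :: chartwo)"
  proof (rule injI)
    fix i j :: nat assume "fls_X ^ i = (fls_X ^ j :: chartwo)"
    then have "fls_subdegree (fls_X ^ i :: chartwo) = fls_subdegree (fls_X ^ j :: chartwo)" by simp
    then show "i = j" by (simp add: fls_subdegree_pow)
  qed
  then show ?thesis using finite_subset infinite_UNIV_nat finite_imageD by (metis subset_UNIV)
qed

text \<open>A specialisation \<open>a\<close> of the new cluster lifts to the old one by solving the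
  exchange relation, provided the exchange binomial does not vanish at \<open>a\<close>. The
  variable \<open>b\<close> occurs linearly in just one monomial, so moving it excludes at most two
  values. Along this line the relation is a polynomial with infinitely many zeros, hence it also
  vanishes at \<open>a\<close>.\<close>

lemma indep_mutate:
  assumes y: "indep y" "y k \<noteq> 0" and pq: "p k = 0" "q k = 0" and b: "b < m" "b \<noteq> k" "p b = 0" "q b = 1"
  shows "indep (y(k := ((\<Prod>j<m. y j ^ p j) + (\<Prod>j<m. y j ^ q j)) / y k))"
  unfolding indep_def
proof (intro allI impI)
  fix e and a :: "nat \<Rightarrow> chartwo"
  assume e: "ev (y(k := ((\<Prod>j<m. y j ^ p j) + (\<Prod>j<m. y j ^ q j)) / y k)) e = 0" and a: "\<forall>i. a i \<noteq> 0"
  have "ev y (fst (clear k p q m e)) = 0" using ev_clear [of y k p q m e] y e by simp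
  then have c0: "ev x (fst (clear k p q m e)) = 0" if "\<forall>i. x i \<noteq> 0" for x :: "nat \<Rightarrow> chartwo"
    using y(1) that unfolding indep_def by blast
  have c: "ev (x(k := ((\<Prod>j<m. x j ^ p j) + (\<Prod>j<m. x j ^ q j)) / x k)) e = 0" if "\<forall>i. x i \<noteq> 0" for x :: "nat \<Rightarrow> chartwo"
    using c0 [OF that] ev_clear [of x k p q m e] that by simp
  obtain P where P: "\<And>z. poly P z = ev (a(b := a b + z)) e" using ev_line by blast
  define Mp where "Mp = (\<Prod>j<m. a j ^ p j)"
  define Mq where "Mq = (\<Prod>j\<in>{..<m} - {b}. a j ^ q j)"
  have nz: "Mp \<noteq> 0" "Mq \<noteq> 0" using a by (auto simp: Mp_def Mq_def)
  have root: "poly P z = 0" if z: "a b + z \<noteq> 0" "Mp + (a b + z) * Mq \<noteq> 0" for z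
  proof -
    define a' where "a' = a(b := a b + z)"
    have "(\<Prod>j<m. a' j ^ p j) = Mp"
      unfolding Mp_def using b by (intro prod.cong) (auto simp: a'_def)
    moreover have "(\<Prod>j<m. a' j ^ q j) = a' b ^ q b * (\<Prod>j\<in>{..<m} - {b}. a' j ^ q j)"
      using b by (intro prod.remove) auto
    then have "(\<Prod>j<m. a' j ^ q j) = (a b + z) * Mq"
      unfolding Mq_def using b by (simp add: a'_def)
    ultimately have W: "(\<Prod>j<m. a' j ^ p j) + (\<Prod>j<m. a' j ^ q j) = Mp + (a b + z) * Mq" by simp
    \<comment> \<open>Mutation is an involution: this \<open>x\<close> is the old cluster that
      mutates to \<open>a'\<close>.\<close>
    define x where "x = a'(k := (Mp + (a b + z) * Mq) / a' k)"
    have a'nz: "a' i \<noteq> 0" for i using a z by (simp add: a'_def)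
    have "(\<Prod>j<m. x j ^ p j) = (\<Prod>j<m. a' j ^ p j)" "(\<Prod>j<m. x j ^ q j) = (\<Prod>j<m. a' j ^ q j)"
      using pq by (auto intro!: prod.cong simp: x_def)
    then have "x(k := ((\<Prod>j<m. x j ^ p j) + (\<Prod>j<m. x j ^ q j)) / x k) = a'"
      using z a'nz [of k] W by (auto simp: x_def fun_eq_iff)
    moreover have "\<forall>i. x i \<noteq> 0" using a'nz z by (simp add: x_def)
    ultimately show ?thesis using c [of x] P [of z] by (simp add: a'_def)
  qed
  have "P = 0"
  proof (rule ccontr)
    assume "P \<noteq> 0"
    then have "finite {z. poly P z = 0}" by (rule poly_roots_finite)
    moreover have "- {z. poly P z = 0} \<subseteq> {- a b, - a b - Mp / Mq}"
    proof
      fix z assume "z \<in> - {z. poly P z = 0}"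
      then have "a b + z = 0 \<or> Mp + (a b + z) * Mq = 0" using root by blast
      then show "z \<in> {- a b, - a b - Mp / Mq}"
      proof
        assume "a b + z = 0"
        then show ?thesis by (simp add: eq_neg_iff_add_eq_0 add.commute)
      next
        assume "Mp + (a b + z) * Mq = 0"
        then have "(a b + z) * Mq = - Mp" by (simp add: eq_neg_iff_add_eq_0 add.commute)
        then have "a b + z = - Mp / Mq" using nz by (simp add: field_simps)
        moreover have "z = (a b + z) - a b" by simp
        ultimately have "z = - a b - Mp / Mq" by simp
        then show ?thesis by simp
      qed
    qed
    then have "finite (- {z. poly P z = 0})" by (rule finite_subset) simp
    ultimately have "finite ({z. poly P z = 0} \<union> - {z. poly P z = 0})" by blast
    then show False using infinite_chartwo by simp
  qed
  then show "ev a e = 0" using P [of 0] by simp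
qed

section \<open>Removing separating arcs\<close>

text \<open>Such an arc has period 0 under every cocycle, for example when it is separating. It
  would be sent to \<open>arc 0\<close>, which is 0.\<close>

definition null :: "nat \<Rightarrow> (nat \<Rightarrow> nat \<Rightarrow> nat) \<Rightarrow> nat \<Rightarrow> bool" where
  "null F lab e \<longleftrightarrow> (\<forall>h. cocycle F lab h \<longrightarrow> (\<forall>t<F. \<forall>s<3. lab t s = e \<longrightarrow> h t s = 0))"

lemma cocycle_anti: "cocycle F lab h \<Longrightarrow> gl F lab t s t' s' \<Longrightarrow> h t' s' = - h t s"
  unfolding cocycle_def by blast

lemma cocycle_sum: "cocycle F lab h \<Longrightarrow> t < F \<Longrightarrow> (\<Sum>s<3. h t s) = 0"
  unfolding cocycle_def by blast

lemma cocycle_sum': "cocycle F lab h \<Longrightarrow> t < F \<Longrightarrow> s < 3 \<Longrightarrow> h t s + (h t (nx s) + h t (nx (nx s))) = 0"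
  using cocycle_sum [of F lab h t] by (simp add: sum_less3 [of s])

definition crossing :: "nat \<Rightarrow> nat \<Rightarrow> nat \<Rightarrow> nat \<Rightarrow> nat \<Rightarrow> nat \<Rightarrow> int" where
  "crossing x i y j z q = (if (z, q) = (x, i) then 1 else 0) - (if (z, q) = (y, j) then 1 else 0)"

lemma crossing_anti:
  assumes "surf F m lab" "gl F lab x i y j" "gl F lab z q z' q'"
  shows "crossing x i y j z' q' = - crossing x i y j z q"
proof -
  have "(z', q') = (x, i) \<longleftrightarrow> (z, q) = (y, j)"
    using gl_unique [OF assms(1) _ assms(3)] gl_unique [OF assms(1) _ gl_sym [OF assms(3)]]
      assms(2) gl_sym [OF assms(2)] by fast
  moreover have "(z', q') = (y, j) \<longleftrightarrow> (z, q) = (x, i)"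
    using gl_unique [OF assms(1) _ assms(3)] gl_unique [OF assms(1) _ gl_sym [OF assms(3)]]
      assms(2) gl_sym [OF assms(2)] by fast
  ultimately show ?thesis by (simp add: crossing_def)
qed

lemma crossing_sum:
  assumes "i < 3" "j < 3"
  shows "(\<Sum>q<3. crossing x i y j z q) = (if z = x then 1 else 0) - (if z = y then 1 else 0)"
proof -
  have "(\<Sum>q<3. if (z, q) = (x, i) then 1 else 0 :: int) = (if z = x then 1 else 0)" if "i < 3" for x i :: nat
  proof -
    have "(\<Sum>q<3. if (z, q) = (x, i) then 1 else 0 :: int) = (\<Sum>q<3. if q = i then (if z = x then 1 else 0) else 0)"
      by (rule sum.cong) auto
    then show ?thesis using that by simp
  qed
  then show ?thesis using assms by (simp only: crossing_def sum_subtractf)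
qed

locale nullflip = geoflip +
  assumes no_sf: "\<not> sf F lab e j" and null_k: "null F lab k" and nonnull_a: "\<not> null F lab ea"
begin

text \<open>An integral flow of unit strength from \<open>t\<close> to \<open>x\<close> across the
  sides other than \<open>k\<close>. Chains are used in place of paths because they can be added and
  closed up to cocycles.\<close>

definition flow :: "nat \<Rightarrow> bool" where
  "flow x \<longleftrightarrow> (\<exists>c :: nat \<Rightarrow> nat \<Rightarrow> int. (\<forall>z q z' q'. gl F lab z q z' q' \<longrightarrow> c z' q' = - c z q) \<and>
     c t s = 0 \<and> (\<forall>y<F. (\<Sum>q<3. c y q) = (if y = t then 1 else 0) - (if y = x then 1 else 0)))"

lemma flow_t: "flow t"
  unfolding flow_def by (rule exI [of _ "\<lambda>_ _. 0"]) simp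

lemma flow_step:
  assumes "flow x" "gl F lab x i y j" "lab x i \<noteq> k"
  shows "flow y"
proof -
  obtain c :: "nat \<Rightarrow> nat \<Rightarrow> int" where c: "\<And>z q z' q'. gl F lab z q z' q' \<Longrightarrow> c z' q' = - c z q" "c t s = 0"
    "\<And>y. y < F \<Longrightarrow> (\<Sum>q<3. c y q) = (if y = t then 1 else 0) - (if y = x then 1 else 0)"
    using assms(1) unfolding flow_def by blast
  have b: "i < 3" "j < 3" "(x, i) \<noteq> (t, s)" "(y, j) \<noteq> (t, s)"
    using assms(2,3) k by (auto simp: gl_def)
  let ?c = "\<lambda>z q. c z q + crossing x i y j z q"
  have "?c z' q' = - ?c z q" if "gl F lab z q z' q'" for z q z' q'
    using c(1) [OF that] crossing_anti [OF surf assms(2) that] by simp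
  moreover have "?c t s = 0" using c(2) b by (auto simp: crossing_def)
  moreover have "(\<Sum>q<3. ?c z q) = (if z = t then 1 else 0) - (if z = y then 1 else 0)" if "z < F" for z
    using c(3) [OF that] by (simp only: sum.distrib crossing_sum [OF b(1,2)])
  ultimately show ?thesis unfolding flow_def by (intro exI [of _ ?c]) simp
qed

text \<open>A flow from \<open>t\<close> to \<open>t'\<close> off the null arc \<open>k\<close> could be closed up to a cocycle not vanishing at \<open>k\<close>.\<close>

lemma not_flow_t': "\<not> flow t'"
proof
  assume "flow t'"
  then obtain c :: "nat \<Rightarrow> nat \<Rightarrow> int" where c: "\<And>z q z' q'. gl F lab z q z' q' \<Longrightarrow> c z' q' = - c z q" "c t s = 0"
    "\<And>y. y < F \<Longrightarrow> (\<Sum>q<3. c y q) = (if y = t then 1 else 0) - (if y = t' then 1 else 0)"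
    unfolding flow_def by blast
  let ?c = "\<lambda>z q. c z q + crossing t' s' t s z q"
  have "?c z' q' = - ?c z q" if "gl F lab z q z' q'" for z q z' q'
    using c(1) [OF that] crossing_anti [OF surf gl_k(2) that] by simp
  moreover have "(\<Sum>q<3. ?c z q) = 0" if "z < F" for z
    using c(3) [OF that] by (simp only: sum.distrib crossing_sum [OF nxs(24,22)])
  ultimately have "cocycle F lab ?c" unfolding cocycle_def by blast
  then have "?c t s = 0" using null_k k nxs unfolding null_def by blast
  then show False using c(2) by (simp add: crossing_def)
qed

lemma flow_iff: "gl F lab x i y j \<Longrightarrow> lab x i \<noteq> k \<Longrightarrow> flow x \<longleftrightarrow> flow y"
  using flow_step [of x i y j] flow_step [of y j x i] gl_sym [of F lab x i y j] by (auto simp: gl_def)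

lemma null_k_value: "cocycle F lab h \<Longrightarrow> h t s = 0 \<and> h t' s' = 0"
  using null_k k nxs unfolding null_def by blast

definition cut :: "(nat \<Rightarrow> nat \<Rightarrow> int) \<Rightarrow> nat \<Rightarrow> nat \<Rightarrow> int" where
  "cut h x i = (if flow x then h x i else 0)"

text \<open>Each cocycle vanishes on \<open>k\<close>, so it can be set to 0 on the triangles that
  no flow reaches without violating the gluing condition.\<close>

lemma cocycle_cut:
  assumes "cocycle F lab h"
  shows "cocycle F lab (cut h)"
proof -
  have "cut h y j = - cut h x i" if g: "gl F lab x i y j" for x i y j
  proof (cases "lab x i = k")
    case True
    then have "h x i = 0 \<and> h y j = 0" using gl_k_cases [OF g] null_k_value [OF assms] by auto
    then show ?thesis by (simp add: cut_def)
  next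
    case False
    then show ?thesis using flow_iff [OF g] cocycle_anti [OF assms g] by (simp add: cut_def)
  qed
  moreover have "(\<Sum>q<3. cut h x q) = 0" if "x < F" for x
    using cocycle_sum [OF assms that] by (cases "flow x") (simp_all add: cut_def)
  ultimately show ?thesis unfolding cocycle_def by blast
qed

text \<open>A common outer side would let a flow pass from \<open>t\<close> to \<open>t'\<close>
  without crossing \<open>k\<close>.\<close>

lemma sides_apart:
  assumes "i < 3" "lab t i \<noteq> k" "j < 3"
  shows "lab t i \<noteq> lab t' j"
proof
  assume "lab t i = lab t' j"
  then have "gl F lab t i t' j" using assms by (simp add: gl_def)
  then show False using flow_step [OF flow_t] assms not_flow_t' by blast
qed

lemma outer_distinct: "ea \<noteq> ed" "eb \<noteq> ec" "eb \<noteq> ed" "eb \<noteq> ea"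
  using sides_apart no_sf [of k ea] sf_k [of ea] by auto

text \<open>The same cocycle after the flip; its value on the new diagonal is forced by the triangle
  equation.\<close>

definition cocycle2 :: "(nat \<Rightarrow> nat \<Rightarrow> int) \<Rightarrow> nat \<Rightarrow> nat \<Rightarrow> int" where
  "cocycle2 h z q = (if (z, q) = (t, nx (nx s)) then - h t' (nx (nx s')) - h t (nx s)
     else if (z, q) = (t', nx (nx s')) then - h t (nx (nx s)) - h t' (nx s')
     else h (fst (rho z q)) (snd (rho z q)))"

lemma cocycle2_simps:
  "cocycle2 h t s = h t' (nx (nx s'))" "cocycle2 h t (nx s) = h t (nx s)"
  "cocycle2 h t (nx (nx s)) = - h t' (nx (nx s')) - h t (nx s)"
  "cocycle2 h t' s' = h t (nx (nx s))" "cocycle2 h t' (nx s') = h t' (nx s')"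
  "cocycle2 h t' (nx (nx s')) = - h t (nx (nx s)) - h t' (nx s')"
  "x \<noteq> t \<Longrightarrow> x \<noteq> t' \<Longrightarrow> cocycle2 h x i = h x i"
  by (auto simp: cocycle2_def rho_def)

lemma cocycle2_other: "lab2 z q \<noteq> k \<Longrightarrow> cocycle2 h z q = h (fst (rho z q)) (snd (rho z q))"
  by (auto simp: cocycle2_def)

lemma cocycle_cocycle2:
  assumes "cocycle F lab h"
  shows "cocycle F lab2 (cocycle2 h)"
proof -
  have s: "h t (nx s) + h t (nx (nx s)) = 0" "h t' (nx s') + h t' (nx (nx s')) = 0"
    using cocycle_sum' [OF assms, of t s] cocycle_sum' [OF assms, of t' s'] null_k_value [OF assms] by auto
  have "cocycle2 h y j = - cocycle2 h x i" if g: "gl F lab2 x i y j" for x i y j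
  proof (cases "lab2 x i = k")
    case True
    then show ?thesis using gl2_k_cases [OF g] s by (auto simp: cocycle2_simps)
  next
    case False
    then have "lab2 y j \<noteq> k" using g by (simp add: gl_def)
    then show ?thesis
      using cocycle2_other [OF False] cocycle2_other [of y j] cocycle_anti [OF assms rho_gl [OF g]] by simp
  qed
  moreover have "(\<Sum>q<3. cocycle2 h x q) = 0" if "x < F" for x
  proof -
    consider "x = t" | "x = t'" | "x \<noteq> t" "x \<noteq> t'" by blast
    then show ?thesis
    proof cases
      case 1
      then show ?thesis by (simp add: sum_less3 [of s] cocycle2_simps)
    next
      case 2
      then show ?thesis by (simp add: sum_less3 [of s'] cocycle2_simps)
    next
      case 3
      then show ?thesis using cocycle_sum [OF assms that] by (simp add: cocycle2_simps)
    qed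
  qed
  ultimately show ?thesis unfolding cocycle_def by blast
qed

lemma nonnull_other:
  assumes "\<not> null F lab e" "e \<noteq> k"
  shows "\<not> null F lab2 e"
proof -
  obtain h x i where h: "cocycle F lab h" "x < F" "i < 3" "lab x i = e" "h x i \<noteq> 0"
    using assms(1) unfolding null_def by blast
  define y j where "y = fst (irho x i)" and "j = snd (irho x i)"
  have r: "rho y j = (x, i)" "y < F" "j < 3"
    using irho_rho [of x i] irho_range [OF h(2,3)] by (auto simp: y_def j_def)
  then have "lab2 y j = e" using h by (simp add: lab2_def)
  moreover have "cocycle2 h y j \<noteq> 0" using cocycle2_other [of y j h] r h assms(2) \<open>lab2 y j = e\<close> by simp
  ultimately show ?thesis using cocycle_cocycle2 [OF h(1)] r unfolding null_def by blast
qed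

text \<open>The value on the new diagonal combines one side of \<open>t\<close> with one side of
  \<open>t'\<close>. Cutting off the part beyond \<open>k\<close> removes the latter, and the former
  is nonzero for some cocycle because \<open>ea\<close> is not null.\<close>

lemma nonnull_k: "\<not> null F lab2 k"
proof -
  obtain h x i where h: "cocycle F lab h" "x < F" "i < 3" "lab x i = ea" "h x i \<noteq> 0"
    using nonnull_a unfolding null_def by blast
  have "h t (nx s) \<noteq> 0"
  proof (cases "(x, i) = (t, nx s)")
    case False
    then have "gl F lab x i t (nx s)" using h by (simp add: gl_def)
    then show ?thesis using cocycle_anti [OF h(1)] h(5) by simp
  qed (use h in auto)
  then have "cocycle2 (cut h) t (nx (nx s)) \<noteq> 0"
    using flow_t not_flow_t' by (simp add: cocycle2_simps cut_def)
  moreover have "cocycle F lab2 (cocycle2 (cut h))" using cocycle_cocycle2 cocycle_cut h by blast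
  ultimately show ?thesis unfolding null_def using lab2_simps(3) nxs by blast
qed

lemma no_sf2: "\<not> sf F lab2 e j"
proof (cases "e = k")
  case True
  then show ?thesis using sf2_k [of j] outer_distinct by auto
next
  case False
  then show ?thesis using sf2_other no_sf by blast
qed

lemma indep2:
  assumes S: "seedrel F m lab lam S" and y: "indep (fst S)"
  shows "indep (fst (mutate m k S))"
proof -
  have C: "snd S = cmat F lab" using S by (simp add: seedrel_def)
  have E: "EE F lab e j = (if j = e then 1 else 0)" for e j using no_sf by (simp add: EE_def)
  show ?thesis
    unfolding mutate_fst C
  \<comment> \<open>By \<open>outer_distinct\<close>, \<open>eb\<close> occurs once among the outer
    sides, so it enters only one exchange monomial, with exponent 1.\<close>
  proof (rule indep_mutate [where b = eb and k = k])
    show "fst S k \<noteq> 0" using S k_less posr_neq_0 by (auto simp: seedrel_def)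
    show "eb < m" using surf_lab [OF surf] by simp
    show "nat (cmat F lab k k) = 0" "nat (- cmat F lab k k) = 0" by (simp_all add: cmat_col E)
    show "nat (cmat F lab eb k) = 0" "nat (- cmat F lab eb k) = 1"
      using outer_distinct by (simp_all add: cmat_col E)
  qed (use y in auto)
qed

end

context holonomy
begin

definition plain where
  "plain F m lab pun w lam uu kap S \<longleftrightarrow> geom F m lab pun w lam uu kap \<and> seedrel F m lab lam S \<and>
     (\<forall>e j. \<not> sf F lab e j) \<and> indep (fst S)"

text \<open>Otherwise nullity would pass from side to side and, by connectedness, to all arcs,
  against the nonzero cocycle \<open>h\<close>.\<close>

lemma null_neighbour:
  assumes g: "geom F m lab pun w lam uu kap" and h: "cocycle F lab h" "ip F h h \<noteq> 0"
    and e: "e < m" "null F lab e"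
  shows "\<exists>t<F. \<exists>s<3. null F lab (lab t s) \<and> \<not> null F lab (lab t (nx s))"
proof (rule ccontr)
  note surf = combD(1) [OF geomD(1) [OF g]]
  assume "\<not> ?thesis"
  then have step: "null F lab (lab t (nx s))" if "t < F" "s < 3" "null F lab (lab t s)" for t s
    using that by blast
  then have all: "null F lab (lab t i)" if "t < F" "s < 3" "null F lab (lab t s)" "i < 3" for t s i
    using that less3_cases [of s i] by (metis nx_simps(1))
  have reach: "\<forall>i<3. null F lab (lab y i)" if "gp F lab w x A y" "\<forall>i<3. null F lab (lab x i)" for x A y
    using that
  proof (induction rule: gp.induct)
    case (step t A t' s t'' s'' B)
    then have "gl F lab t' s t'' s''" by (simp add: hop_def)
    then have "null F lab (lab t'' s'')" "t'' < F" "s'' < 3" using step by (auto simp: gl_def)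
    then show ?case using all by blast
  qed
  obtain t s where t: "t < F" "s < 3" "lab t s = e" using surf_side [OF surf e(1)] by blast
  then have "\<forall>i<3. null F lab (lab t i)" using all e by blast
  then have "null F lab (lab x i)" if "x < F" "i < 3" for x i
    using reach [OF geomD(5) [OF g G_one t(1) that(1)]] that by blast
  then have "h x i = 0" if "x < F" "i < 3" for x i using h(1) that unfolding null_def by blast
  then have "ip F h h = 0" by (simp add: ip_def)
  then show False using h by simp
qed

lemma plain_flip:
  assumes p: "plain F m lab pun w lam uu kap S" and F: "0 < F" "0 < n" "F + n < m + 2"
    and e: "e < m" "null F lab e"
  shows "\<exists>lab' pun' w' lam' S'. plain F m lab' pun' w' lam' uu kap S' \<and>
    {e. e < m \<and> null F lab' e} \<subset> {e. e < m \<and> null F lab e}"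
proof -
  have g: "geom F m lab pun w lam uu kap" "seedrel F m lab lam S" "\<And>e j. \<not> sf F lab e j" "indep (fst S)"
    using p by (auto simp: plain_def)
  note surf = combD(1) [OF geomD(1) [OF g(1)]]
  obtain h where "cocycle F lab h" "ip F h h \<noteq> 0"
    using harmonic_cocycle [OF geomD(1) [OF g(1)] F] by blast
  then obtain t s where t: "t < F" "s < 3" "null F lab (lab t s)" "\<not> null F lab (lab t (nx s))"
    using null_neighbour [OF g(1) _ _ e] by blast
  obtain t' s' where gl: "gl F lab t s t' s'" by (rule surf_gl_ex [OF surf t(1,2)])
  define k where "k = lab t s"
  have "t \<noteq> t'"
  proof
    assume "t = t'"
    then have "s' = nx s \<or> s' = nx (nx s)" using gl less3_cases [of s s'] by (auto simp: gl_def)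
    then have "sf F lab (lab t (nx (nx s))) k \<or> sf F lab (lab t (nx s)) k"
      unfolding sf_def k_def using gl \<open>t = t'\<close> t by (metis gl_def nx_simps(1,6))
    then show False using g(3) by blast
  qed
  then have q: "quad F m lab t s t' s' k" using gl surf by (auto simp: quad_def gl_def k_def)
  obtain M where M: "M \<in> G" "hop F lab w t s t' s' M" using geomD(4) [OF g(1) gl] by blast
  interpret nullflip F m lab t s t' s' k G n u c pun w lam uu kap M
    using q g M t by (simp add: nullflip_def nullflip_axioms_def geoflip_def flip_def flip_axioms_def
        geoflip_axioms_def holonomy_axioms k_def)
  have "plain F m lab2 pun2 w2 lam2 uu kap (mutate m k S)"
    unfolding plain_def using geom2 seedrel2 [OF g(2)] no_sf2 indep2 [OF g(2,4)] by blast
  moreover have "{e. e < m \<and> null F lab2 e} \<subset> {e. e < m \<and> null F lab e}"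
    using nonnull_other nonnull_k null_k k_less by blast
  ultimately show ?thesis by blast
qed

lemma plain_nonnull:
  assumes "plain F m lab pun w lam uu kap S" and F: "0 < F" "0 < n" "F + n < m + 2"
  shows "\<exists>lab' pun' w' lam' S'. plain F m lab' pun' w' lam' uu kap S' \<and> (\<forall>e<m. \<not> null F lab' e)"
  using assms(1)
proof (induction "card {e. e < m \<and> null F lab e}" arbitrary: lab pun w lam S rule: less_induct)
  case less
  show ?case
  proof (cases "\<exists>e<m. null F lab e")
    case True
    then obtain lab' pun' w' lam' S' where *: "plain F m lab' pun' w' lam' uu kap S'"
      "{e. e < m \<and> null F lab' e} \<subset> {e. e < m \<and> null F lab e}"
      using plain_flip [OF less.prems F] by blast
    have "card {e. e < m \<and> null F lab' e} < card {e. e < m \<and> null F lab e}"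
      by (rule psubset_card_mono [OF _ *(2)]) simp
    then show ?thesis using less.hyps [OF _ *(1)] by blast
  next
    case False
    then show ?thesis using less.prems by blast
  qed
qed

end

section \<open>Reduction modulo two\<close>

lemma char_two: "x + x = (0 :: chartwo)"
proof -
  have bit: "b + b = 0" for b :: bit by (simp only: mult_2 [symmetric] bit_2_eq_0 mult_zero_left)
  show ?thesis by (intro fls_eqI) (simp only: fls_plus_nth fls_zero_nth bit)
qed

lemma uminus_char_two: "- x = (x :: chartwo)"
  using char_two [of x] by (rule minus_unique)

lemma diff_char_two: "x - y = x + (y :: chartwo)"
  using uminus_char_two [of y] by (simp only: diff_conv_add_uminus)

section \<open>Degenerate lambda lengths and the residue condition\<close>

definition tau :: chartwo where "tau = fls_X"
definition Q :: "int \<Rightarrow> chartwo" where "Q k = fls_const (fls_X_intpow k)"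

lemma Q_add: "Q (j + k) = Q j * Q k"
  unfolding Q_def fls_const_mult_const fls_X_intpow_times_fls_X_intpow ..

lemma Q_0 [simp]: "Q 0 = 1"
  by (simp add: Q_def)

lemma tau_nz [simp]: "tau \<noteq> 0"
  by (simp add: tau_def)

definition arc :: "int \<Rightarrow> chartwo" where "arc k = tau * (Q k + Q (- k))"

lemma Q_sum_coeff:
  assumes "k \<noteq> 0"
  shows "fls_nth (fls_nth (Q k + Q (- k)) 0) k = 1"
  using assms by (simp add: Q_def)

lemma Q_sum_nz: "k \<noteq> 0 \<Longrightarrow> Q k + Q (- k) \<noteq> 0"
proof
  assume "k \<noteq> 0" "Q k + Q (- k) = 0"
  then show False using Q_sum_coeff [of k] by (simp only:) simp
qed

lemma arc_nz: "k \<noteq> 0 \<Longrightarrow> arc k \<noteq> 0"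
  using Q_sum_nz by (simp add: arc_def)

lemma arc_minus: "arc (- k) = arc k"
  by (simp add: arc_def add.commute)

text \<open>Power series in \<open>tau\<close> whose constant term lies in the field with two
  elements, and not merely in its Laurent series field: the ring into which the cluster algebra is
  forced.\<close>

definition valring :: "chartwo set" where
  "valring = {b + tau * fps_to_fls p | b p. b = 0 \<or> b = 1}"

lemma is_subring_valring: "is_subring valring"
  unfolding is_subring_def
proof (intro conjI ballI)
  show "1 \<in> valring"
    unfolding valring_def by (intro CollectI exI [of _ 1] exI [of _ 0]) simp
  show "- x \<in> valring" if "x \<in> valring" for x using that by (simp only: uminus_char_two)
  fix x y assume "x \<in> valring" "y \<in> valring"
  then obtain b p b' p' where x: "x = b + tau * fps_to_fls p" "b = 0 \<or> b = 1"
    and y: "y = b' + tau * fps_to_fls p'" "b' = 0 \<or> b' = 1" by (auto simp: valring_def)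
  have "x + y = (b + b') + tau * fps_to_fls (p + p')"
    by (simp add: x(1) y(1) algebra_simps)
  moreover have "b + b' = 0 \<or> b + b' = 1" using x y char_two [of 1] by auto
  ultimately show "x + y \<in> valring" unfolding valring_def by blast
  obtain q where q: "fps_to_fls q = b" using x(2) by (metis fps_one_to_fls fps_zero_to_fls)
  obtain q' where q': "fps_to_fls q' = b'" using y(2) by (metis fps_one_to_fls fps_zero_to_fls)
  have "x * y = b * b' + tau * fps_to_fls (q * p' + p * q' + fps_X * p * p')"
    by (simp add: x(1) y(1) q [symmetric] q' [symmetric] fls_times_fps_to_fls algebra_simps tau_def)
  moreover have "b * b' = 0 \<or> b * b' = 1" using x y by auto
  ultimately show "x * y \<in> valring" unfolding valring_def by blast
qed

lemma tau_const_valring: "tau * fls_const \<beta> \<in> valring"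
  unfolding valring_def
  by (intro CollectI exI [of _ 0] exI [of _ "fps_const \<beta>"]) (simp add: fps_const_to_fls)

text \<open>There is no positive power of \<open>tau\<close> to hide behind: the constant term in
  \<open>tau\<close> is itself a nonconstant Laurent polynomial, as \<open>k\<close> and
  \<open>- k\<close> differ.\<close>

lemma Q_sum_notin_valring:
  assumes "k \<noteq> 0"
  shows "Q k + Q (- k) \<notin> valring"
proof
  assume "Q k + Q (- k) \<in> valring"
  then obtain b p where bp: "Q k + Q (- k) = b + tau * fps_to_fls p" "b = 0 \<or> b = 1" by (auto simp: valring_def)
  have "fls_nth (tau * fps_to_fls p) 0 = 0" by (simp add: tau_def fls_X_times_conv_shift)
  then have "fls_nth (Q k + Q (- k)) 0 = fls_nth b 0" by (simp add: bp(1))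
  then have "fls_nth (fls_nth b 0) k = 1" using Q_sum_coeff [OF assms] by simp
  then show False using bp(2) assms by auto
qed

definition diag :: "int \<Rightarrow> chartwo mat2" where "diag k = Mat2 (Q k) 0 0 (Q (- k))"

lemma det2_diag: "det2 (diag k) = 1"
  by (simp add: diag_def flip: Q_add)

lemma mv_diag_mult: "mv (diag j) (mv (diag k) x) = mv (diag (j + k)) x"
proof -
  have "- (j + k) = - j + - k" by simp
  then show ?thesis by (cases x) (simp only: diag_def mv.simps Q_add mult.assoc mult_zero_left add_0 add_0_right)
qed

lemma mv_diag_Q: "mv (diag d) (Q x, tau * Q (- x)) = (Q (d + x), tau * Q (- (d + x)))"
proof -
  have "- (d + x) = - d + - x" by simp
  then show ?thesis
    by (simp only: diag_def mv.simps Q_add mult_zero_left add_0 add_0_right mult.left_commute)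
qed

lemma tr_diag: "tr (diag k) = Q k + Q (- k)"
  by (simp add: diag_def)

text \<open>Vectors whose second coordinate alone carries a factor \<open>tau\<close>. Diagonal
  matrices preserve the shape, and the determinant of two such vectors is a multiple of
  \<open>tau\<close>, which makes plain arcs small.\<close>

definition form :: "(chartwo \<times> chartwo) set" where
  "form = {(fls_const \<alpha>, tau * fls_const \<beta>) | \<alpha> \<beta>. True}"

lemma form_diag: "X \<in> form \<Longrightarrow> mv (diag k) X \<in> form"
proof -
  assume "X \<in> form"
  then obtain \<alpha> \<beta> where "X = (fls_const \<alpha>, tau * fls_const \<beta>)" by (auto simp: form_def)
  then have "mv (diag k) X = (fls_const (fls_X_intpow k * \<alpha>), tau * fls_const (fls_X_intpow (- k) * \<beta>))"
    by (simp add: diag_def Q_def algebra_simps flip: fls_const_mult_const)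
  then show ?thesis unfolding form_def by blast
qed

lemma form_dt: "X \<in> form \<Longrightarrow> Y \<in> form \<Longrightarrow> dt X Y \<in> valring"
proof -
  assume "X \<in> form" "Y \<in> form"
  then obtain \<alpha> \<beta> \<alpha>' \<beta>' where "X = (fls_const \<alpha>, tau * fls_const \<beta>)" "Y = (fls_const \<alpha>', tau * fls_const \<beta>')"
    by (auto simp: form_def)
  then have "dt X Y = tau * (fls_const \<alpha> * fls_const \<beta>' - fls_const \<beta> * fls_const \<alpha>')"
    by (simp add: algebra_simps)
  also have "\<dots> = tau * fls_const (\<alpha> * \<beta>' - \<beta> * \<alpha>')"
    by (simp only: fls_const_mult_const fls_minus_const)
  finally show ?thesis using tau_const_valring by simp
qed

lemma ev_inverse_var:
  fixes x :: "nat \<Rightarrow> 'a::field"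
  assumes "e < m" "x e \<noteq> 0"
  shows "inverse (x e) * (\<Prod>j<m. x j) = ev x (pmon (\<lambda>j. if j = e then 0 else 1) m)"
proof -
  have "(\<Prod>j<m. x j) = x e * prod x ({..<m} - {e})" using assms by (intro prod.remove) auto
  moreover have "(\<Prod>j<m. x j ^ (if j = e then 0 else 1)) = x e ^ 0 * prod x ({..<m} - {e})"
    using assms by (subst prod.remove [of _ e]) (auto intro!: prod.cong)
  ultimately show ?thesis using assms by simp
qed

text \<open>The specialisation is the lambda length function of the degenerate structure on the closed
  surface whose holonomy is the diagonal representation of the cocycle \<open>h\<close>; its horocycle
  lengths vanish, so all notched arcs are killed.\<close>

locale specialisation = holonomy +
  fixes F m lab pun w lam uu kap S h
  assumes plain: "plain F m lab pun w lam uu kap S" and h: "cocycle F lab h"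
    and h_nz: "\<And>t s. t < F \<Longrightarrow> s < 3 \<Longrightarrow> h t s \<noteq> 0"
begin

lemma geom: "geom F m lab pun w lam uu kap" and seedrel: "seedrel F m lab lam S"
  and no_sf: "\<not> sf F lab e j" and indep: "indep (fst S)"
  using plain by (auto simp: plain_def)

lemmas comb = geomD(1) [OF geom]
lemmas surf = combD(1) [OF comb]

abbreviation "y \<equiv> fst S"

lemma y_nz: "j < m \<Longrightarrow> y j \<noteq> 0"
  using seedrel posr_neq_0 by (auto simp: seedrel_def)

lemma lam_y: "e < m \<Longrightarrow> lam e = y e"
proof -
  assume e: "e < m"
  then have "lam e = (\<Prod>j<m. y j ^ EE F lab e j)" using seedrel by (simp add: seedrel_def)
  also have "\<dots> = (\<Prod>j<m. if j = e then y j else 1)"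
    by (rule prod.cong) (auto simp: EE_def no_sf)
  finally show ?thesis using e by simp
qed

text \<open>The value 1 beyond \<open>m\<close> meets the requirement of \<open>indep\<close> that a
  specialisation vanish nowhere.\<close>

definition a :: "nat \<Rightarrow> chartwo" where
  "a e = (if e < m then arc (SOME k. \<exists>t<F. \<exists>s<3. lab t s = e \<and> k = h t s) else 1)"

lemma a_lab: "t < F \<Longrightarrow> s < 3 \<Longrightarrow> a (lab t s) = arc (h t s)"
proof -
  assume t: "t < F" "s < 3"
  have "\<exists>t'<F. \<exists>s'<3. lab t' s' = lab t s \<and> (SOME k. \<exists>t'<F. \<exists>s'<3. lab t' s' = lab t s \<and> k = h t' s') = h t' s'"
    by (rule someI [where P = "\<lambda>k. \<exists>t'<F. \<exists>s'<3. lab t' s' = lab t s \<and> k = h t' s'", of "h t s"])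
      (use t in blast)
  then obtain t' s' where t': "t' < F" "s' < 3" "lab t' s' = lab t s" "a (lab t s) = arc (h t' s')"
    using surf_lab [OF surf t] by (auto simp: a_def)
  show ?thesis
  proof (cases "(t', s') = (t, s)")
    case False
    then have "gl F lab t' s' t s" using t t' by (simp add: gl_def)
    then show ?thesis using cocycle_anti [OF h] t'(4) arc_minus by fastforce
  qed (use t' in auto)
qed

lemma a_nz: "a e \<noteq> 0"
proof (cases "e < m")
  case True
  then obtain t s where "t < F" "s < 3" "lab t s = e" using surf_side [OF surf] by blast
  then show ?thesis using a_lab [of t s] arc_nz h_nz by auto
qed (simp add: a_def)

text \<open>Graph of the specialisation of Laurent polynomials in the cluster \<open>y\<close>, with
  a power of the product of all variables as denominator. That it is single-valued is the content of
  \<open>indep\<close>, see \<open>Psi_unique\<close>.\<close>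

definition Psi :: "ratfun \<Rightarrow> chartwo \<Rightarrow> bool" where
  "Psi f z \<longleftrightarrow> (\<exists>e d. f * (\<Prod>j<m. y j) ^ d = ev y e \<and> z * (\<Prod>j<m. a j) ^ d = ev a e)"

lemma ev_den: "ev x (pmon (\<lambda>_. d) m) = (\<Prod>j<m. x j) ^ d"
  by (simp add: prod_power_distrib)

lemma Psi_add: "Psi f z \<Longrightarrow> Psi f' z' \<Longrightarrow> Psi (f + f') (z + z')"
proof -
  assume "Psi f z" "Psi f' z'"
  then obtain e d e' d' where e: "f * (\<Prod>j<m. y j) ^ d = ev y e" "z * (\<Prod>j<m. a j) ^ d = ev a e"
    "f' * (\<Prod>j<m. y j) ^ d' = ev y e'" "z' * (\<Prod>j<m. a j) ^ d' = ev a e'" unfolding Psi_def by blast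
  let ?e = "PA (PM e (pmon (\<lambda>_. d') m)) (PM e' (pmon (\<lambda>_. d) m))"
  have "(f + f') * (\<Prod>j<m. y j) ^ (d + d') = ev y ?e" "(z + z') * (\<Prod>j<m. a j) ^ (d + d') = ev a ?e"
    unfolding ev.simps ev_den e [symmetric] by (simp_all add: algebra_simps power_add)
  then show ?thesis unfolding Psi_def by blast
qed

lemma Psi_mult: "Psi f z \<Longrightarrow> Psi f' z' \<Longrightarrow> Psi (f * f') (z * z')"
proof -
  assume "Psi f z" "Psi f' z'"
  then obtain e d e' d' where e: "f * (\<Prod>j<m. y j) ^ d = ev y e" "z * (\<Prod>j<m. a j) ^ d = ev a e"
    "f' * (\<Prod>j<m. y j) ^ d' = ev y e'" "z' * (\<Prod>j<m. a j) ^ d' = ev a e'" unfolding Psi_def by blast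
  have "(f * f') * (\<Prod>j<m. y j) ^ (d + d') = ev y (PM e e')" "(z * z') * (\<Prod>j<m. a j) ^ (d + d') = ev a (PM e e')"
    unfolding ev.simps e [symmetric] by (simp_all add: algebra_simps power_add)
  then show ?thesis unfolding Psi_def by blast
qed

lemma Psi_int: "Psi (of_int i) (of_int i)"
  unfolding Psi_def by (intro exI [of _ "PC i"] exI [of _ 0]) simp

lemma Psi_0: "Psi 0 0" and Psi_1: "Psi 1 1"
  using Psi_int [of 0] Psi_int [of 1] by auto

lemma Psi_uminus: "Psi f z \<Longrightarrow> Psi (- f) (- z)"
  using Psi_mult [OF Psi_int [of "- 1"], of f z] by simp

lemma Psi_diff: "Psi f z \<Longrightarrow> Psi f' z' \<Longrightarrow> Psi (f - f') (z - z')"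
  using Psi_add [OF _ Psi_uminus, of f z f' z'] by simp

lemma Psi_var: "e < m \<Longrightarrow> Psi (y e) (a e)"
  unfolding Psi_def by (intro exI [of _ "PV e"] exI [of _ 0]) simp

lemma Psi_inverse_var: "e < m \<Longrightarrow> Psi (inverse (y e)) (inverse (a e))"
  using ev_inverse_var [of e m y] ev_inverse_var [of e m a] y_nz a_nz unfolding Psi_def
  by (intro exI [of _ "pmon (\<lambda>j. if j = e then 0 else 1) m"] exI [of _ 1]) simp

lemma Psi_unique:
  assumes "Psi f z" "Psi f z'"
  shows "z = z'"
proof -
  have "Psi 0 (z - z')" using Psi_diff [OF assms] by simp
  then obtain e d where e: "0 = ev y e" "(z - z') * (\<Prod>j<m. a j) ^ d = ev a e"
    unfolding Psi_def by auto
  then have "ev a e = 0" using indep a_nz unfolding indep_def by metis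
  then show ?thesis using e a_nz by simp
qed

lemma Psi_lam: "e < m \<Longrightarrow> Psi (lam e) (a e)" "e < m \<Longrightarrow> Psi (inverse (lam e)) (inverse (a e))"
  by (simp_all add: lam_y Psi_var Psi_inverse_var)

lemma Psi_sum: "(\<And>i. i \<in> I \<Longrightarrow> Psi (f i) (z i)) \<Longrightarrow> Psi (sum f I) (sum z I)"
  by (induction I rule: infinite_finite_induct) (auto simp: Psi_0 Psi_add)

section \<open>The degenerate developing map and its comparison with \<open>w\<close>\<close>

definition H :: "nat \<Rightarrow> nat \<Rightarrow> int" where
  "H t s = (if s = 0 then 0 else if s = 1 then h t 0 else h t 0 + h t 1)"

lemma H_nx: "t < F \<Longrightarrow> s < 3 \<Longrightarrow> H t (nx s) = H t s + h t s"
proof -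
  assume t: "t < F" "s < 3"
  then have "s = 0 \<or> s = 1 \<or> s = 2" by auto
  moreover have "h t 0 + (h t 1 + h t 2) = 0" using cocycle_sum' [OF h t(1), of 0] by (simp add: nx_values)
  ultimately show ?thesis by (auto simp: H_def nx_values)
qed

text \<open>Corner vectors of the degenerate structure. Since \<open>H\<close> integrates
  \<open>h\<close> around the triangle, neighbouring corners have determinant
  \<open>arc (h t s)\<close>, up to a sign that is invisible in characteristic two.\<close>

definition W :: "nat \<Rightarrow> nat \<Rightarrow> chartwo \<times> chartwo" where
  "W t s = (Q (H t s), tau * Q (- H t s))"

lemma W_dt: "t < F \<Longrightarrow> s < 3 \<Longrightarrow> dt (W t s) (W t (nx s)) = a (lab t s)"
proof -
  assume t: "t < F" "s < 3"
  have "dt (W t s) (W t (nx s)) = tau * (Q (H t s) * Q (- (H t s + h t s)) - Q (- H t s) * Q (H t s + h t s))"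
    unfolding W_def H_nx [OF t] dt.simps by (simp only: right_diff_distrib mult.left_commute mult.assoc)
  also have "\<dots> = tau * (Q (- h t s) - Q (h t s))" by (simp flip: Q_add)
  also have "\<dots> = arc (h t s)" by (simp only: arc_def diff_char_two add.commute)
  finally show ?thesis using a_lab [OF t] by simp
qed

lemma W_form: "W t s \<in> form"
  unfolding W_def form_def Q_def by blast

text \<open>With \<open>UNIV\<close> as coefficient ring integrality is vacuous; the expansion
  formulas are wanted, in identical shape for both fields.\<close>

sublocale R: integrality F m lab w lam UNIV
  using surf geomD(2,3) [OF geom] posr_neq_0 by unfold_locales (auto simp: is_subring_def)

sublocale K: integrality F m lab W a UNIV
  using surf W_dt a_nz by unfold_locales (auto simp: is_subring_def)

text \<open>The coordinates of \<open>x\<close> need not be Laurent polynomials in \<open>y\<close>,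
  so vectors are compared through their pairings with corners.\<close>

definition rep :: "nat \<Rightarrow> ratfun \<times> ratfun \<Rightarrow> chartwo \<times> chartwo \<Rightarrow> bool" where
  "rep t x X \<longleftrightarrow> (\<forall>s<3. Psi (dt x (w t s)) (dt X (W t s)))"

lemma repI:
  assumes t: "t < F" "s < 3" and "Psi (dt x (w t s)) (dt X (W t s))" "Psi (dt x (w t (nx s))) (dt X (W t (nx s)))"
  shows "rep t x X"
proof -
  have "Psi (dt x (w t (nx (nx s)))) (dt X (W t (nx (nx s))))"
    unfolding R.third [OF t] K.third [OF t]
    using assms surf_lab [OF surf] by (intro Psi_mult Psi_uminus Psi_add Psi_lam) auto
  then show ?thesis using assms less3_cases [OF t(2)] by (auto simp: rep_def)
qed

lemma rep_dt: "t < F \<Longrightarrow> rep t x X \<Longrightarrow> rep t x' X' \<Longrightarrow> Psi (dt x x') (dt X X')"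
  unfolding R.dt_formula [of t x x'] K.dt_formula [of t X X'] rep_def
  using surf_lab [OF surf] by (intro Psi_mult Psi_diff Psi_lam) auto

lemma rep_corner: "t < F \<Longrightarrow> s < 3 \<Longrightarrow> rep t (w t s) (W t s)"
  using Psi_0 Psi_lam(1) surf_lab [OF surf] geomD(2) [OF geom] W_dt
  by (intro repI [of t s]) simp_all

text \<open>The degenerate gluing matrix is diagonal: by the cocycle property the same difference of
  \<open>H\<close> matches both ends of the side, and the sign in \<open>hop\<close> is lost in
  characteristic two.\<close>

lemma rep_hop:
  assumes "hop F lab w t s t' s' B" "rep t' x X"
  shows "rep t (mv B x) (mv (diag (H t s - H t' (nx s'))) X)"
proof (rule repI [of t s])
  let ?D = "diag (H t s - H t' (nx s'))"
  have g: "gl F lab t s t' s'" and B: "mv B (w t' (nx s')) = w t s" "mv B (w t' s') = - w t (nx s)" "det2 B = 1"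
    using assms(1) by (auto simp: hop_def)
  show b: "t < F" "s < 3" using g by (auto simp: gl_def)
  have b': "t' < F" "s' < 3" using g by (auto simp: gl_def)
  have "mv ?D (W t' (nx s')) = W t s" unfolding W_def mv_diag_Q by simp
  moreover have "H t s - H t' (nx s') + H t' s' = H t (nx s)"
    using H_nx [OF b] H_nx [OF b'] cocycle_anti [OF h g] by simp
  then have "mv ?D (W t' s') = W t (nx s)"
    unfolding W_def mv_diag_Q by simp
  ultimately have K: "dt (mv ?D X) (W t s) = dt X (W t' (nx s'))" "dt (mv ?D X) (W t (nx s)) = dt X (W t' s')"
    using dt_mv [of ?D X "W t' (nx s')"] dt_mv [of ?D X "W t' s'"] by (simp_all add: det2_diag)
  have "dt (mv B x) (w t s) = dt x (w t' (nx s'))" "- dt (mv B x) (w t (nx s)) = dt x (w t' s')"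
    using dt_mv [of B x "w t' (nx s')"] dt_mv [of B x "w t' s'"] by (simp_all add: B)
  then have "dt (mv B x) (w t s) = dt x (w t' (nx s'))" "dt (mv B x) (w t (nx s)) = - dt x (w t' s')"
    by (simp, metis minus_minus)
  moreover have "Psi (dt x (w t' (nx s'))) (dt X (W t' (nx s')))" "Psi (- dt x (w t' s')) (- dt X (W t' s'))"
    using assms(2) b' Psi_uminus by (auto simp: rep_def)
  ultimately show "Psi (dt (mv B x) (w t s)) (dt (mv ?D X) (W t s))"
    "Psi (dt (mv B x) (w t (nx s))) (dt (mv ?D X) (W t (nx s)))"
    by (simp_all only: K uminus_char_two)
qed

definition acts :: "nat \<Rightarrow> ratfun mat2 \<Rightarrow> nat \<Rightarrow> int \<Rightarrow> bool" where
  "acts t A t' k \<longleftrightarrow> (\<forall>x X. rep t' x X \<longrightarrow> rep t (mv A x) (mv (diag k) X))"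

lemma actsD: "acts t A t' k \<Longrightarrow> rep t' x X \<Longrightarrow> rep t (mv A x) (mv (diag k) X)"
  unfolding acts_def by blast

lemma acts_trans: "acts t A t' j \<Longrightarrow> acts t' B t'' k \<Longrightarrow> acts t (A * B) t'' (j + k)"
  unfolding acts_def mv_mult mv_diag_mult [symmetric] by blast

lemma acts_hop: "hop F lab w t s t' s' B \<Longrightarrow> acts t B t' (H t s - H t' (nx s'))"
  unfolding acts_def using rep_hop by blast

lemma acts_gp: "gp F lab w t A t' \<Longrightarrow> \<exists>k. acts t A t' k"
proof (induction rule: gp.induct)
  case (base t)
  have "acts t 1 t 0" unfolding acts_def diag_def by (auto simp: one_mat2_def [symmetric])
  then show ?case ..
next
  case (step t A t' s t'' s'' B)
  then show ?case using acts_trans acts_hop by blast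
qed

lemma Psi_tr: "t < F \<Longrightarrow> acts t A t k \<Longrightarrow> Psi (tr A) (Q k + Q (- k))"
  unfolding R.tr_formula [of t A] tr_diag [symmetric] K.tr_formula [of t "diag k"]
  using surf_lab [OF surf] by (intro Psi_mult Psi_add Psi_lam rep_dt [of t] actsD [of t A t] rep_corner) auto

text \<open>Each corner contribution splits into two terms \<open>T\<close>, one for each adjacent
  side. Gluing identifies the sum of the first terms with the sum of the second, so the total is
  twice a number.\<close>

lemma a_horo: "horo F lab pun a i = 0"
proof -
  define T where "T x = Q x / arc x" for x
  \<comment> \<open>In the expansion the mixed term \<open>Q (x - y)\<close> occurs twice and
    cancels.\<close>
  have corner: "arc (- x - y) / (arc x * arc y) = T x + T (- y)" if "x \<noteq> 0" "y \<noteq> 0" for x y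
  proof -
    have "Q x * arc y + Q (- y) * arc x = tau * (Q (x + y) + Q (x - y) + Q (x - y) + Q (- x - y))"
      by (simp add: arc_def algebra_simps flip: Q_add)
    also have "\<dots> = tau * (Q (x + y) + (Q (x - y) + Q (x - y)) + Q (- x - y))" by (simp only: add.assoc)
    also have "\<dots> = arc (- x - y)" by (simp add: char_two arc_def add.commute)
    finally have "arc (- x - y) = Q x * arc y + Q (- y) * arc x" ..
    then show ?thesis using arc_nz [OF that(1)] arc_nz [OF that(2)] by (simp add: T_def arc_minus field_simps)
  qed
  have summand: "(if pun t s = i then a (lab t (nx s)) / (a (lab t s) * a (lab t (nx (nx s)))) else 0) =
      (if pun t s = i then T (h t s) else 0) + (if pun t s = i then T (- h t (nx (nx s))) else 0)"
    if t: "t < F" "s < 3" for t s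
  proof -
    have "h t (nx s) = - h t s - h t (nx (nx s))" using cocycle_sum' [OF h t] by simp
    then show ?thesis using corner [of "h t s" "h t (nx (nx s))"] t h_nz by (simp add: a_lab)
  qed
  have rot: "(\<Sum>s<3. f (nx s)) = (\<Sum>s<3. f s)" for f :: "nat \<Rightarrow> chartwo"
    using sum_less3 [of 0 f] sum_less3 [of 0 "\<lambda>s. f (nx s)"] by (simp add: nx_values algebra_simps)
  have "(\<Sum>s<3. if pun t s = i then T (- h t (nx (nx s))) else 0) = (\<Sum>s<3. if pun t (nx s) = i then T (- h t s) else 0)" for t
  proof -
    have "(\<Sum>s<3. if pun t (nx s) = i then T (- h t s) else 0) =
      (\<Sum>s<3. (if pun t (nx (nx (nx s))) = i then T (- h t (nx (nx s))) else 0))"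
      using rot [of "\<lambda>s. if pun t (nx s) = i then T (- h t s) else 0"]
        rot [of "\<lambda>s. if pun t (nx (nx s)) = i then T (- h t (nx s)) else 0"] by simp
    also have "\<dots> = (\<Sum>s<3. if pun t s = i then T (- h t (nx (nx s))) else 0)"
      by (intro sum.cong refl) simp
    finally show ?thesis ..
  qed
  then have "(\<Sum>t<F. \<Sum>s<3. if pun t s = i then T (- h t (nx (nx s))) else 0) =
      (\<Sum>t<F. \<Sum>s<3. if pun t (nx s) = i then T (- h t s) else 0)" by simp
  also have "\<dots> = (\<Sum>t<F. \<Sum>s<3. if pun t s = i then T (h t s) else 0)"
  proof (rule sum_mate [OF surf])
    fix t s t' s' assume g: "gl F lab t s t' s'"
    show "(if pun t (nx s) = i then T (- h t s) else 0) = (if pun t' s' = i then T (h t' s') else 0)"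
      using cocycle_anti [OF h g] combD(2) [OF comb gl_sym [OF g]] by simp
  qed
  finally have eq: "(\<Sum>t<F. \<Sum>s<3. if pun t s = i then T (- h t (nx (nx s))) else 0) =
      (\<Sum>t<F. \<Sum>s<3. if pun t s = i then T (h t s) else 0)" .
  have "horo F lab pun a i = (\<Sum>t<F. \<Sum>s<3. (if pun t s = i then T (h t s) else 0) +
      (if pun t s = i then T (- h t (nx (nx s))) else 0))"
    unfolding horo_def by (intro sum.cong refl summand) auto
  also have "\<dots> = (\<Sum>t<F. \<Sum>s<3. if pun t s = i then T (h t s) else 0) +
      (\<Sum>t<F. \<Sum>s<3. if pun t s = i then T (- h t (nx (nx s))) else 0)"
    by (simp only: sum.distrib)
  also have "\<dots> = 0" unfolding eq by (rule char_two)
  finally show ?thesis .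
qed

lemma Psi_kap: "i < n \<Longrightarrow> Psi (kap i) 0"
proof -
  assume i: "i < n"
  have "Psi (horo F lab pun lam i) (horo F lab pun a i)"
    unfolding horo_def divide_inverse inverse_mult_distrib
    using surf_lab [OF surf] by (auto intro!: Psi_sum Psi_mult Psi_lam simp: Psi_0)
  then show ?thesis using geomD(7) [OF geom i] a_horo by simp
qed

text \<open>A puncture vector of the current tagging lies in the orbit of a corner vector; the
  oppositely tagged one carries the factor \<open>kap i\<close>, which specialises to 0, and is
  represented by the zero vector.\<close>

lemma punc_rep:
  assumes "x \<in> punc"
  shows "\<exists>X\<in>form. rep 0 x X"
proof -
  note F0 = F_pos [OF geom]
  have uu: "\<exists>X\<in>form. rep 0 (uu i) X" if i: "i < n" for i
  proof -
    obtain A t s where A: "gp F lab w 0 A t" "t < F" "s < 3" "uu i = mv A (w t s)"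
      using uu_gp [OF geom i F0] by metis
    obtain k where "acts 0 A t k" using acts_gp [OF A(1)] by blast
    then have "rep 0 (uu i) (mv (diag k) (W t s))" unfolding A(4) by (rule actsD [OF _ rep_corner [OF A(2,3)]])
    then show ?thesis using form_diag [OF W_form] by blast
  qed
  show ?thesis
  proof (rule punc_cases [OF geomD(6) [OF geom] assms])
    fix i assume i: "i < n" "x = sv (kap i) (uu i)"
    obtain X where X: "rep 0 (uu i) X" using uu [OF i(1)] by blast
    have "rep 0 x (0, 0)"
      unfolding rep_def
    proof (intro allI impI)
      fix s :: nat assume "s < 3"
      then have "Psi (kap i * dt (uu i) (w 0 s)) (0 * dt X (W 0 s))"
        using X Psi_kap [OF i(1)] by (intro Psi_mult) (auto simp: rep_def)
      then show "Psi (dt x (w 0 s)) (dt (0, 0) (W 0 s))" by (cases "W 0 s") (simp add: i(2) dt_sv_left)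
    qed
    moreover have "(0, 0) \<in> form" unfolding form_def by (intro CollectI exI [of _ 0]) simp
    ultimately show ?thesis by blast
  qed (use uu in auto)
qed

lemma arc_value:
  assumes "A \<in> G" "x \<in> punc" "x' \<in> punc"
  shows "\<exists>z\<in>valring. Psi (dt (mv A x) x') z"
proof -
  note F0 = F_pos [OF geom]
  obtain X X' where X: "X \<in> form" "rep 0 x X" "X' \<in> form" "rep 0 x' X'" using punc_rep assms by metis
  obtain k where "acts 0 A 0 k" using acts_gp [OF geomD(5) [OF geom assms(1) F0 F0]] by blast
  then have "rep 0 (mv A x) (mv (diag k) X)" using X unfolding acts_def by blast
  then show ?thesis using rep_dt [OF F0 _ X(4)] form_dt [OF form_diag [OF X(1)] X(3)] by blast
qed

lemma cluster_algebra_value: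
  assumes "good F m (var, B)" "f \<in> cluster_algebra m B"
  shows "\<exists>z\<in>valring. Psi f z"
  using assms(2) unfolding cluster_algebra_def
proof (induction rule: subring_gen.induct)
  case (gen x)
  then obtain S i where S: "x = fst S i" "S \<in> seeds m B" "i < m" by auto
  then obtain A v v' where "A \<in> G" "v \<in> punc" "v' \<in> punc" "x = dt (mv A v) v'"
    using good_arc [OF good_seeds [OF _ assms(1)]] by blast
  then show ?case using arc_value by blast
next
  case one
  then show ?case using Psi_1 is_subringD(1) [OF is_subring_valring] by blast
next
  case (neg x)
  then show ?case using Psi_uminus is_subringD(3) [OF is_subring_valring] by blast
next
  case (add x y)
  then show ?case using Psi_add is_subringD(4) [OF is_subring_valring] by blast
next
  case (mult x y)
  then show ?case using Psi_mult is_subringD(5) [OF is_subring_valring] by blast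
qed

text \<open>If every group element had period 0, the periods from triangle 0 would be well defined
  and add up with \<open>H\<close> to a potential on the punctures whose differences are
  \<open>h\<close>.\<close>

lemma trace_value:
  assumes "\<And>P. (\<And>t s t' s'. gl F lab t s t' s' \<Longrightarrow> P t s = P t' (nx s')) \<Longrightarrow>
    \<exists>t<F. \<exists>s<3. h t s \<noteq> P t (nx s) - P t s"
  shows "\<exists>A\<in>G. \<exists>k. k \<noteq> 0 \<and> Psi (tr A) (Q k + Q (- k))"
proof (rule ccontr)
  note F0 = F_pos [OF geom]
  assume no: "\<not> ?thesis"
  have zero: "k = 0" if "A \<in> G" "acts 0 A 0 k" for A k
    using no Psi_tr [OF F0 that(2)] that(1) by blast
  have "\<exists>k. acts 0 1 t k" "\<exists>k. acts t 1 0 k" if "t < F" for t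
    using acts_gp geomD(5) [OF geom G_one] F0 that by blast+
  then obtain f f' where f: "\<And>t. t < F \<Longrightarrow> acts 0 1 t (f t)" "\<And>t. t < F \<Longrightarrow> acts t 1 0 (f' t)" by metis
  have f': "f' t = - f t" if "t < F" for t
    using zero [OF G_one] acts_trans [OF f(1) [OF that] f(2) [OF that]] by force
  define P where "P t s = H t s + f t" for t s
  have "P t s = P t' (nx s')" if g: "gl F lab t s t' s'" for t s t' s'
  proof -
    obtain B where B: "B \<in> G" "hop F lab w t s t' s' B" using geomD(4) [OF geom g] by blast
    have b: "t < F" "t' < F" using g by (auto simp: gl_def)
    have "acts 0 (1 * B * 1) 0 (f t + (H t s - H t' (nx s')) + f' t')"
      by (rule acts_trans [OF acts_trans [OF f(1) [OF b(1)] acts_hop [OF B(2)]] f(2) [OF b(2)]])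
    then have "f t + (H t s - H t' (nx s')) + f' t' = 0" using zero [OF B(1)] by simp
    then show ?thesis using f' [OF b(2)] by (simp add: P_def)
  qed
  then obtain t s where "t < F" "s < 3" "h t s \<noteq> P t (nx s) - P t s" using assms by blast
  then show False using H_nx by (simp add: P_def)
qed

end

context holonomy
begin

text \<open>A trace of nonzero period \<open>k\<close> specialises to \<open>Q k + Q (- k)\<close>,
  outside the ring \<open>valring\<close> that contains the values of the cluster algebra;
  single-valuedness of \<open>Psi\<close> makes this a contradiction.\<close>

lemma skein_not_subset_cluster_algebra:
  assumes g: "good F m (var, B)" and p: "plain F m lab pun w lam uu kap S"
    and F: "0 < F" "0 < n" "F + n < m + 2"
  shows "\<not> skein \<subseteq> cluster_algebra m B"
proof
  assume sub: "skein \<subseteq> cluster_algebra m B"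
  obtain lab pun w lam S where p: "plain F m lab pun w lam uu kap S" and nn: "\<forall>e<m. \<not> null F lab e"
    using plain_nonnull [OF p F] by metis
  have geom: "geom F m lab pun w lam uu kap" using p by (simp add: plain_def)
  note surf = combD(1) [OF geomD(1) [OF geom]]
  obtain h0 where h0: "cocycle F lab h0" "ip F h0 h0 \<noteq> 0"
    "\<And>P. (\<And>t s t' s'. gl F lab t s t' s' \<Longrightarrow> P t s = P t' (nx s')) \<Longrightarrow> ip F h0 (\<lambda>t s. P t (nx s) - P t s) = 0"
    using harmonic_cocycle [OF geomD(1) [OF geom] F] by blast
  \<comment> \<open>Avoiding the zeros of the evaluations makes every arc invertible; avoiding those
    of the pairing with \<open>h0\<close> keeps \<open>h\<close> from being a coboundary.\<close>
  define Phi where "Phi = insert (ip F h0) ((\<lambda>(t, s) h. h t s) ` ({..<F} \<times> {..<3}))"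
  have "\<exists>h. cocycle F lab h \<and> (\<forall>f\<in>Phi. f h \<noteq> 0)"
  proof (rule generic_cocycle)
    show "finite Phi" by (simp add: Phi_def)
    show "f (\<lambda>t s. h t s + N * h' t s) = f h + N * f h'" if "f \<in> Phi" for f h h' N
      using that by (auto simp: Phi_def ip_def sum.distrib sum_distrib_left algebra_simps)
    show "\<exists>h. cocycle F lab h \<and> f h \<noteq> 0" if f: "f \<in> Phi" for f
    proof (cases "f = ip F h0")
      case False
      then obtain t s where t: "f = (\<lambda>h. h t s)" "t < F" "s < 3" using f by (auto simp: Phi_def)
      then have "\<not> null F lab (lab t s)" using nn surf_lab [OF surf] by blast
      then obtain h x i where h: "cocycle F lab h" "x < F" "i < 3" "lab x i = lab t s" "h x i \<noteq> 0"
        unfolding null_def by blast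
      have "h t s \<noteq> 0"
      proof (cases "(x, i) = (t, s)")
        case False
        then have "gl F lab x i t s" using h t by (simp add: gl_def)
        then show ?thesis using cocycle_anti [OF h(1)] h(5) by simp
      qed (use h in auto)
      then show ?thesis using h t by blast
    qed (use h0 in blast)
  qed
  then obtain h where hh: "cocycle F lab h" "ip F h0 h \<noteq> 0" "\<And>t s. t < F \<Longrightarrow> s < 3 \<Longrightarrow> h t s \<noteq> 0"
    by (auto simp: Phi_def)
  interpret specialisation G n u c F m lab pun w lam uu kap S h
    using p hh by (simp add: specialisation_def specialisation_axioms_def holonomy_axioms)
  have "\<exists>t<F. \<exists>s<3. h t s \<noteq> P t (nx s) - P t s"
    if "\<And>t s t' s'. gl F lab t s t' s' \<Longrightarrow> P t s = P t' (nx s')" for P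
  proof (rule ccontr)
    assume "\<not> ?thesis"
    then have "ip F h0 h = ip F h0 (\<lambda>t s. P t (nx s) - P t s)"
      unfolding ip_def by (intro sum.cong refl) auto
    then show False using h0(3) [of P] that hh(2) by simp
  qed
  then obtain A k where A: "A \<in> G" "k \<noteq> 0" "Psi (tr A) (Q k + Q (- k))"
    using trace_value by blast
  have "tr A \<in> skein"
    unfolding skein_def inv_gens_def using A(1) by (intro subring_gen.gen) blast
  then obtain z where "z \<in> valring" "Psi (tr A) z" using cluster_algebra_value [OF g] sub by blast
  then show False using Psi_unique [OF A(3)] Q_sum_notin_valring [OF A(2)] by blast
qed

end

lemma (in triangulation) positive_genus_neq:
  assumes "g \<ge> 1"
  shows "cluster_algebra m (exch_matrix F lab) \<noteq> upper_cluster_algebra m (exch_matrix F lab)"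
proof -
  have "int n - int m + int F = 2 - 2 * int g" using tri by (simp add: is_triangulation_def)
  \<comment> \<open>Positive genus enters through this count.\<close>
  then have "F + n < m + 2" using assms by linarith
  moreover have "plain F m lab pun w var u c (var, exch_matrix F lab)"
    unfolding plain_def using geom_init seedrel_init no_sf indep_var by simp
  ultimately have "\<not> skein \<subseteq> cluster_algebra m (exch_matrix F lab)"
    using skein_not_subset_cluster_algebra [OF good_init] F_pos n by simp
  then show ?thesis using skein_between by blast
qed

theorem theoremE:
  shows "(\<forall>g n F m lab.
            n \<ge> 1 \<and> 2 - 2 * int g - int n < 0 \<and> (g, n) \<noteq> (0, 3) \<and>
            is_triangulation g n F m lab \<and>
            \<not> finitely_generated_ring (cluster_algebra m (exch_matrix F lab))
            \<longrightarrow> cluster_algebra m (exch_matrix F lab) \<noteq> upper_cluster_algebra m (exch_matrix F lab))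
       \<and> (\<forall>n F m lab. n \<ge> 1 \<and> is_triangulation 1 n F m lab
            \<longrightarrow> cluster_algebra m (exch_matrix F lab) \<noteq> upper_cluster_algebra m (exch_matrix F lab))"
proof (intro conjI allI impI; elim conjE)
  fix g n F m :: nat and lab
  assume "n \<ge> 1" "(g, n) \<noteq> (0, 3)" "is_triangulation g n F m lab"
    "\<not> finitely_generated_ring (cluster_algebra m (exch_matrix F lab))"
  then show "cluster_algebra m (exch_matrix F lab) \<noteq> upper_cluster_algebra m (exch_matrix F lab)"
    by (intro triangulation.not_finitely_generated_imp_neq [of g n]) (simp_all add: triangulation_def)
next
  fix n F m :: nat and lab
  assume "n \<ge> 1" "is_triangulation 1 n F m lab"
  then show "cluster_algebra m (exch_matrix F lab) \<noteq> upper_cluster_algebra m (exch_matrix F lab)"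
    by (intro triangulation.positive_genus_neq [of 1 n]) (simp_all add: triangulation_def)
qed

end
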